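(* Let $D$ be a connected digraph, let $(X,H)$ be a cover of $D$, and let $f:V(H)\to\mathbb{N}_0^2$. Then $(D,X,H,f)$ is an uncolorable degree-feasible configuration if and only if $(D,X,H,f)$ is constructible.
   Context: All digraphs are finite, without loops and parallel arcs (digons allowed); $d_D(v)=(d^+_D(v),d^-_D(v))$; pairs in $\mathbb{N}_0^2$ are compared and added coordinatewise. Connected, block (maximal connected subdigraph with no vertex whose removal disconnects it) refer to the underlying graph. $D^\pm(G)$: replace each edge of undirected $G$ by a digon. Antidirected cycle: underlying graph a cycle, each vertex a source or a sink. Cover of $D$: pair $(X,H)$, $H$ disjoint from $D$, sets $X_v\subseteq V(H)$ ($v\in V(D)$) pairwise disjoint with union $V(H)$, each independent in $H$, and for distinct $u,v$ the arcs of $H$ from $X_u$ to $X_v$ form a matching if $uv\in A(D)$, none otherwise. Transversal: $T$ with $|T\cap X_v|=1$ for all $v$. For $U\subseteq V(H)$, the subcover $(X,H)/U$ is the cover $(X',H[U])$ of $D[\{v:X_v\cap U\ne\varnothing\}]$ with $X'_v=X_v\cap U$. A cover is saturated if for every arc $uv$ of the digraph, the arcs from $X_u$ to $X_v$ form a perfect matching of $H[X_u\cup X_v]$. For $f:V(H)\to\mathbb{N}_0^2$, $f=(f^+,f^-)$, $f(Y)=\sum_{y\in Y}f(y)$. $H$ is strictly $f$-degenerate if every nonempty subdigraph $H'$ of $H$ has a vertex $x$ with $d^+_{H'}(x)<f^+(x)$ or $d^-_{H'}(x)<f^-(x)$. A configuration is a tuple $(D,X,H,f)$ with $(X,H)$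 a cover of $D$ and $f:V(H)\to\mathbb{N}_0^2$; it is degree-feasible if $f(X_v)\ge d_D(v)$ for all $v\in V(D)$, colorable if some transversal $T$ of $(X,H)$ has $H[T]$ strictly $f$-degenerate, and uncolorable otherwise. A configuration $(D,X,H,f)$ is constructible if one of the following holds (recursively): (I) M-configuration: $D$ is a block and there is a transversal $T$ with $(X,H)/T$ saturated, $f(x)=d_D(v)$ for $x\in T\cap X_v$ and $f(x)=(0,0)$ for $x\notin T$. (II) K-configuration: $D=D^\pm(K_n)$, $n\ge1$, there are $n_1,\dots,n_p\in\mathbb{N}$, $p\ge1$, $n_1+\dots+n_p=n-1$, and pairwise disjoint transversals $T_1,\dots,T_p$ with each $(X,H)/T_i$ saturated, $f(x)=(n_i,n_i)$ for $x\in T_i$ and $f(x)=(0,0)$ for $x\notin T_1\cup\dots\cup T_p$. (III) odd C-configuration: $D=D^\pm(C_n)$, $n\ge5$ odd, there are disjoint transversals $T_1,T_2$ with $(X,H)/T_i$ saturated, $f(x)=(1,1)$ on $T_1\cup T_2$ and $(0,0)$ elsewhere. (IV) even C-configuration: $D=D^\pm(C_n)$, $n\ge4$ even, there are disjoint transversals $T_1,T_2$ with $H[T_1\cup T_2]=D^\pm(C_{2n})$, $f=(1,1)$ on $T_1\cup T_2$ and $(0,0)$ elsewhere. (V) A-configuration: $D$ is an antidirected cycle on $n\ge4$ vertices, $n$ even, there are disjoint transversals $T_1,T_2$ with $H[T_1\cup T_2]$ an antidirected cycle on $2n$ vertices, and for $x\in X_v$: $f(x)=(1,0)$ if $x\in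 T_1\cup T_2$ and $v$ is a source of $D$, $f(x)=(0,1)$ if $x\in T_1\cup T_2$ and $v$ is a sink, $f(x)=(0,0)$ otherwise. (VI) Merging: there are disjoint constructible configurations $(D^1,X^1,H^1,f^1)$, $(D^2,X^2,H^2,f^2)$ with $|D^i|<|D|$, $D$ is obtained from $D^1,D^2$ by identifying $v^1\in V(D^1)$ and $v^2\in V(D^2)$ into a vertex $v^\star$, $H$ is obtained from $H^1,H^2$ by choosing a bijection $\pi:X^1_{v^1}\to X^2_{v^2}$ and identifying each $x$ with $\pi(x)$, and $f=f^1$ on $V(H^1)\setminus X^1_{v^1}$, $f=f^2$ on $V(H^2)\setminus X^2_{v^2}$, and $f=f^1(x)+f^2(\pi(x))$ at the vertex obtained from $x$ and $\pi(x)$.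
   Formalization: The cover digraph H is assumed to have at least one vertex; without this the claim fails for D a single vertex v with X_v empty, which is uncolorable and degree-feasible but not constructible. *)

theory Defs
  imports
    "Graph_Theory.Digraph_Isomorphism"
    "HOL-Library.Product_Plus"
    "HOL-Library.Product_Order"
    "HOL-Library.Disjoint_Sets"
begin

text \<open>
  Finite digraphs without loops and parallel arcs are given by \<^locale>\<open>pair_digraph\<close>.
  Notions that are also applied to subdigraphs obtained with the library operation
  \<^const>\<open>induce_subgraph\<close> are stated for \<^typ>\<open>('a, 'b) pre_digraph\<close>.
  The type \<^typ>\<open>nat \<times> nat\<close> is added and ordered coordinatewise.
\<close>

section \<open>Digraphs\<close>

definition degree_pair :: "('a, 'e) pre_digraph \<Rightarrow> 'a \<Rightarrow> nat \<times> nat" where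
  "degree_pair G v = (out_degree G v, in_degree G v)"

definition is_source :: "('a, 'e) pre_digraph \<Rightarrow> 'a \<Rightarrow> bool" where
  "is_source G v \<longleftrightarrow> v \<in> verts G \<and> in_degree G v = 0"

definition is_sink :: "('a, 'e) pre_digraph \<Rightarrow> 'a \<Rightarrow> bool" where
  "is_sink G v \<longleftrightarrow> v \<in> verts G \<and> out_degree G v = 0"

text \<open>
  The constant \<^const>\<open>Digraph_Component.connected\<close> refers to the underlying graph and is false
  for the digraph without vertices, hence the guard below for one-vertex digraphs.
\<close>

definition no_separating_vertex :: "('a, 'e) pre_digraph \<Rightarrow> bool" where
  "no_separating_vertex G \<longleftrightarrow>
     (\<forall>v \<in> verts G. verts G - {v} \<noteq> {} \<longrightarrow> Digraph_Component.connected (pre_digraph.del_vert G v))"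

definition is_block_of :: "('a, 'e) pre_digraph \<Rightarrow> ('a, 'e) pre_digraph \<Rightarrow> bool" where
  "is_block_of B G \<longleftrightarrow>
     pre_digraph.max_subgraph G (\<lambda>B'. Digraph_Component.connected B' \<and> no_separating_vertex B') B"

abbreviation is_block :: "('a, 'e) pre_digraph \<Rightarrow> bool" where
  "is_block G \<equiv> is_block_of G G"

text \<open>An undirected simple graph is given here by its vertex set and its set of two-element edges.\<close>

definition bidirect :: "'a set \<Rightarrow> 'a set set \<Rightarrow> 'a pair_pre_digraph" where
  "bidirect V E = \<lparr> pverts = V, parcs = {(u, v). u \<in> V \<and> v \<in> V \<and> u \<noteq> v \<and> {u, v} \<in> E} \<rparr>"

definition bidirected_complete :: "nat \<Rightarrow> nat pair_pre_digraph" where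
  "bidirected_complete n = bidirect {..<n} {{i, j} | i j. i < n \<and> j < n \<and> i \<noteq> j}"

definition bidirected_cycle :: "nat \<Rightarrow> nat pair_pre_digraph" where
  "bidirected_cycle n = bidirect {..<n} {{i, (i + 1) mod n} | i. i < n}"

text \<open>
  The underlying graph is compared through its symmetric digraph \<^const>\<open>mk_symmetric\<close>; this
  forgets multiplicities, but a digon is impossible when every vertex is a source or a sink.
\<close>

definition antidirected_cycle :: "nat \<Rightarrow> ('a, 'e) pre_digraph \<Rightarrow> bool" where
  "antidirected_cycle n G \<longleftrightarrow> 3 \<le> n \<and>
     digraph_iso (with_proj (mk_symmetric G)) (with_proj (bidirected_cycle n)) \<and>
     (\<forall>v \<in> verts G. is_source G v \<or> is_sink G v)"


section \<open>Covers\<close>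

definition arcs_from_to :: "('b, 'e) pre_digraph \<Rightarrow> 'b set \<Rightarrow> 'b set \<Rightarrow> ('b \<times> 'b) set" where
  "arcs_from_to G A B = {(x, y) \<in> arcs_ends G. x \<in> A \<and> y \<in> B}"

definition matching :: "('b \<times> 'b) set \<Rightarrow> bool" where
  "matching M \<longleftrightarrow> (\<forall>e \<in> M. \<forall>e' \<in> M. e \<noteq> e' \<longrightarrow> {fst e, snd e} \<inter> {fst e', snd e'} = {})"

definition perfect_matching :: "('b, 'e) pre_digraph \<Rightarrow> ('b \<times> 'b) set \<Rightarrow> bool" where
  "perfect_matching G M \<longleftrightarrow>
     M \<subseteq> arcs_ends G \<and> matching M \<and> (\<Union>e \<in> M. {fst e, snd e}) = verts G"

definition is_cover :: "'a pair_pre_digraph \<Rightarrow> ('a \<Rightarrow> 'b set) \<Rightarrow> 'b pair_pre_digraph \<Rightarrow> bool" where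
  "is_cover D X H \<longleftrightarrow>
     pair_digraph H \<and>
     disjoint_family_on X (pverts D) \<and>
     (\<Union>v \<in> pverts D. X v) = pverts H \<and>
     (\<forall>v \<in> pverts D. arcs_from_to H (X v) (X v) = {}) \<and>
     (\<forall>u \<in> pverts D. \<forall>v \<in> pverts D. u \<noteq> v \<longrightarrow>
        (if (u, v) \<in> parcs D then matching (arcs_from_to H (X u) (X v))
         else arcs_from_to H (X u) (X v) = {}))"

definition transversal :: "'a pair_pre_digraph \<Rightarrow> ('a \<Rightarrow> 'b set) \<Rightarrow> 'b pair_pre_digraph \<Rightarrow> 'b set \<Rightarrow> bool" where
  "transversal D X H T \<longleftrightarrow> T \<subseteq> pverts H \<and> (\<forall>v \<in> pverts D. card (T \<inter> X v) = 1)"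

definition saturated :: "('a, 'e) pre_digraph \<Rightarrow> ('a \<Rightarrow> 'b set) \<Rightarrow> ('b, 'c) pre_digraph \<Rightarrow> bool" where
  "saturated G X H \<longleftrightarrow>
     (\<forall>(u, v) \<in> arcs_ends G. perfect_matching (H \<restriction> (X u \<union> X v)) (arcs_from_to H (X u) (X v)))"

text \<open>\<open>saturated_subcover D X H U\<close>: the subcover $(X,H)/U$ is saturated.\<close>

definition saturated_subcover ::
  "'a pair_pre_digraph \<Rightarrow> ('a \<Rightarrow> 'b set) \<Rightarrow> 'b pair_pre_digraph \<Rightarrow> 'b set \<Rightarrow> bool" where
  "saturated_subcover D X H U \<longleftrightarrow>
     saturated (D \<restriction> {v \<in> pverts D. X v \<inter> U \<noteq> {}}) (\<lambda>v. X v \<inter> U) (H \<restriction> U)"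


section \<open>Configurations\<close>

definition strictly_degenerate :: "('b, 'e) pre_digraph \<Rightarrow> ('b \<Rightarrow> nat \<times> nat) \<Rightarrow> bool" where
  "strictly_degenerate G f \<longleftrightarrow>
     (\<forall>H'. subgraph H' G \<and> verts H' \<noteq> {} \<longrightarrow>
        (\<exists>x \<in> verts H'. out_degree H' x < fst (f x) \<or> in_degree H' x < snd (f x)))"

definition configuration ::
  "'a pair_pre_digraph \<Rightarrow> ('a \<Rightarrow> 'b set) \<Rightarrow> 'b pair_pre_digraph \<Rightarrow> ('b \<Rightarrow> nat \<times> nat) \<Rightarrow> bool" where
  "configuration D X H f \<longleftrightarrow> pair_digraph D \<and> is_cover D X H"

definition degree_feasible ::
  "'a pair_pre_digraph \<Rightarrow> ('a \<Rightarrow> 'b set) \<Rightarrow> 'b pair_pre_digraph \<Rightarrow> ('b \<Rightarrow> nat \<times> nat) \<Rightarrow> bool" where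
  "degree_feasible D X H f \<longleftrightarrow>
     configuration D X H f \<and> (\<forall>v \<in> pverts D. (\<Sum>x \<in> X v. f x) \<ge> degree_pair D v)"

definition colorable ::
  "'a pair_pre_digraph \<Rightarrow> ('a \<Rightarrow> 'b set) \<Rightarrow> 'b pair_pre_digraph \<Rightarrow> ('b \<Rightarrow> nat \<times> nat) \<Rightarrow> bool" where
  "colorable D X H f \<longleftrightarrow>
     configuration D X H f \<and> (\<exists>T. transversal D X H T \<and> strictly_degenerate (H \<restriction> T) f)"

definition uncolorable ::
  "'a pair_pre_digraph \<Rightarrow> ('a \<Rightarrow> 'b set) \<Rightarrow> 'b pair_pre_digraph \<Rightarrow> ('b \<Rightarrow> nat \<times> nat) \<Rightarrow> bool" where
  "uncolorable D X H f \<longleftrightarrow> configuration D X H f \<and> \<not> colorable D X H f"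


section \<open>Constructible configurations\<close>

definition M_configuration ::
  "'a pair_pre_digraph \<Rightarrow> ('a \<Rightarrow> 'b set) \<Rightarrow> 'b pair_pre_digraph \<Rightarrow> ('b \<Rightarrow> nat \<times> nat) \<Rightarrow> bool" where
  "M_configuration D X H f \<longleftrightarrow>
     configuration D X H f \<and> is_block (with_proj D) \<and>
     (\<exists>T. transversal D X H T \<and> saturated_subcover D X H T \<and>
        (\<forall>v \<in> pverts D. \<forall>x \<in> T \<inter> X v. f x = degree_pair D v) \<and>
        (\<forall>x \<in> pverts H - T. f x = (0, 0)))"

definition K_configuration ::
  "'a pair_pre_digraph \<Rightarrow> ('a \<Rightarrow> 'b set) \<Rightarrow> 'b pair_pre_digraph \<Rightarrow> ('b \<Rightarrow> nat \<times> nat) \<Rightarrow> bool" where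
  "K_configuration D X H f \<longleftrightarrow>
     configuration D X H f \<and>
     (\<exists>n \<ge> 1. digraph_iso (with_proj D) (with_proj (bidirected_complete n)) \<and>
       (\<exists>p \<ge> 1. \<exists>(m :: nat \<Rightarrow> nat) T.
          (\<forall>i \<in> {1..p}. m i \<ge> 1) \<and> (\<Sum>i = 1..p. m i) = n - 1 \<and>
          (\<forall>i \<in> {1..p}. transversal D X H (T i) \<and> saturated_subcover D X H (T i)) \<and>
          disjoint_family_on T {1..p} \<and>
          (\<forall>i \<in> {1..p}. \<forall>x \<in> T i. f x = (m i, m i)) \<and>
          (\<forall>x \<in> pverts H - (\<Union>i \<in> {1..p}. T i). f x = (0, 0))))"

definition odd_C_configuration ::
  "'a pair_pre_digraph \<Rightarrow> ('a \<Rightarrow> 'b set) \<Rightarrow> 'b pair_pre_digraph \<Rightarrow> ('b \<Rightarrow> nat \<times> nat) \<Rightarrow> bool" where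
  "odd_C_configuration D X H f \<longleftrightarrow>
     configuration D X H f \<and>
     (\<exists>n \<ge> 5. odd n \<and> digraph_iso (with_proj D) (with_proj (bidirected_cycle n))) \<and>
     (\<exists>T1 T2. transversal D X H T1 \<and> transversal D X H T2 \<and> T1 \<inter> T2 = {} \<and>
        saturated_subcover D X H T1 \<and> saturated_subcover D X H T2 \<and>
        (\<forall>x \<in> T1 \<union> T2. f x = (1, 1)) \<and>
        (\<forall>x \<in> pverts H - (T1 \<union> T2). f x = (0, 0)))"

definition even_C_configuration ::
  "'a pair_pre_digraph \<Rightarrow> ('a \<Rightarrow> 'b set) \<Rightarrow> 'b pair_pre_digraph \<Rightarrow> ('b \<Rightarrow> nat \<times> nat) \<Rightarrow> bool" where
  "even_C_configuration D X H f \<longleftrightarrow>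
     configuration D X H f \<and>
     (\<exists>n \<ge> 4. even n \<and> digraph_iso (with_proj D) (with_proj (bidirected_cycle n)) \<and>
       (\<exists>T1 T2. transversal D X H T1 \<and> transversal D X H T2 \<and> T1 \<inter> T2 = {} \<and>
          digraph_iso (H \<restriction> (T1 \<union> T2)) (with_proj (bidirected_cycle (2 * n))) \<and>
          (\<forall>x \<in> T1 \<union> T2. f x = (1, 1)) \<and>
          (\<forall>x \<in> pverts H - (T1 \<union> T2). f x = (0, 0))))"

definition A_configuration ::
  "'a pair_pre_digraph \<Rightarrow> ('a \<Rightarrow> 'b set) \<Rightarrow> 'b pair_pre_digraph \<Rightarrow> ('b \<Rightarrow> nat \<times> nat) \<Rightarrow> bool" where
  "A_configuration D X H f \<longleftrightarrow>
     configuration D X H f \<and>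
     (\<exists>n \<ge> 4. even n \<and> antidirected_cycle n (with_proj D) \<and>
       (\<exists>T1 T2. transversal D X H T1 \<and> transversal D X H T2 \<and> T1 \<inter> T2 = {} \<and>
          antidirected_cycle (2 * n) (H \<restriction> (T1 \<union> T2)) \<and>
          (\<forall>v \<in> pverts D. \<forall>x \<in> X v.
             (x \<in> T1 \<union> T2 \<and> is_source D v \<longrightarrow> f x = (1, 0)) \<and>
             (x \<in> T1 \<union> T2 \<and> is_sink D v \<longrightarrow> f x = (0, 1)) \<and>
             (x \<notin> T1 \<union> T2 \<longrightarrow> f x = (0, 0)))))"

text \<open>
  \<open>identification i1 G1 i2 G2 R G\<close>: the digraph \<open>G\<close> arises from the disjoint union of \<open>G1\<close> and
  \<open>G2\<close> by identifying \<open>x\<close> with \<open>y\<close> for all \<open>(x, y) \<in> R\<close>. The maps \<open>i1\<close> and \<open>i2\<close> send each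
  vertex to the vertex obtained from it. As \<open>G1\<close> and \<open>G2\<close> enter only through these maps, they
  count as disjoint even if their vertex sets overlap inside the type (which may be too small
  to contain disjoint copies).
\<close>

definition identification ::
  "('a \<Rightarrow> 'a) \<Rightarrow> 'a pair_pre_digraph \<Rightarrow> ('a \<Rightarrow> 'a) \<Rightarrow> 'a pair_pre_digraph \<Rightarrow> ('a \<times> 'a) set
     \<Rightarrow> 'a pair_pre_digraph \<Rightarrow> bool" where
  "identification i1 G1 i2 G2 R G \<longleftrightarrow>
     inj_on i1 (pverts G1) \<and> inj_on i2 (pverts G2) \<and>
     (\<forall>x \<in> pverts G1. \<forall>y \<in> pverts G2. i1 x = i2 y \<longleftrightarrow> (x, y) \<in> R) \<and>
     pverts G = i1 ` pverts G1 \<union> i2 ` pverts G2 \<and>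
     parcs G = map_prod i1 i1 ` parcs G1 \<union> map_prod i2 i2 ` parcs G2"

definition merging ::
  "'a pair_pre_digraph \<Rightarrow> ('a \<Rightarrow> 'b set) \<Rightarrow> 'b pair_pre_digraph \<Rightarrow> ('b \<Rightarrow> nat \<times> nat) \<Rightarrow>
   'a pair_pre_digraph \<Rightarrow> ('a \<Rightarrow> 'b set) \<Rightarrow> 'b pair_pre_digraph \<Rightarrow> ('b \<Rightarrow> nat \<times> nat) \<Rightarrow>
   'a pair_pre_digraph \<Rightarrow> ('a \<Rightarrow> 'b set) \<Rightarrow> 'b pair_pre_digraph \<Rightarrow> ('b \<Rightarrow> nat \<times> nat) \<Rightarrow> bool" where
  "merging D1 X1 H1 f1 D2 X2 H2 f2 D X H f \<longleftrightarrow>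
     (\<exists>v1 v2 \<pi> i1 i2 j1 j2.
        v1 \<in> pverts D1 \<and> v2 \<in> pverts D2 \<and>
        identification i1 D1 i2 D2 {(v1, v2)} D \<and>
        bij_betw \<pi> (X1 v1) (X2 v2) \<and>
        identification j1 H1 j2 H2 {(x, \<pi> x) | x. x \<in> X1 v1} H \<and>
        (\<forall>u \<in> pverts D1. X (i1 u) = j1 ` X1 u) \<and>
        (\<forall>u \<in> pverts D2. X (i2 u) = j2 ` X2 u) \<and>
        (\<forall>x \<in> pverts H1 - X1 v1. f (j1 x) = f1 x) \<and>
        (\<forall>y \<in> pverts H2 - X2 v2. f (j2 y) = f2 y) \<and>
        (\<forall>x \<in> X1 v1. f (j1 x) = f1 x + f2 (\<pi> x)))"

inductive constructible ::
  "'a pair_pre_digraph \<Rightarrow> ('a \<Rightarrow> 'b set) \<Rightarrow> 'b pair_pre_digraph \<Rightarrow> ('b \<Rightarrow> nat \<times> nat) \<Rightarrow> bool" where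
  M: "M_configuration D X H f \<Longrightarrow> constructible D X H f"
| K: "K_configuration D X H f \<Longrightarrow> constructible D X H f"
| odd_C: "odd_C_configuration D X H f \<Longrightarrow> constructible D X H f"
| even_C: "even_C_configuration D X H f \<Longrightarrow> constructible D X H f"
| A: "A_configuration D X H f \<Longrightarrow> constructible D X H f"
| merge: "\<lbrakk> constructible D1 X1 H1 f1; constructible D2 X2 H2 f2;
     configuration D X H f;
     card (pverts D1) < card (pverts D); card (pverts D2) < card (pverts D);
     merging D1 X1 H1 f1 D2 X2 H2 f2 D X H f \<rbrakk> \<Longrightarrow> constructible D X H f"

end

theory Submission
  imports Defs
begin

text \<open>
  Fix a transversal of part of the cover, coloured greedily, and lower \<open>f\<close> at every remaining
  vertex of \<open>H\<close> by the numbers of its arcs to and from the chosen vertices. The residual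
  configuration is again uncolorable and degree-feasible, and an uncolorable degree-feasible
  configuration on a connected digraph has no slack at all; so, as long as the remaining digraph
  is connected, every arc to a coloured vertex must be matched and must hit positive weight.

  Deleting single vertices of a block, this shows that the vertices of \<open>H\<close> with nonzero weight
  form a cover in which all matchings are perfect, with the same number \<open>p\<close> of vertices over
  each vertex of \<open>D\<close>. If \<open>p = 1\<close>, this is an M-configuration. If \<open>p \<ge> 2\<close>, the underlying
  graph is complete or a cycle: otherwise it has a smaller block \<open>B\<close> with a vertex \<open>b\<close> not
  adjacent to the rest \<open>U\<close> and a vertex \<open>c\<close> with exactly one neighbour in \<open>U\<close>. By induction the
  residual weight on \<open>B\<close> is determined by its values at \<open>b\<close>, which do not depend on the
  colouring of \<open>U\<close>, although its values at \<open>c\<close> do. Complete graphs are treated by comparing the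
  residuals after different colourings of one vertex, and cycles by colouring along the cycle.
  At a cut vertex the residual weights of the two sides add up to \<open>f\<close>, which gives a merging.
\<close>

section \<open>Connectivity, blocks and cycles\<close>

text \<open>Slack destroys uncolorability because strict degeneracy asks for only one of two
  inequalities at each vertex: if a vertex with room in either direction is kept for the end, its
  removal lowers a degree of each neighbour and so passes the slack on. The price of this freedom is
  the main obstacle. A priori the two weights of a vertex of \<open>H\<close> are unrelated, and the
  two matchings of a digon may disagree; tightness speaks about each direction separately. For
  \<open>p \<ge> 2\<close> the link comes from comparing two colours of one vertex. On complete
  graphs, one colour changes a residual in one direction only and another colour changes it in
  neither, yet the smaller configuration is balanced after both. On cycles, a digon with two
  different matchings would let a colouring along the cycle arrive at either colour of the last
  vertex but one, and the last vertex would have to be blocked equally by both, which no matching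
  allows. For \<open>p = 1\<close> no second colour exists to compare with, which is why
  M-configurations impose no shape on the block.\<close>

locale ugraph =
  fixes adj :: "'a \<Rightarrow> 'a \<Rightarrow> bool"
  assumes adj_sym: "adj u v \<Longrightarrow> adj v u"
    and adj_irrefl: "\<not> adj v v"
begin

text \<open>Stated by cuts rather than paths, because most uses need an edge that leaves a given
  proper subset. The empty set is excluded, in agreement with the library's
  \<open>connected\<close>.\<close>

definition conn :: "'a set \<Rightarrow> bool" where
  "conn W \<longleftrightarrow> W \<noteq> {} \<and> (\<forall>P. P \<subseteq> W \<longrightarrow> P \<noteq> {} \<longrightarrow> P \<noteq> W \<longrightarrow> (\<exists>u\<in>P. \<exists>v\<in>W - P. adj u v))"

text \<open>The guard admits a single vertex as a block; a single edge qualifies as well.\<close>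

definition biconn :: "'a set \<Rightarrow> bool" where
  "biconn W \<longleftrightarrow> conn W \<and> (\<forall>v\<in>W. W - {v} \<noteq> {} \<longrightarrow> conn (W - {v}))"

text \<open>The equivalence excludes chords, so every vertex has at most two neighbours in
  \<open>W\<close>.\<close>

definition cycle_enum :: "nat \<Rightarrow> (nat \<Rightarrow> 'a) \<Rightarrow> 'a set \<Rightarrow> bool" where
  "cycle_enum n v W \<longleftrightarrow> 3 \<le> n \<and> bij_betw v {..<n} W \<and>
     (\<forall>i<n. \<forall>j<n. adj (v i) (v j) \<longleftrightarrow> j = Suc i mod n \<or> i = Suc j mod n)"

lemma not_singleton_if_card: "2 \<le> card W \<Longrightarrow> W \<noteq> {a}"
  by auto

lemma conn_cut:
  assumes "conn W" "P \<subseteq> W" "P \<noteq> {}" "P \<noteq> W"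
  obtains u v where "u \<in> P" "v \<in> W - P" "adj u v"
  using assms unfolding conn_def by blast

lemma conn_nonempty: "conn W \<Longrightarrow> W \<noteq> {}"
  by (simp add: conn_def)

text \<open>A cut that splits \<open>B\<close> is crossed inside \<open>B\<close>. Otherwise one
  side of the cut avoids \<open>B\<close>, and the hypothesis applies to that side.\<close>

lemma conn_attach:
  assumes B: "conn B"
    and Y: "\<And>R. R \<subseteq> Y \<Longrightarrow> R \<noteq> {} \<Longrightarrow> \<exists>u\<in>R. \<exists>v\<in>(B \<union> Y) - R. adj u v"
  shows "conn (B \<union> Y)"
  unfolding conn_def
proof (intro conjI allI impI)
  show "B \<union> Y \<noteq> {}" using conn_nonempty[OF B] by simp
next
  fix P assume P: "P \<subseteq> B \<union> Y" "P \<noteq> {}" "P \<noteq> B \<union> Y"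
  consider "P \<inter> B = {}" | "B \<subseteq> P" | "P \<inter> B \<noteq> {}" "P \<inter> B \<noteq> B" by blast
  then show "\<exists>u\<in>P. \<exists>v\<in>(B \<union> Y) - P. adj u v"
  proof cases
    case 1
    then show ?thesis using P Y[of P] by blast
  next
    case 2
    then have "(B \<union> Y) - P \<subseteq> Y" "(B \<union> Y) - P \<noteq> {}" using P by auto
    from Y[OF this] show ?thesis using adj_sym by blast
  next
    case 3
    then obtain u v where "u \<in> P \<inter> B" "v \<in> B - P \<inter> B" "adj u v"
      using conn_cut[OF B, of "P \<inter> B"] by blast
    then show ?thesis by blast
  qed
qed

lemma conn_singleton: "conn {v}"
  unfolding conn_def by blast

lemma conn_insert:
  assumes "conn B" "v \<in> B" "adj u v"
  shows "conn (insert u B)"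
proof -
  have "conn (B \<union> {u})"
    using assms adj_irrefl by (intro conn_attach) (auto dest: subset_singletonD)
  then show ?thesis by simp
qed

lemma conn_complete:
  assumes "W \<noteq> {}" "\<And>u v. u \<in> W \<Longrightarrow> v \<in> W \<Longrightarrow> u \<noteq> v \<Longrightarrow> adj u v"
  shows "conn W"
  unfolding conn_def
proof (intro conjI allI impI)
  fix P assume "P \<subseteq> W" "P \<noteq> {}" "P \<noteq> W"
  then obtain u v where "u \<in> P" "v \<in> W - P" by blast
  moreover have "adj u v" using calculation \<open>P \<subseteq> W\<close> assms(2) by blast
  ultimately show "\<exists>u\<in>P. \<exists>v\<in>W - P. adj u v" by blast
qed (use assms in auto)

lemma biconn_complete:
  assumes "W \<noteq> {}" "\<And>u v. u \<in> W \<Longrightarrow> v \<in> W \<Longrightarrow> u \<noteq> v \<Longrightarrow> adj u v"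
  shows "biconn W"
  unfolding biconn_def using assms by (auto intro!: conn_complete)

lemma conn_successively:
  "p \<noteq> [] \<Longrightarrow> successively adj p \<Longrightarrow> conn (set p)"
proof (induction p)
  case (Cons a p)
  show ?case
  proof (cases "p = []")
    case True
    then show ?thesis by (simp add: conn_singleton)
  next
    case False
    then have "conn (set p)" "adj a (hd p)"
      using Cons by (auto simp: successively_Cons)
    then show ?thesis using False conn_insert[of "set p" "hd p" a] by simp
  qed
qed simp

text \<open>A maximal proper connected subset misses exactly one vertex, since it stays connected
  when an outside neighbour is added.\<close>

lemma exists_noncut:
  assumes "finite Q" "conn Q" "2 \<le> card Q"
  shows "\<exists>z\<in>Q. conn (Q - {z})"
proof -
  let ?F = "{C. C \<subset> Q \<and> conn C}"
  obtain q where q: "q \<in> Q" using conn_nonempty[OF assms(2)] by blast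
  then have "{q} \<in> ?F" using assms(3) conn_singleton by (auto simp: psubset_eq)
  moreover have "finite ?F" using assms(1) by (auto intro: finite_subset[of _ "Pow Q"])
  ultimately obtain C where C: "C \<in> ?F" and max: "\<forall>C'\<in>?F. C \<subseteq> C' \<longrightarrow> C = C'"
    using finite_has_maximal[of ?F] by (metis (no_types, lifting) empty_iff)
  then have "C \<subseteq> Q" "C \<noteq> {}" "C \<noteq> Q" using conn_nonempty by blast+
  then obtain u v where uv: "u \<in> C" "v \<in> Q - C" "adj u v"
    using conn_cut[OF assms(2)] by blast
  then have "conn (insert v C)" using C conn_insert[of C u v] adj_sym by blast
  then have "insert v C = Q" using max C uv by blast
  then have "Q - {v} = C" using uv by blast
  then show ?thesis using C uv by blast
qed

text \<open>A minimal nonempty set without outgoing edges inside \<open>U\<close> is connected: a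
  part of it without edges to its rest would be a smaller such set.\<close>

lemma exists_component:
  assumes "finite U" "U \<noteq> {}"
  shows "\<exists>R. R \<subseteq> U \<and> conn R \<and> (\<forall>u\<in>R. \<forall>v\<in>U - R. \<not> adj u v)"
proof -
  let ?F = "{R. R \<subseteq> U \<and> R \<noteq> {} \<and> (\<forall>u\<in>R. \<forall>v\<in>U - R. \<not> adj u v)}"
  have "finite ?F" using assms(1) by (auto intro: finite_subset[of _ "Pow U"])
  moreover have "U \<in> ?F" using assms by auto
  ultimately obtain R where R: "R \<in> ?F" and min: "\<forall>R'\<in>?F. R' \<subseteq> R \<longrightarrow> R = R'"
    using finite_has_minimal[of ?F] by (metis (no_types, lifting) empty_iff)
  have "conn R"
    unfolding conn_def
  proof (intro conjI allI impI)
    fix P assume P: "P \<subseteq> R" "P \<noteq> {}" "P \<noteq> R"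
    show "\<exists>u\<in>P. \<exists>v\<in>R - P. adj u v"
    proof (rule ccontr)
      assume "\<not> ?thesis"
      then have "P \<in> ?F" using P R by blast
      then show False using min P by blast
    qed
  qed (use R in auto)
  then show ?thesis using R by blast
qed

lemma walk_exists:
  assumes "conn W" "s \<in> W" "t \<in> W"
  shows "\<exists>p. p \<noteq> [] \<and> hd p = s \<and> last p = t \<and> set p \<subseteq> W \<and> successively adj p"
proof -
  let ?P = "{v\<in>W. \<exists>p. p \<noteq> [] \<and> hd p = s \<and> last p = v \<and> set p \<subseteq> W \<and> successively adj p}"
  have "s \<in> ?P" using assms by (auto intro!: exI[of _ "[s]"])
  have "?P = W"
  proof (rule ccontr)
    assume "?P \<noteq> W"
    then obtain u v where uv: "u \<in> ?P" "v \<in> W - ?P" "adj u v"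
      using conn_cut[OF assms(1), of ?P] \<open>s \<in> ?P\<close> by blast
    then obtain p where "p \<noteq> []" "hd p = s" "last p = u" "set p \<subseteq> W" "successively adj p"
      by blast
    then have "p @ [v] \<noteq> []" "hd (p @ [v]) = s" "last (p @ [v]) = v" "set (p @ [v]) \<subseteq> W"
      "successively adj (p @ [v])"
      using uv by (auto simp: successively_append_iff)
    then show False using uv by blast
  qed
  then show ?thesis using assms(3) by blast
qed

lemma biconn_conn: "biconn W \<Longrightarrow> conn W"
  by (simp add: biconn_def)

lemma biconn_delete: "biconn W \<Longrightarrow> v \<in> W \<Longrightarrow> W \<noteq> {v} \<Longrightarrow> conn (W - {v})"
  unfolding biconn_def by blast

lemma conn_neighbour:
  assumes "conn W" "v \<in> W" "W \<noteq> {v}"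
  shows "\<exists>u\<in>W. adj v u"
  using conn_cut[OF assms(1), of "{v}"] assms by blast

text \<open>Once a neighbour \<open>s\<close> is deleted, the remaining set is still connected and
  supplies the second one.\<close>

lemma biconn_two_neighbours:
  assumes "biconn W" "3 \<le> card W" "a \<in> W"
  shows "\<exists>s\<in>W. \<exists>t\<in>W. s \<noteq> t \<and> adj a s \<and> adj a t"
proof -
  have "W \<noteq> {a}" using assms by auto
  then obtain s where s: "s \<in> W" "adj a s"
    using conn_neighbour[OF biconn_conn[OF assms(1)]] assms by blast
  have "W \<noteq> {s}" using s assms adj_irrefl by auto
  then have c: "conn (W - {s})" using biconn_delete assms s by blast
  have card: "card (W - {s}) \<ge> 2" using assms s by simp
  have ne: "W - {s} \<noteq> {a}"
  proof
    assume "W - {s} = {a}"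
    then have "card (W - {s}) = 1" by (simp only: card.empty card_insert_disjoint) simp
    then show False using card by simp
  qed
  have "a \<in> W - {s}" using assms s adj_irrefl by blast
  then obtain t where "t \<in> W - {s}" "adj a t"
    using conn_neighbour[OF c _ ne] by blast
  then show ?thesis using s by blast
qed

lemma cycle_enum_range:
  assumes "cycle_enum n v W" "i < n"
  shows "v i \<in> W"
  using assms unfolding cycle_enum_def bij_betw_def by auto

lemma cycle_enum_eq_iff:
  assumes "cycle_enum n v W" "i < n" "j < n"
  shows "v i = v j \<longleftrightarrow> i = j"
  using assms unfolding cycle_enum_def bij_betw_def inj_on_def by auto

lemma cycle_enum_surj:
  assumes "cycle_enum n v W" "w \<in> W"
  obtains i where "i < n" "w = v i"
  using assms unfolding cycle_enum_def bij_betw_def by auto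

text \<open>The cycle minus \<open>v k\<close> is the walk through the n - 1 indices following
  \<open>k\<close>, read modulo \<open>n\<close>, so every deletion leaves a connected set.\<close>

lemma biconn_cycle:
  assumes "cycle_enum n v W"
  shows "biconn W"
proof -
  have n: "3 \<le> n" using assms by (simp add: cycle_enum_def)
  have step: "adj (v i) (v (Suc i mod n))" if "i < n" for i
    using assms that n unfolding cycle_enum_def by auto
  have walk: "conn ((\<lambda>i. v (i mod n)) ` {k..<k + m})" if "m > 0" for k m
  proof -
    have "successively adj (map (\<lambda>i. v (i mod n)) [k..<k + m])"
      using step[of "_ mod n"] n by (auto simp: successively_conv_nth mod_Suc_eq)
    from conn_successively[OF _ this] that show ?thesis by simp
  qed
  have W: "W = v ` {..<n}" and inj: "inj_on v {..<n}"
    using assms by (auto simp: cycle_enum_def bij_betw_def)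
  have img: "(\<lambda>i. v (i mod n)) ` {k..<k + n} = W" for k
  proof (induction k)
    case 0
    then show ?case using W by (auto simp: image_iff)
  next
    case (Suc k)
    have "{k..<k + n} = insert k {Suc k..<k + n}" "{Suc k..<Suc k + n} = insert (k + n) {Suc k..<k + n}"
      using n by auto
    then show ?case using Suc by auto
  qed
  have "conn W" using walk[of n 0] img[of 0] n by simp
  moreover have "conn (W - {w})" if "w \<in> W" for w
  proof -
    obtain k where k: "k < n" "w = v k" using cycle_enum_surj[OF assms \<open>w \<in> W\<close>] by blast
    have "{k..<k + n} = insert k {Suc k..<Suc k + (n - 1)}" using n by auto
    then have "W = insert (v k) ((\<lambda>i. v (i mod n)) ` {Suc k..<Suc k + (n - 1)})"
      using img[of k] k by auto
    \<comment> \<open>By counting: otherwise n - 1 indices would cover all n vertices.\<close>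
    moreover have "v k \<notin> (\<lambda>i. v (i mod n)) ` {Suc k..<Suc k + (n - 1)}"
    proof
      assume "v k \<in> (\<lambda>i. v (i mod n)) ` {Suc k..<Suc k + (n - 1)}"
      then have "W = (\<lambda>i. v (i mod n)) ` {Suc k..<Suc k + (n - 1)}"
        using calculation by auto
      then have "card W \<le> n - 1" by (metis add_diff_cancel_left' card_atLeastLessThan card_image_le finite_atLeastLessThan)
      moreover have "card W = n" using W inj by (simp add: card_image)
      ultimately show False using n by simp
    qed
    ultimately have "W - {w} = (\<lambda>i. v (i mod n)) ` {Suc k..<Suc k + (n - 1)}"
      using k by (metis Diff_insert_absorb)
    then show ?thesis using walk[of "n - 1" "Suc k"] n by simp
  qed
  ultimately show ?thesis by (simp add: biconn_def)
qed

end

section \<open>Ears, chordless cycles and the choice of a proper sub-block\<close>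

context ugraph
begin

definition attached :: "'a set \<Rightarrow> 'a \<Rightarrow> bool" where
  "attached Q b \<longleftrightarrow> (\<exists>q\<in>Q. adj q b)"

definition two_attached :: "'a set \<Rightarrow> 'a set \<Rightarrow> bool" where
  "two_attached B Q \<longleftrightarrow> (\<exists>b1\<in>B. \<exists>b2\<in>B. b1 \<noteq> b2 \<and> attached Q b1 \<and> attached Q b2)"

lemma conn_universal:
  assumes "u \<in> S" "\<And>w. w \<in> S \<Longrightarrow> w \<noteq> u \<Longrightarrow> adj u w"
  shows "conn S"
proof -
  have "conn ({u} \<union> (S - {u}))"
    using assms adj_sym by (intro conn_attach conn_singleton) blast
  then show ?thesis using assms(1) by (simp add: insert_absorb)
qed

text \<open>\<open>Q\<close> is minimal among the connected sets attached to two vertices of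
  \<open>B\<close>. If deleting a vertex \<open>z\<close> of \<open>Q\<close> cut off a part
  \<open>R\<close>, then \<open>Q - R\<close> would be a smaller connected set with the same two
  attachments.\<close>

lemma biconn_ear:
  assumes Q: "conn Q" and B: "biconn B" "2 \<le> card B" and disj: "Q \<inter> B = {}"
    and two: "two_attached B Q"
    and min: "\<And>Q'. Q' \<subset> Q \<Longrightarrow> conn Q' \<Longrightarrow> \<not> two_attached B Q'"
  shows "biconn (B \<union> Q)"
proof -
  obtain b1 b2 q1 q2 where b: "b1 \<in> B" "b2 \<in> B" "b1 \<noteq> b2" "q1 \<in> Q" "q2 \<in> Q" "adj q1 b1" "adj q2 b2"
    using two unfolding two_attached_def attached_def by blast
  have cut: "\<exists>u\<in>R. \<exists>v\<in>(B' \<union> Q) - R. adj u v"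
    if "R \<subseteq> Q" "R \<noteq> {}" "B' \<subseteq> B" "b1 \<in> B' \<or> b2 \<in> B'" for R B'
  proof (cases "R = Q")
    case True
    then show ?thesis using that b disj by blast
  next
    case False
    then show ?thesis using conn_cut[OF Q that(1,2)] by blast
  qed
  have "conn (B \<union> Q)"
    using B b by (intro conn_attach cut) (auto simp: biconn_def)
  moreover have "conn (B \<union> Q - {z})" if "z \<in> B" for z
  proof -
    have "B \<noteq> {z}" using B(2) by auto
    then have "conn (B - {z})" using biconn_delete[OF B(1) that] by simp
    then have "conn ((B - {z}) \<union> Q)"
      using b by (intro conn_attach cut) auto
    moreover have "B \<union> Q - {z} = (B - {z}) \<union> Q" using that disj by blast
    ultimately show ?thesis by simp
  qed
  moreover have "conn (B \<union> Q - {z})" if z: "z \<in> Q" for z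
  proof -
    have "conn (B \<union> (Q - {z}))"
    proof (rule conn_attach)
      show "conn B" using B by (simp add: biconn_def)
      fix R assume R: "R \<subseteq> Q - {z}" "R \<noteq> {}"
      show "\<exists>u\<in>R. \<exists>v\<in>B \<union> (Q - {z}) - R. adj u v"
      proof (rule ccontr)
        assume closed: "\<not> ?thesis"
        \<comment> \<open>Inside \<open>B \<union> Q\<close> the set \<open>R\<close> has outside
          neighbours at most in \<open>z\<close>, so an edge leaving a set without \<open>z\<close>
          cannot end in \<open>R\<close>. Sets that contain \<open>z\<close> are handled through
          their complement.\<close>
        have half: "\<exists>u\<in>P. \<exists>v\<in>(Q - R) - P. adj u v"
          if P: "P \<subseteq> Q - R" "P \<noteq> {}" "z \<notin> P" for P
        proof -
          obtain u v where uv: "u \<in> P" "v \<in> Q - P" "adj u v"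
            using conn_cut[OF Q, of P] P z by blast
          then have "v \<notin> R" using closed P adj_sym disj by blast
          then show ?thesis using uv by blast
        qed
        have "conn (Q - R)"
          unfolding conn_def
        proof (intro conjI allI impI)
          show "Q - R \<noteq> {}" using z R by blast
        next
          fix P assume P: "P \<subseteq> Q - R" "P \<noteq> {}" "P \<noteq> Q - R"
          show "\<exists>u\<in>P. \<exists>v\<in>(Q - R) - P. adj u v"
          proof (cases "z \<in> P")
            case True
            then show ?thesis using half[of "(Q - R) - P"] P adj_sym by blast
          qed (use half P in blast)
        qed
        moreover have "Q - R \<subset> Q" using R by blast
        moreover have "two_attached B (Q - R)"
        proof -
          have "q1 \<notin> R" "q2 \<notin> R" using closed b disj R by blast+
          then show ?thesis using b unfolding two_attached_def attached_def by blast
        qed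
        ultimately show False using min by blast
      qed
    qed
    moreover have "B \<union> Q - {z} = B \<union> (Q - {z})" using z disj by blast
    ultimately show ?thesis by simp
  qed
  ultimately show ?thesis unfolding biconn_def by blast
qed

text \<open>The cycle is a shortest walk in \<open>W - {a}\<close> between two distinct neighbours
  of \<open>a\<close>, closed up by \<open>a\<close>. Chords, repetitions and further neighbours of
  \<open>a\<close> on the walk would all allow a shorter one.\<close>

lemma exists_chordless_cycle:
  assumes W: "biconn W" "3 \<le> card W"
  shows "\<exists>n v C. C \<subseteq> W \<and> cycle_enum n v C"
proof -
  obtain a where a: "a \<in> W" using conn_nonempty[OF biconn_conn[OF W(1)]] by blast
  define wk where "wk p \<longleftrightarrow> p \<noteq> [] \<and> set p \<subseteq> W - {a} \<and> successively adj p \<and> hd p \<noteq> last p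
    \<and> adj a (hd p) \<and> adj a (last p)" for p
  obtain s t where st: "s \<in> W" "t \<in> W" "s \<noteq> t" "adj a s" "adj a t"
    using biconn_two_neighbours[OF W a] by blast
  have "conn (W - {a})" using biconn_delete[OF W(1) a] not_singleton_if_card[of W a] W(2) by simp
  moreover have "s \<in> W - {a}" "t \<in> W - {a}" using st adj_irrefl by auto
  ultimately obtain p0 where "wk p0"
    using walk_exists[of "W - {a}" s t] st unfolding wk_def by metis
  then obtain p where p: "wk p" and min: "\<And>q. wk q \<Longrightarrow> length p \<le> length q"
    using ex_has_least_nat[of wk p0 length] by blast
  let ?m = "length p"
  have p': "p \<noteq> []" "set p \<subseteq> W - {a}" "successively adj p" "p ! 0 \<noteq> p ! (?m - 1)"
    "adj a (p ! 0)" "adj a (p ! (?m - 1))"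
    using p unfolding wk_def by (auto simp: hd_conv_nth last_conv_nth)
  have m: "2 \<le> ?m" using p' by (cases p rule: remdups_adj.cases) auto
  have step: "adj (p ! i) (p ! Suc i)" if "Suc i < ?m" for i
    using p'(3) that by (simp add: successively_conv_nth)
  have shortcut: "wk (take (Suc i) p @ drop j p)" if ij: "i < j" "j < ?m" "adj (p ! i) (p ! j)" for i j
  proof -
    have "successively adj (take (Suc i) p)" "successively adj (drop j p)"
      using step ij by (auto simp: successively_conv_nth)
    moreover have "last (take (Suc i) p) = p ! i" "hd (drop j p) = p ! j"
      using ij by (auto simp: take_Suc_conv_app_nth hd_drop_conv_nth)
    ultimately have "successively adj (take (Suc i) p @ drop j p)"
      using ij by (auto simp: successively_append_iff)
    moreover have "hd (take (Suc i) p @ drop j p) = hd p" "last (take (Suc i) p @ drop j p) = last p"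
      using ij by (auto simp: hd_append)
    ultimately show ?thesis
      using p unfolding wk_def by (auto dest: in_set_takeD in_set_dropD)
  qed
  have chord: "j = Suc i" if ij: "i < j" "j < ?m" "adj (p ! i) (p ! j)" for i j
    using min[OF shortcut[OF ij]] ij by simp
  have inj: "p ! i \<noteq> p ! j" if ij: "i < j" "j < ?m" for i j
  proof
    assume eq: "p ! i = p ! j"
    \<comment> \<open>If the start recurs, the walk can begin at the repeat; any other repetition
      gives a chord from the predecessor of the first occurrence.\<close>
    show False
    proof (cases i)
      case 0
      have "successively adj (drop j p)" using step ij by (auto simp: successively_conv_nth)
      moreover have "hd (drop j p) = hd p"
        using ij eq 0 p'(1) by (simp add: hd_drop_conv_nth hd_conv_nth)
      ultimately have "wk (drop j p)"
        using p ij unfolding wk_def by (auto dest: in_set_dropD)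
      then show False using min[of "drop j p"] ij by simp
    next
      case (Suc k)
      then have "adj (p ! k) (p ! j)" using step[of k] ij eq by simp
      then show False using chord[of k j] Suc ij by simp
    qed
  qed
  have internal: "\<not> adj a (p ! i)" if i: "0 < i" "i < ?m - 1" for i
  proof
    assume "adj a (p ! i)"
    moreover have "last (take (Suc i) p) = p ! i" "hd (take (Suc i) p) = p ! 0"
      using i p'(1) by (auto simp: take_Suc_conv_app_nth hd_append hd_conv_nth nth_append)
    moreover have "p ! 0 \<noteq> p ! i" using inj[of 0 i] i by simp
    moreover have "successively adj (take (Suc i) p)" using step i by (auto simp: successively_conv_nth)
    ultimately have "wk (take (Suc i) p)"
      using p p' unfolding wk_def by (auto dest: in_set_takeD)
    then show False using min[of "take (Suc i) p"] i by simp
  qed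
  define v where "v = (!) (a # p)"
  have v: "v 0 = a" "v (Suc i) = p ! i" for i by (auto simp: v_def)
  have "distinct p" unfolding distinct_conv_nth by (metis inj linorder_neqE_nat)
  then have "distinct (a # p)" using p'(2) by auto
  then have "bij_betw v {..<Suc ?m} (set (a # p))"
    unfolding v_def by (intro bij_betw_nth) auto
  moreover have "adj (v i) (v j) \<longleftrightarrow> j = Suc i mod Suc ?m \<or> i = Suc j mod Suc ?m"
    if ij: "i < Suc ?m" "j < Suc ?m" for i j
  proof -
    have end_adj: "adj a (p ! k) \<longleftrightarrow> k = 0 \<or> Suc k = ?m" if "k < ?m" for k
    proof -
      have "k = 0 \<or> k = ?m - 1 \<or> 0 < k \<and> k < ?m - 1" using that by linarith
      then show ?thesis using internal[of k] p'(5,6) m by auto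
    qed
    have inner: "adj (p ! k) (p ! l) \<longleftrightarrow> l = Suc k \<or> k = Suc l" if "k < ?m" "l < ?m" for k l
    proof (cases k l rule: linorder_cases)
      case less
      then show ?thesis using chord[of k l] step[of k] that by auto
    next
      case equal
      then show ?thesis using adj_irrefl by simp
    next
      case greater
      then have "adj (p ! l) (p ! k) \<longleftrightarrow> k = Suc l" using chord[of l k] step[of l] that by auto
      then show ?thesis using greater adj_sym by auto
    qed
    have md: "Suc k mod Suc ?m = (if k = ?m then 0 else Suc k)" if "k < Suc ?m" for k
      using that by simp
    show ?thesis
    proof (cases i; cases j)
      assume "i = 0" "j = 0"
      then show ?thesis using adj_irrefl m v p'(1) by (simp add: md)
    next
      fix l assume "i = 0" "j = Suc l"
      then show ?thesis using end_adj[of l] ij m v p'(1) by (auto simp: md)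
    next
      fix k assume "i = Suc k" "j = 0"
      moreover have "adj (p ! k) a \<longleftrightarrow> adj a (p ! k)" using adj_sym by blast
      ultimately show ?thesis using end_adj[of k] ij m v p'(1) by (auto simp: md)
    next
      fix k l assume "i = Suc k" "j = Suc l"
      then show ?thesis using inner[of k l] ij m v p'(1) by (simp add: md) presburger
    qed
  qed
  ultimately have "cycle_enum (Suc ?m) v (set (a # p))"
    unfolding cycle_enum_def using m by auto
  moreover have "set (a # p) \<subseteq> W" using a p'(2) by auto
  ultimately show ?thesis by blast
qed

text \<open>A maximal proper block \<open>B\<close> with at least three vertices is completed to
  \<open>W\<close> by one minimal ear \<open>Q\<close>. If \<open>Q\<close> has two or more
  vertices, only two vertices of \<open>B\<close> see it, and one of them, \<open>c\<close>, only
  through a single vertex \<open>z\<close>; any third vertex of \<open>B\<close> is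
  \<open>b\<close>. If \<open>Q\<close> is one vertex \<open>u\<close> with a non-neighbour in
  \<open>B\<close>, that non-neighbour is \<open>b\<close>. If \<open>u\<close> sees all of
  \<open>B\<close>, the block is replaced by \<open>W - {x}\<close>, with \<open>y\<close> as
  \<open>b\<close> and \<open>u\<close> as \<open>c\<close>.\<close>

lemma biconn_split:
  assumes fin: "finite W" and W: "biconn W" "3 \<le> card W"
    and nc: "x \<in> W" "y \<in> W" "x \<noteq> y" "\<not> adj x y"
    and ncyc: "\<And>n v. \<not> cycle_enum n v W"
  shows "\<exists>B b c u. B \<subset> W \<and> biconn B \<and> 3 \<le> card B \<and> b \<in> B \<and> (\<forall>u'\<in>W - B. \<not> adj b u') \<and>
    c \<in> B \<and> u \<in> W - B \<and> adj c u \<and> (\<forall>u'\<in>W - B. adj c u' \<longrightarrow> u' = u)"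
proof -
  let ?F = "{B. B \<subset> W \<and> biconn B \<and> 3 \<le> card B}"
  \<comment> \<open>This cycle is a proper subset because \<open>W\<close> itself is no cycle, so
    proper blocks with at least three vertices exist.\<close>
  obtain n v C where C: "C \<subseteq> W" "cycle_enum n v C"
    using exists_chordless_cycle[OF W] by blast
  then have "card C = n" by (auto simp: cycle_enum_def dest: bij_betw_same_card)
  moreover have "C \<noteq> W" using C(2) ncyc by blast
  moreover have "3 \<le> n" using C(2) by (simp add: cycle_enum_def)
  ultimately have "C \<in> ?F" using C(1) biconn_cycle[OF C(2)] by blast
  moreover have "finite ?F" using fin by (auto intro: finite_subset[of _ "Pow W"])
  ultimately obtain B where B: "B \<in> ?F" and max: "\<forall>B'\<in>?F. B \<subseteq> B' \<longrightarrow> B = B'"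
    using finite_has_maximal[of ?F] by (metis (no_types, lifting) empty_iff)
  have BW: "B \<subset> W" "biconn B" "3 \<le> card B" using B by auto
  then have finB: "finite B" using fin by (auto intro: finite_subset)
  let ?U = "W - B"
  let ?G = "{Q. Q \<subseteq> ?U \<and> conn Q \<and> two_attached B Q}"
  obtain R where R: "R \<subseteq> ?U" "conn R" "\<forall>u\<in>R. \<forall>v\<in>?U - R. \<not> adj u v"
    using exists_component[of ?U] fin B by auto
  \<comment> \<open>A component of the rest that is attached to \<open>B\<close> in at most one
    vertex \<open>c\<close> would be separated from the other vertices of \<open>B\<close> by
    deleting \<open>c\<close>.\<close>
  have "two_attached B R"
  proof (rule ccontr)
    assume "\<not> ?thesis"
    then obtain c where c: "c \<in> B" "\<And>b. b \<in> B \<Longrightarrow> attached R b \<Longrightarrow> b = c"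
      using B unfolding two_attached_def by (metis (no_types, lifting) biconn_conn conn_nonempty ex_in_conv mem_Collect_eq)
    have "conn (W - {c})"
      using biconn_delete[OF W(1), of c] not_singleton_if_card[of W c] W(2) c B by auto
    moreover have "R \<subseteq> W - {c}" "R \<noteq> {}" using R c conn_nonempty by blast+
    moreover have "R \<noteq> W - {c}"
    proof
      assume "R = W - {c}"
      then have "B \<subseteq> {c}" using R(1) B by blast
      then have "card B \<le> 1" using card_mono[of "{c}" B] by simp
      then show False using B by simp
    qed
    ultimately obtain u v where uv: "u \<in> R" "v \<in> W - {c} - R" "adj u v"
      using conn_cut by metis
    then have "v \<in> B" using R by blast
    then show False using c uv unfolding attached_def by blast
  qed
  then have "R \<in> ?G" using R by blast
  moreover have "finite ?G" using fin by (auto intro: finite_subset[of _ "Pow W"])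
  ultimately obtain Q where Q: "Q \<in> ?G" and min: "\<forall>Q'\<in>?G. Q' \<subseteq> Q \<longrightarrow> Q = Q'"
    using finite_has_minimal[of ?G] by (metis (no_types, lifting) empty_iff)
  have minQ: "\<not> two_attached B Q'" if "Q' \<subset> Q" "conn Q'" for Q'
    using min that Q by blast
  have bic: "biconn (B \<union> Q)"
    using Q B minQ by (intro biconn_ear) auto
  have "B \<union> Q = W"
  proof (rule ccontr)
    assume "B \<union> Q \<noteq> W"
    moreover have "card B \<le> card (B \<union> Q)"
      using fin Q B by (intro card_mono) (auto intro: finite_subset)
    ultimately have "B \<union> Q \<in> ?F" using bic Q B by auto
    then have "B = B \<union> Q" using max by blast
    then show False using Q conn_nonempty by blast
  qed
  then have QU: "Q = ?U" using Q by blast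
  have finQ: "finite Q" using QU fin by simp
  obtain b1 b2 where b12: "b1 \<in> B" "b2 \<in> B" "b1 \<noteq> b2" "attached Q b1" "attached Q b2"
    using Q unfolding two_attached_def by blast
  show ?thesis
  proof (cases "2 \<le> card Q")
    case True
    then obtain z where z: "z \<in> Q" "conn (Q - {z})"
      using exists_noncut Q finQ by blast
    \<comment> \<open>By minimality neither \<open>{z}\<close> nor \<open>Q - {z}\<close> is
      attached twice, so the two attachments are split between them.\<close>
    have n1: "\<not> two_attached B (Q - {z})" using minQ[of "Q - {z}"] z by blast
    have "{z} \<noteq> Q" using True by auto
    then have n2: "\<not> two_attached B {z}" using minQ[of "{z}"] z conn_singleton by blast
    have split: "attached Q b \<longleftrightarrow> attached {z} b \<or> attached (Q - {z}) b" for b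
      using z unfolding attached_def by blast
    obtain c c' where c: "c \<in> B" "c' \<in> B" "c \<noteq> c'" "attached {z} c" "attached (Q - {z}) c'"
      using b12 n1 n2 unfolding split two_attached_def by metis
    have nc: "\<not> attached (Q - {z}) c" using n1 c unfolding two_attached_def by blast
    have "card {c, c'} < card B" using B c by simp
    then have "\<not> B \<subseteq> {c, c'}" using card_mono[of "{c, c'}" B] by auto
    then obtain b where b: "b \<in> B" "b \<noteq> c" "b \<noteq> c'" by blast
    have "\<not> attached Q b"
      using n1 n2 c b unfolding split two_attached_def by metis
    then have "\<forall>u'\<in>W - B. \<not> adj b u'" using QU adj_sym unfolding attached_def by blast
    moreover have "adj c z" "z \<in> W - B" "\<forall>u'\<in>W - B. adj c u' \<longrightarrow> u' = z"
      using c nc z QU adj_sym unfolding attached_def by blast+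
    note nbr = calculation this
    show ?thesis
      by (intro exI[of _ B] exI[of _ b] exI[of _ c] exI[of _ z] conjI) (fact BW nbr b c)+
  next
    case False
    moreover have "Q \<noteq> {}" using Q conn_nonempty by blast
    ultimately have "card Q = 1" using finQ by (metis One_nat_def Suc_leI card_gt_0_iff le_antisym not_less_eq_eq numeral_2_eq_2)
    then obtain u where u: "Q = {u}" by (auto simp: card_1_singleton_iff)
    show ?thesis
    proof (cases "\<exists>b\<in>B. \<not> adj b u")
      case True
      then obtain b where b: "b \<in> B" "\<not> adj b u" by blast
      have b1: "adj b1 u" using b12 u adj_sym unfolding attached_def by blast
      have WB: "W - B = {u}" using QU u by simp
      show ?thesis
        by (intro exI[of _ B] exI[of _ b] exI[of _ b1] exI[of _ u] conjI)
          (simp_all add: WB BW b b1 b12)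
    next
      case False
      \<comment> \<open>Here \<open>u\<close> is joined to all of \<open>B\<close>, so
        \<open>x\<close> and \<open>y\<close> lie in \<open>B\<close>. Deleting a vertex from
        \<open>W - {x}\<close> leaves a set that is connected through \<open>u\<close>, or a part
        \<open>B - {x}\<close> of the block \<open>B\<close>.\<close>
      then have univ: "adj u b" if "b \<in> B" for b using that adj_sym by blast
      have Wu: "W = insert u B" "u \<notin> B" using QU u B by auto
      have xy: "x \<in> B" "y \<in> B" using nc Wu univ adj_sym by auto
      have cW: "conn (W - {x} - {v})" if v: "v \<in> W - {x}" for v
      proof (cases "v = u")
        case True
        have "B \<noteq> {x}" using B not_singleton_if_card[of B x] by simp
        then have "conn (B - {x})" using biconn_delete[of B x] B xy by blast
        moreover have "W - {x} - {v} = B - {x}" using True Wu by auto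
        ultimately show ?thesis by simp
      next
        case False
        then show ?thesis using Wu univ xy by (intro conn_universal[of u]) auto
      qed
      have "W \<noteq> {x}" using nc by blast
      then have bx: "biconn (W - {x})"
        unfolding biconn_def using biconn_delete[OF W(1) nc(1)] cW by blast
      have cx: "card (W - {x}) = card B" using Wu xy finB by simp
      have ux: "adj u x" "u \<noteq> x" "u \<in> W" using univ xy Wu by auto
      have yx: "y \<noteq> x" "\<not> adj y x" using nc adj_sym by auto
      have Wx: "W - (W - {x}) = {x}" "W - {x} \<subset> W" using nc by auto
      show ?thesis
        by (intro exI[of _ "W - {x}"] exI[of _ y] exI[of _ u] exI[of _ x] conjI)
          (simp_all add: Wx bx cx BW nc ux yx)
    qed
  qed
qed

end

section \<open>Colourings and residual weights\<close>

text \<open>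
  The Boolean argument of \<open>A\<close>, \<open>E\<close> and of weights selects a direction: \<open>A True u v\<close> stands for an
  arc from \<open>u\<close> to \<open>v\<close> and \<open>A False u v\<close> for one from \<open>v\<close> to \<open>u\<close>, so that one argument covers
  out-degrees and in-degrees. A transversal is given by a choice function \<open>\<phi>\<close>.
\<close>

locale cover_system =
  fixes V :: "'a set" and A :: "bool \<Rightarrow> 'a \<Rightarrow> 'a \<Rightarrow> bool"
    and X :: "'a \<Rightarrow> 'b set" and E :: "bool \<Rightarrow> 'b \<Rightarrow> 'b \<Rightarrow> bool"
  assumes finite_V: "finite V"
    and finite_X: "v \<in> V \<Longrightarrow> finite (X v)"
    and X_disjoint: "u \<in> V \<Longrightarrow> v \<in> V \<Longrightarrow> x \<in> X u \<Longrightarrow> x \<in> X v \<Longrightarrow> u = v"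
    and A_irrefl: "\<not> A b v v"
    and A_flip: "A (\<not> b) u v = A b v u"
    and E_flip: "E (\<not> b) x y = E b y x"
    and E_A: "u \<in> V \<Longrightarrow> v \<in> V \<Longrightarrow> x \<in> X u \<Longrightarrow> y \<in> X v \<Longrightarrow> E b x y \<Longrightarrow> A b u v"
    and E_fun: "u \<in> V \<Longrightarrow> v \<in> V \<Longrightarrow> x \<in> X u \<Longrightarrow> y \<in> X v \<Longrightarrow> y' \<in> X v \<Longrightarrow>
      E b x y \<Longrightarrow> E b x y' \<Longrightarrow> y = y'"
begin

definition nb :: "'a \<Rightarrow> 'a \<Rightarrow> bool" where
  "nb u v \<longleftrightarrow> (\<exists>b. A b u v)"

sublocale ugraph nb
proof
  show "nb u v \<Longrightarrow> nb v u" for u v unfolding nb_def using A_flip by metis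
  show "\<not> nb v v" for v unfolding nb_def using A_irrefl by simp
qed

definition cnt :: "bool \<Rightarrow> 'a set \<Rightarrow> ('a \<Rightarrow> 'b) \<Rightarrow> 'b \<Rightarrow> nat" where
  "cnt b U \<phi> x = card {u \<in> U. E b x (\<phi> u)}"

definition deg :: "bool \<Rightarrow> 'a set \<Rightarrow> 'a \<Rightarrow> nat" where
  "deg b W v = card {u \<in> W. A b v u}"

definition feas :: "(bool \<Rightarrow> 'b \<Rightarrow> nat) \<Rightarrow> 'a set \<Rightarrow> bool" where
  "feas g W \<longleftrightarrow> (\<forall>v\<in>W. \<forall>b. deg b W v \<le> (\<Sum>x\<in>X v. g b x))"

text \<open>Sets of base vertices replace subdigraphs of the transversal; only induced subdigraphs
  are tested this way.\<close>

definition col :: "(bool \<Rightarrow> 'b \<Rightarrow> nat) \<Rightarrow> 'a set \<Rightarrow> ('a \<Rightarrow> 'b) \<Rightarrow> bool" where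
  "col g W \<phi> \<longleftrightarrow> (\<forall>v\<in>W. \<phi> v \<in> X v) \<and>
     (\<forall>U. U \<subseteq> W \<longrightarrow> U \<noteq> {} \<longrightarrow> (\<exists>v\<in>U. \<exists>b. cnt b U \<phi> (\<phi> v) < g b (\<phi> v)))"

definition uncol :: "(bool \<Rightarrow> 'b \<Rightarrow> nat) \<Rightarrow> 'a set \<Rightarrow> bool" where
  "uncol g W \<longleftrightarrow> (\<forall>\<phi>. \<not> col g W \<phi>)"

text \<open>Subtraction truncates at 0, so a residual may lose less weight than there are arcs.
  \<open>res_tight\<close> excludes this in the situation of interest.\<close>

definition res :: "(bool \<Rightarrow> 'b \<Rightarrow> nat) \<Rightarrow> 'a set \<Rightarrow> ('a \<Rightarrow> 'b) \<Rightarrow> bool \<Rightarrow> 'b \<Rightarrow> nat" where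
  "res g U \<phi> b x = g b x - cnt b U \<phi> x"

text \<open>These are the colours that a vertex admits when it is coloured alone.\<close>

definition supp :: "(bool \<Rightarrow> 'b \<Rightarrow> nat) \<Rightarrow> 'a \<Rightarrow> 'b set" where
  "supp g v = {x \<in> X v. \<exists>b. 0 < g b x}"

lemma supp_range: "x \<in> supp g v \<Longrightarrow> x \<in> X v"
  by (simp add: supp_def)

lemma finite_sub: "W \<subseteq> V \<Longrightarrow> finite W"
  using finite_V by (rule finite_subset[rotated])

lemma E_inj:
  assumes "u \<in> V" "v \<in> V" "x \<in> X u" "x' \<in> X u" "y \<in> X v" "E b x y" "E b x' y"
  shows "x = x'"
  using E_fun[of v u y x x' "\<not> b"] assms by (simp add: E_flip)

lemma E_irrefl: "v \<in> V \<Longrightarrow> x \<in> X v \<Longrightarrow> y \<in> X v \<Longrightarrow> \<not> E b x y"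
  using E_A[of v v] A_irrefl by blast

lemma cnt_mono: "finite U' \<Longrightarrow> U \<subseteq> U' \<Longrightarrow> cnt b U \<phi> x \<le> cnt b U' \<phi> x"
  unfolding cnt_def by (intro card_mono) auto

lemma cnt_cong: "(\<And>u. u \<in> U \<Longrightarrow> \<phi> u = \<psi> u) \<Longrightarrow> cnt b U \<phi> x = cnt b U \<psi> x"
  unfolding cnt_def by (intro arg_cong[of _ _ card]) auto

lemma cnt_Un:
  assumes "finite U" "finite W" "U \<inter> W = {}"
  shows "cnt b (U \<union> W) \<phi> x = cnt b U \<phi> x + cnt b W \<phi> x"
proof -
  have "{u \<in> U \<union> W. E b x (\<phi> u)} = {u \<in> U. E b x (\<phi> u)} \<union> {u \<in> W. E b x (\<phi> u)}" by auto
  then show ?thesis unfolding cnt_def using assms by (simp add: card_Un_disjoint disjoint_iff)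
qed

lemma deg_Un:
  assumes "finite U" "finite W" "U \<inter> W = {}"
  shows "deg b (U \<union> W) v = deg b U v + deg b W v"
proof -
  have "{u \<in> U \<union> W. A b v u} = {u \<in> U. A b v u} \<union> {u \<in> W. A b v u}" by auto
  then show ?thesis unfolding deg_def using assms by (simp add: card_Un_disjoint disjoint_iff)
qed

lemma deg_pos_iff: "finite W \<Longrightarrow> 0 < deg b W v \<longleftrightarrow> (\<exists>u\<in>W. A b v u)"
  unfolding deg_def by (auto simp: card_gt_0_iff)

lemma col_cong:
  assumes "\<And>v. v \<in> W \<Longrightarrow> \<phi> v = \<psi> v" "col g W \<phi>"
  shows "col g W \<psi>"
  unfolding col_def
proof (intro conjI allI impI ballI)
  fix v assume "v \<in> W"
  then show "\<psi> v \<in> X v" using assms by (auto simp: col_def)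
next
  fix U assume U: "U \<subseteq> W" "U \<noteq> {}"
  then obtain v b where "v \<in> U" "cnt b U \<phi> (\<phi> v) < g b (\<phi> v)"
    using assms(2) unfolding col_def by blast
  moreover have "cnt b U \<phi> (\<phi> v) = cnt b U \<psi> (\<phi> v)"
    using U assms(1) by (intro cnt_cong) auto
  moreover have "\<phi> v = \<psi> v" using calculation U assms(1) by auto
  ultimately show "\<exists>v\<in>U. \<exists>b. cnt b U \<psi> (\<psi> v) < g b (\<psi> v)" by metis
qed

lemma col_range: "col g W \<phi> \<Longrightarrow> v \<in> W \<Longrightarrow> \<phi> v \<in> X v"
  by (simp add: col_def)

text \<open>A subset that contains \<open>s\<close> is witnessed by \<open>s\<close>, whose count in
  it is at most that over \<open>W\<close>; every other subset lies in \<open>W\<close>.\<close>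

lemma col_insert:
  assumes W: "W \<subseteq> V" and s: "s \<in> V" "s \<notin> W" and \<phi>: "col g W \<phi>" and x: "x \<in> X s"
    and less: "cnt b W \<phi> x < g b x"
  shows "col g (insert s W) (\<phi>(s := x))"
  unfolding col_def
proof (intro conjI allI impI ballI)
  fix v assume "v \<in> insert s W"
  then show "(\<phi>(s := x)) v \<in> X v" using col_range[OF \<phi>] x by auto
next
  fix U assume U: "U \<subseteq> insert s W" "U \<noteq> {}"
  show "\<exists>v\<in>U. \<exists>b. cnt b U (\<phi>(s := x)) ((\<phi>(s := x)) v) < g b ((\<phi>(s := x)) v)"
  proof (cases "s \<in> U")
    case True
    have "{u \<in> U. E b x ((\<phi>(s := x)) u)} \<subseteq> {u \<in> W. E b x (\<phi> u)}"
      using U E_irrefl[OF s(1) x x] by auto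
    then have "cnt b U (\<phi>(s := x)) x \<le> cnt b W \<phi> x"
      unfolding cnt_def using finite_sub[OF W] by (intro card_mono) auto
    then show ?thesis using True less by (intro bexI[of _ s] exI[of _ b]) auto
  next
    case False
    then have "U \<subseteq> W" using U by blast
    then obtain v b' where v: "v \<in> U" "cnt b' U \<phi> (\<phi> v) < g b' (\<phi> v)"
      using \<phi> U unfolding col_def by blast
    moreover have "cnt b' U (\<phi>(s := x)) (\<phi> v) = cnt b' U \<phi> (\<phi> v)"
      using False by (intro cnt_cong) auto
    moreover have "v \<noteq> s" using False v by blast
    ultimately show ?thesis by (intro bexI[of _ v] exI[of _ b']) auto
  qed
qed

lemma col_empty: "col g {} \<phi>"
  by (simp add: col_def)

lemma col_singleton:
  assumes "v \<in> V" "x \<in> supp g v"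
  shows "col g {v} (\<lambda>_. x)"
proof -
  have x: "x \<in> X v" "\<exists>b. 0 < g b x" using assms by (auto simp: supp_def)
  then obtain b where "0 < g b x" by blast
  then have "col g (insert v {}) ((\<lambda>_. x)(v := x))"
    using assms x by (intro col_insert[where b = b] col_empty) (auto simp: cnt_def)
  then show ?thesis by (simp add: fun_upd_idem)
qed

text \<open>No \<open>\<phi> u\<close> has two partners over \<open>v\<close> in direction
  \<open>b\<close>, so the counts over the fibre add up without overlap.\<close>

lemma sum_cnt:
  assumes U: "U \<subseteq> V" and v: "v \<in> V" and \<phi>: "\<And>u. u \<in> U \<Longrightarrow> \<phi> u \<in> X u"
  shows "(\<Sum>x\<in>X v. cnt b U \<phi> x) = card {u \<in> U. \<exists>x\<in>X v. E b x (\<phi> u)}"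
proof -
  have "{u \<in> U. \<exists>x\<in>X v. E b x (\<phi> u)} = (\<Union>x\<in>X v. {u \<in> U. E b x (\<phi> u)})" by blast
  also have "card \<dots> = (\<Sum>x\<in>X v. card {u \<in> U. E b x (\<phi> u)})"
  proof (rule card_UN_disjoint)
    show "\<forall>i\<in>X v. \<forall>j\<in>X v. i \<noteq> j \<longrightarrow> {u \<in> U. E b i (\<phi> u)} \<inter> {u \<in> U. E b j (\<phi> u)} = {}"
      using E_inj U v \<phi> by blast
  qed (use finite_X v finite_sub[OF U] in auto)
  finally show ?thesis by (simp add: cnt_def)
qed

lemma matched_subset:
  assumes "U \<subseteq> V" "v \<in> V" "\<And>u. u \<in> U \<Longrightarrow> \<phi> u \<in> X u"
  shows "{u \<in> U. \<exists>x\<in>X v. E b x (\<phi> u)} \<subseteq> {u \<in> U. A b v u}"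
  using E_A assms by blast

lemma sum_cnt_le:
  assumes "U \<subseteq> V" "v \<in> V" "\<And>u. u \<in> U \<Longrightarrow> \<phi> u \<in> X u"
  shows "(\<Sum>x\<in>X v. cnt b U \<phi> x) \<le> deg b U v"
proof -
  have "{u \<in> U. \<exists>x\<in>X v. E b x (\<phi> u)} \<subseteq> {u \<in> U. A b v u}"
    using assms by (rule matched_subset)
  then have "card {u \<in> U. \<exists>x\<in>X v. E b x (\<phi> u)} \<le> deg b U v"
    unfolding deg_def using finite_sub[OF assms(1)] by (intro card_mono) auto
  moreover have "(\<Sum>x\<in>X v. cnt b U \<phi> x) = card {u \<in> U. \<exists>x\<in>X v. E b x (\<phi> u)}"
    using assms by (rule sum_cnt)
  ultimately show ?thesis by simp
qed

text \<open>Greedy colouring: a vertex with slack is coloured last, so that its neighbours gain slack.\<close>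

lemma colorable_if_slack:
  assumes "W \<subseteq> V" "feas g W"
    and "\<And>P. P \<subseteq> W \<Longrightarrow> P \<noteq> {} \<Longrightarrow> (\<And>u v. u \<in> P \<Longrightarrow> v \<in> W - P \<Longrightarrow> \<not> nb u v) \<Longrightarrow>
      \<exists>v\<in>P. \<exists>b. deg b W v < (\<Sum>x\<in>X v. g b x)"
  shows "\<exists>\<phi>. col g W \<phi>"
  using finite_sub[OF assms(1)] assms
proof (induction W rule: finite_psubset_induct)
  case (psubset W)
  show ?case
  proof (cases "W = {}")
    case True
    then show ?thesis using col_empty by blast
  next
    case False
    then obtain s b where s: "s \<in> W" "deg b W s < (\<Sum>x\<in>X s. g b x)"
      using psubset.prems(3)[of W] by blast
    let ?W = "W - {s}"
    have W: "insert s ?W = W" using s by blast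
    have finW: "finite ?W" using psubset.hyps(1) by simp
    have degW: "deg b W v = deg b {s} v + deg b ?W v" for b v
      using deg_Un[of "{s}" ?W b v] finW W by (simp add: insert_absorb)
    have "\<exists>\<phi>. col g ?W \<phi>"
    proof (rule psubset.IH)
      show "?W \<subset> W" using s by blast
      show "?W \<subseteq> V" using psubset.prems(1) by blast
      show "feas g ?W"
        unfolding feas_def
      proof (intro ballI allI)
        fix v b assume "v \<in> ?W"
        then have "deg b W v \<le> (\<Sum>x\<in>X v. g b x)" using psubset.prems(2) by (simp add: feas_def)
        then show "deg b ?W v \<le> (\<Sum>x\<in>X v. g b x)" using degW[of b v] by simp
      qed
      fix P assume P: "P \<subseteq> ?W" "P \<noteq> {}" "\<And>u v. u \<in> P \<Longrightarrow> v \<in> ?W - P \<Longrightarrow> \<not> nb u v"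
      \<comment> \<open>A neighbour of \<open>s\<close> gains slack from the removal of
        \<open>s\<close>. If \<open>P\<close> has no such neighbour, it has no outgoing edges in
        \<open>W\<close> either and already owns a slack vertex, whose degree does not grow.\<close>
      show "\<exists>v\<in>P. \<exists>b. deg b ?W v < (\<Sum>x\<in>X v. g b x)"
      proof (cases "\<exists>u\<in>P. nb u s")
        case True
        then obtain u b where u: "u \<in> P" "A b u s" by (auto simp: nb_def)
        then have "0 < deg b {s} u" by (simp add: deg_pos_iff)
        then have "deg b ?W u < deg b W u" using degW[of b u] by simp
        also have "\<dots> \<le> (\<Sum>x\<in>X u. g b x)" using psubset.prems(2) u P by (auto simp: feas_def)
        finally show ?thesis using u by blast
      next
        case False
        then have "\<exists>v\<in>P. \<exists>b. deg b W v < (\<Sum>x\<in>X v. g b x)"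
          using P by (intro psubset.prems(3)) auto
        then show ?thesis using degW by (metis add_lessD1 add.commute)
      qed
    qed
    then obtain \<phi> where \<phi>: "col g ?W \<phi>" by blast
    have sV: "s \<in> V" "?W \<subseteq> V" using s psubset.prems(1) by auto
    \<comment> \<open>The counts over the fibre add up to at most the degree of \<open>s\<close>,
      which is below its total weight, so some colour has room.\<close>
    have "\<exists>x\<in>X s. cnt b ?W \<phi> x < g b x"
    proof (rule ccontr)
      assume "\<not> ?thesis"
      then have "(\<Sum>x\<in>X s. g b x) \<le> (\<Sum>x\<in>X s. cnt b ?W \<phi> x)"
        by (intro sum_mono) (auto simp: not_less)
      also have "\<dots> \<le> deg b ?W s"
        using sV col_range[OF \<phi>] by (intro sum_cnt_le) auto
      also have "\<dots> \<le> deg b W s" using degW by simp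
      finally show False using s by simp
    qed
    then obtain x where "x \<in> X s" "cnt b ?W \<phi> x < g b x" by blast
    then have "col g (insert s ?W) (\<phi>(s := x))"
      using sV by (intro col_insert[OF _ _ _ \<phi>]) auto
    then show ?thesis using W by auto
  qed
qed

text \<open>In a connected set the only nonempty subset without outgoing edges is the whole set, so
  a single slack vertex would meet the condition of \<open>colorable_if_slack\<close>.\<close>

lemma tight:
  assumes W: "W \<subseteq> V" "conn W" "feas g W" "uncol g W" and v: "v \<in> W"
  shows "(\<Sum>x\<in>X v. g b x) = deg b W v"
proof (rule ccontr)
  assume "\<not> ?thesis"
  then have less: "deg b W v < (\<Sum>x\<in>X v. g b x)"
    using W v unfolding feas_def by (metis le_neq_implies_less)
  have "\<exists>\<phi>. col g W \<phi>"
  proof (rule colorable_if_slack)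
    fix P assume P: "P \<subseteq> W" "P \<noteq> {}" "\<And>u v. u \<in> P \<Longrightarrow> v \<in> W - P \<Longrightarrow> \<not> nb u v"
    have "P = W"
    proof (rule ccontr)
      assume "P \<noteq> W"
      then obtain u w where "u \<in> P" "w \<in> W - P" "nb u w"
        using conn_cut[OF W(2) P(1,2)] by metis
      then show False using P(3) by blast
    qed
    then show "\<exists>v\<in>P. \<exists>b. deg b W v < (\<Sum>x\<in>X v. g b x)" using less v by blast
  qed (fact W)+
  then show False using W by (simp add: uncol_def)
qed

text \<open>A part of \<open>U\<close> without outgoing edges inside \<open>U\<close> has an edge to
  \<open>W - U\<close> by connectivity, and the neighbour lost there is slack.\<close>

lemma proper_colorable:
  assumes W: "W \<subseteq> V" "conn W" "feas g W" and U: "U \<subset> W"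
  shows "\<exists>\<phi>. col g U \<phi>"
proof (rule colorable_if_slack)
  have finW: "finite U" "finite (W - U)" using finite_sub W U by (auto intro: finite_subset)
  have degW: "deg b W v = deg b U v + deg b (W - U) v" for b v
    using deg_Un[OF finW, of b v] U by (simp add: Un_absorb1 psubset_imp_subset)
  show "U \<subseteq> V" using U W by blast
  show "feas g U"
    unfolding feas_def
  proof (intro ballI allI)
    fix v b assume "v \<in> U"
    then have "deg b W v \<le> (\<Sum>x\<in>X v. g b x)" using U W by (auto simp: feas_def)
    then show "deg b U v \<le> (\<Sum>x\<in>X v. g b x)" using degW[of b v] by simp
  qed
  fix P assume P: "P \<subseteq> U" "P \<noteq> {}" "\<And>u v. u \<in> P \<Longrightarrow> v \<in> U - P \<Longrightarrow> \<not> nb u v"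
  then obtain u v where uv: "u \<in> P" "v \<in> W - P" "nb u v"
    using conn_cut[OF W(2), of P] U by (metis order_trans psubsetE subset_antisym)
  then have "v \<in> W - U" using P(3) by blast
  moreover obtain b where "A b u v" using uv by (auto simp: nb_def)
  ultimately have "0 < deg b (W - U) u" using deg_pos_iff[OF finW(2)] by blast
  then have "deg b U u < deg b W u" using degW[of b u] by simp
  also have "\<dots> \<le> (\<Sum>x\<in>X u. g b x)" using W uv P U by (auto simp: feas_def)
  finally show "\<exists>v\<in>P. \<exists>b. deg b U v < (\<Sum>x\<in>X v. g b x)" using uv by blast
qed

text \<open>A set that meets \<open>W\<close> finds its witness there, the arcs to \<open>U\<close>
  being paid by the difference between \<open>g\<close> and its residual. A set inside
  \<open>U\<close> finds it through \<open>\<phi>\<close>. The arcs seen from \<open>U\<close> into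
  \<open>W\<close> never have to be counted.\<close>

lemma col_compose:
  assumes V: "U \<subseteq> V" "W \<subseteq> V" and disj: "U \<inter> W = {}"
    and \<phi>: "col g U \<phi>" and \<psi>: "col (res g U \<phi>) W \<psi>"
  shows "col g (U \<union> W) (\<lambda>v. if v \<in> U then \<phi> v else \<psi> v)"
    (is "col g _ ?\<chi>")
  unfolding col_def
proof (intro conjI allI impI ballI)
  fix v assume "v \<in> U \<union> W"
  then show "?\<chi> v \<in> X v" using col_range[OF \<phi>] col_range[OF \<psi>] by auto
next
  fix P assume P: "P \<subseteq> U \<union> W" "P \<noteq> {}"
  have fin: "finite U" "finite W" "finite P"
    using V P finite_sub by (auto intro: finite_subset)
  have on: "cnt b (P \<inter> U) ?\<chi> x = cnt b (P \<inter> U) \<phi> x" "cnt b (P \<inter> W) ?\<chi> x = cnt b (P \<inter> W) \<psi> x" for b x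
    using disj by (auto intro!: cnt_cong)
  show "\<exists>v\<in>P. \<exists>b. cnt b P ?\<chi> (?\<chi> v) < g b (?\<chi> v)"
  proof (cases "P \<inter> W = {}")
    case True
    then have "P \<subseteq> U" using P by blast
    then obtain v b where "v \<in> P" "cnt b P \<phi> (\<phi> v) < g b (\<phi> v)"
      using \<phi> P unfolding col_def by blast
    then show ?thesis using on(1)[of b "\<phi> v"] \<open>P \<subseteq> U\<close>
      by (intro bexI[of _ v] exI[of _ b]) (auto simp: Int_absorb2)
  next
    case False
    then obtain v b where v: "v \<in> P \<inter> W" "cnt b (P \<inter> W) \<psi> (\<psi> v) < res g U \<phi> b (\<psi> v)"
      using \<psi> unfolding col_def by (metis inf_le2)
    have "cnt b P ?\<chi> (\<psi> v) = cnt b (P \<inter> U) \<phi> (\<psi> v) + cnt b (P \<inter> W) \<psi> (\<psi> v)"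
    proof -
      have "P = P \<inter> U \<union> P \<inter> W" using P by blast
      then show ?thesis
        using cnt_Un[of "P \<inter> U" "P \<inter> W" b ?\<chi> "\<psi> v"] fin disj on by (metis (no_types, lifting) Int_Un_distrib2 Int_assoc Int_commute Int_empty_right finite_Int)
    qed
    also have "\<dots> \<le> cnt b U \<phi> (\<psi> v) + cnt b (P \<inter> W) \<psi> (\<psi> v)"
      using cnt_mono[of U "P \<inter> U" b \<phi> "\<psi> v"] fin by simp
    also have "\<dots> < g b (\<psi> v)" using v by (simp add: res_def)
    finally show ?thesis using v disj by (intro bexI[of _ v] exI[of _ b]) auto
  qed
qed

lemma res_uncol:
  assumes "U \<subseteq> V" "W \<subseteq> V" "U \<inter> W = {}" "col g U \<phi>" "uncol g (U \<union> W)"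
  shows "uncol (res g U \<phi>) W"
  using col_compose[OF assms(1-4)] assms(5) unfolding uncol_def by blast

lemma sum_res_ge:
  "(\<Sum>x\<in>X v. g b x) \<le> (\<Sum>x\<in>X v. res g U \<phi> b x) + (\<Sum>x\<in>X v. cnt b U \<phi> x)"
  unfolding sum.distrib[symmetric] by (intro sum_mono) (simp add: res_def)

lemma res_feas:
  assumes V: "U \<subseteq> V" "W \<subseteq> V" and disj: "U \<inter> W = {}"
    and \<phi>: "\<And>u. u \<in> U \<Longrightarrow> \<phi> u \<in> X u" and feas: "feas g (U \<union> W)"
  shows "feas (res g U \<phi>) W"
  unfolding feas_def
proof (intro ballI allI)
  fix v b assume v: "v \<in> W"
  have "deg b U v + deg b W v = deg b (U \<union> W) v"
    using deg_Un[of U W] V disj finite_sub by simp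
  also have "\<dots> \<le> (\<Sum>x\<in>X v. g b x)" using feas v by (simp add: feas_def)
  also have "\<dots> \<le> (\<Sum>x\<in>X v. res g U \<phi> b x) + (\<Sum>x\<in>X v. cnt b U \<phi> x)" by (rule sum_res_ge)
  also have "(\<Sum>x\<in>X v. cnt b U \<phi> x) \<le> deg b U v" using V v \<phi> by (intro sum_cnt_le) auto
  finally show "deg b W v \<le> (\<Sum>x\<in>X v. res g U \<phi> b x)" by simp
qed

text \<open>Feasibility of \<open>g\<close> and tightness of the residual close the chain deg U +
  deg W <= sum g <= sum res + sum cnt <= deg W + deg U. Equality forbids truncation in
  \<open>res\<close> and leaves no arc to a coloured vertex unmatched.\<close>

lemma res_tight:
  assumes V: "U \<subseteq> V" "W \<subseteq> V" and disj: "U \<inter> W = {}" and \<phi>: "col g U \<phi>"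
    and feas: "feas g (U \<union> W)" and un: "uncol g (U \<union> W)" and W: "conn W" and v: "v \<in> W"
  shows "x \<in> X v \<Longrightarrow> g b x = res g U \<phi> b x + cnt b U \<phi> x"
    and "u \<in> U \<Longrightarrow> A b v u \<Longrightarrow> \<exists>x\<in>X v. E b x (\<phi> u)"
proof -
  note r = col_range[OF \<phi>]
  have fin: "finite U" "finite W" "finite (X v)" using V finite_sub finite_X v by auto
  have vV: "v \<in> V" using V v by blast
  have t: "(\<Sum>x\<in>X v. res g U \<phi> b x) = deg b W v"
    using tight[OF V(2) W res_feas[of U W \<phi>, OF V disj r feas] res_uncol[OF V disj \<phi> un] v] .
  have d: "deg b U v + deg b W v = deg b (U \<union> W) v" using deg_Un fin disj by simp
  have f: "deg b (U \<union> W) v \<le> (\<Sum>x\<in>X v. g b x)" using feas v by (simp add: feas_def)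
  have le: "(\<Sum>x\<in>X v. cnt b U \<phi> x) \<le> deg b U v" using V v r by (intro sum_cnt_le) auto
  have ge: "(\<Sum>x\<in>X v. g b x) \<le> (\<Sum>x\<in>X v. res g U \<phi> b x) + (\<Sum>x\<in>X v. cnt b U \<phi> x)" by (rule sum_res_ge)
  {
    assume x: "x \<in> X v"
    have "(\<Sum>x\<in>X v. g b x) = (\<Sum>x\<in>X v. res g U \<phi> b x + cnt b U \<phi> x)"
      using t d f le ge by (simp add: sum.distrib)
    from sum_mono_inv[OF this _ x fin(3)] show "g b x = res g U \<phi> b x + cnt b U \<phi> x"
      by (simp add: res_def)
  }
  {
    assume u: "u \<in> U" "A b v u"
    have "card {u \<in> U. \<exists>x\<in>X v. E b x (\<phi> u)} = card {u \<in> U. A b v u}"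
      using t d f le ge sum_cnt[of U v \<phi> b, OF V(1) vV r] by (simp add: deg_def)
    then have "{u \<in> U. \<exists>x\<in>X v. E b x (\<phi> u)} = {u \<in> U. A b v u}"
      using matched_subset[of U v \<phi> b, OF V(1) vV r] fin by (intro card_subset_eq) auto
    then show "\<exists>x\<in>X v. E b x (\<phi> u)" using u by blast
  }
qed

end

section \<open>Uncolorable degree-feasible blocks and the supports of their weights\<close>

locale critical_block = cover_system +
  fixes W :: "'a set" and g :: "bool \<Rightarrow> 'b \<Rightarrow> nat"
  assumes WV: "W \<subseteq> V" and bic: "biconn W" and fea: "feas g W" and unc: "uncol g W"
begin

lemma supp_X: "x \<in> supp g v \<Longrightarrow> x \<in> X v"
  by (rule supp_range)

lemma finite_W: "finite W" using finite_sub WV .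

lemma W_conn: "conn W" using bic by (rule biconn_conn)

lemma finite_supp: "v \<in> W \<Longrightarrow> finite (supp g v)"
  using finite_X WV unfolding supp_def by auto

lemma sum_tight: "v \<in> W \<Longrightarrow> (\<Sum>x\<in>X v. g b x) = deg b W v"
  using tight[OF WV W_conn fea unc] .

text \<open>This is \<open>res_tight\<close> for one coloured vertex: a colour in the support is
  admissible for \<open>a\<close> alone, and the rest of a block is connected.\<close>

lemma delete_vertex:
  assumes a: "a \<in> W" "x \<in> supp g a" and v: "v \<in> W" "v \<noteq> a"
  shows "y \<in> X v \<Longrightarrow> g b y = res g {a} (\<lambda>_. x) b y + (if E b y x then 1 else 0)"
    and "A b v a \<Longrightarrow> \<exists>y\<in>X v. E b y x"
    and "feas (res g {a} (\<lambda>_. x)) (W - {a})"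
    and "uncol (res g {a} (\<lambda>_. x)) (W - {a})"
    and "conn (W - {a})"
proof -
  have W: "{a} \<union> (W - {a}) = W" "{a} \<subseteq> V" "W - {a} \<subseteq> V" "{a} \<inter> (W - {a}) = {}" "a \<in> V"
    using a WV by auto
  have c: "col g {a} (\<lambda>_. x)" using col_singleton W(5) a by blast
  show cn: "conn (W - {a})" using biconn_delete[OF bic a(1)] v by blast
  have v': "v \<in> W - {a}" using v by simp
  note r = res_tight[OF W(2,3,4) c, unfolded W(1), OF fea unc cn v']
  have cnt: "cnt b {a} (\<lambda>_. x) y = (if E b y x then 1 else 0)" for b y
  proof -
    have "{u. u = a \<and> E b y x} = (if E b y x then {a} else {})" by auto
    then show ?thesis unfolding cnt_def by simp
  qed
  show "y \<in> X v \<Longrightarrow> g b y = res g {a} (\<lambda>_. x) b y + (if E b y x then 1 else 0)"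
    using r(1) cnt by simp
  show "A b v a \<Longrightarrow> \<exists>y\<in>X v. E b y x" using r(2) by blast
  show "feas (res g {a} (\<lambda>_. x)) (W - {a})"
    using res_feas[OF W(2,3,4), of "\<lambda>_. x" g, unfolded W(1), OF col_range[OF c] fea] by simp
  show "uncol (res g {a} (\<lambda>_. x)) (W - {a})"
    using res_uncol[OF W(2,3,4) c, unfolded W(1), OF unc] .
qed

lemma match_pos:
  assumes "a \<in> W" "v \<in> W" "A b v a" "x \<in> supp g a"
  shows "\<exists>y\<in>X v. E b y x \<and> 1 \<le> g b y"
proof -
  have "v \<noteq> a" using assms(3) A_irrefl by blast
  then obtain y where "y \<in> X v" "E b y x" using delete_vertex(2)[of a x v] assms by blast
  then show ?thesis using delete_vertex(1)[of a x v y b] assms \<open>v \<noteq> a\<close> by auto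
qed

lemma match_supp:
  assumes "a \<in> W" "v \<in> W" "A b v a" "x \<in> supp g a"
  obtains y where "y \<in> supp g v" "E b y x"
proof -
  obtain y where y: "y \<in> X v" "E b y x" "1 \<le> g b y" using match_pos[OF assms] by blast
  then have "y \<in> supp g v" by (auto simp: supp_def intro!: exI[of _ b])
  then show ?thesis using that y by blast
qed

lemma match_supp':
  assumes "a \<in> W" "v \<in> W" "A b a v" "x \<in> supp g a"
  obtains y where "y \<in> supp g v" "E b x y"
  using match_supp[of a v "\<not> b" x] assms by (auto simp: A_flip E_flip)

text \<open>Passing from \<open>y\<close> to its partner over \<open>a\<close> and back returns to
  \<open>y\<close>, and \<open>match_pos\<close> gives the endpoint positive weight in direction
  \<open>b\<close>. So membership in the support, which asks for one direction only, yields every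
  direction in which the vertex has arcs.\<close>

lemma supp_pos:
  assumes a: "a \<in> W" "v \<in> W" "A b v a" and y: "y \<in> supp g v"
  shows "1 \<le> g b y"
proof -
  obtain x where x: "x \<in> supp g a" "E b y x" using match_supp'[OF a(2,1,3) y] .
  obtain y' where "y' \<in> X v" "E b y' x" "1 \<le> g b y'" using match_pos[OF a x(1)] by blast
  moreover have "y' = y" using calculation x y a WV E_inj[of v a y' y x b] supp_X by blast
  ultimately show ?thesis by simp
qed

lemma supp_zero:
  assumes "v \<in> W" "\<And>u. u \<in> W \<Longrightarrow> \<not> A b v u" "x \<in> X v"
  shows "g b x = 0"
proof -
  have "deg b W v = 0" using assms(2) deg_pos_iff[OF finite_W, of b v] by auto
  then have "(\<Sum>x\<in>X v. g b x) = 0" using sum_tight assms(1) by simp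
  then show ?thesis using finite_X assms WV by (auto simp: subset_iff)
qed

text \<open>The matching of a single arc embeds one support into the other.\<close>

lemma card_supp_nb:
  assumes "u \<in> W" "v \<in> W" "nb u v"
  shows "card (supp g u) \<le> card (supp g v)"
proof -
  obtain b where b: "A b u v" using assms by (auto simp: nb_def)
  have "\<forall>x\<in>supp g u. \<exists>y. y \<in> supp g v \<and> E b x y"
    using match_supp'[OF assms(1,2) b] by metis
  then obtain h where h: "\<And>x. x \<in> supp g u \<Longrightarrow> h x \<in> supp g v \<and> E b x (h x)" by metis
  have "inj_on h (supp g u)"
  proof (rule inj_onI)
    fix x x' assume *: "x \<in> supp g u" "x' \<in> supp g u" "h x = h x'"
    have "E b x (h x)" "E b x' (h x)" "h x \<in> X v" using h * supp_X by metis+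
    then show "x = x'" using E_inj[of u v x x'] * supp_X assms WV by blast
  qed
  moreover have "h ` supp g u \<subseteq> supp g v" using h by blast
  ultimately show ?thesis using finite_supp[OF assms(2)] card_inj_on_le by metis
qed

lemma card_supp:
  assumes "u \<in> W" "v \<in> W"
  shows "card (supp g u) = card (supp g v)"
proof -
  let ?P = "{w \<in> W. card (supp g w) = card (supp g u)}"
  have "?P = W"
  proof (rule ccontr)
    assume "?P \<noteq> W"
    then obtain w w' where w: "w \<in> ?P" "w' \<in> W - ?P" "nb w w'"
      using conn_cut[OF W_conn, of ?P] assms by blast
    then show False using card_supp_nb[of w w'] card_supp_nb[of w' w] adj_sym[of w w'] by auto
  qed
  moreover have "v \<in> W" by (fact assms)
  ultimately have "v \<in> ?P" by (simp only:)
  then show ?thesis by simp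
qed

end

section \<open>Critical cycles\<close>

context ugraph
begin

lemma cycle_enum_card_nb:
  assumes cyc: "cycle_enum n v W" and w: "w \<in> W"
  shows "card {u \<in> W. adj w u} \<le> 2"
proof -
  obtain i where i: "i < n" "w = v i" using cycle_enum_surj[OF cyc w] .
  have "{u \<in> W. adj w u} \<subseteq> {v (Suc i mod n), v (if i = 0 then n - 1 else i - 1)}"
  proof
    fix u assume u: "u \<in> {u \<in> W. adj w u}"
    then obtain j where j: "j < n" "u = v j" using cycle_enum_surj[OF cyc] by blast
    then have "j = Suc i mod n \<or> i = Suc j mod n" using u i cyc by (auto simp: cycle_enum_def)
    then show "u \<in> {v (Suc i mod n), v (if i = 0 then n - 1 else i - 1)}"
    proof
      assume "i = Suc j mod n"
      then have "j = (if i = 0 then n - 1 else i - 1)"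
        using j by (cases "Suc j = n") auto
      then show ?thesis using j by simp
    qed (use j in simp)
  qed
  then have "card {u \<in> W. adj w u} \<le> card {v (Suc i mod n), v (if i = 0 then n - 1 else i - 1)}"
    by (intro card_mono) auto
  also have "\<dots> \<le> 2" by (simp add: card_insert_if)
  finally show ?thesis .
qed

lemma cycle_enum_rotate1:
  assumes "cycle_enum n v W"
  shows "cycle_enum n (\<lambda>i. v (Suc i mod n)) W"
proof -
  have n: "3 \<le> n" and bij: "bij_betw v {..<n} W"
    and adj: "\<And>i j. i < n \<Longrightarrow> j < n \<Longrightarrow> adj (v i) (v j) \<longleftrightarrow> j = Suc i mod n \<or> i = Suc j mod n"
    using assms by (auto simp: cycle_enum_def)
  have inj: "Suc i mod n = Suc j mod n \<longleftrightarrow> i = j" if "i < n" "j < n" for i j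
    using that by (auto simp: mod_Suc split: if_splits)
  then have "inj_on (\<lambda>i. Suc i mod n) {..<n}" by (auto intro: inj_onI)
  moreover have "(\<lambda>i. Suc i mod n) ` {..<n} \<subseteq> {..<n}" using n by auto
  ultimately have "bij_betw (\<lambda>i. Suc i mod n) {..<n} {..<n}"
    by (simp add: bij_betw_def endo_inj_surj)
  then have "bij_betw (\<lambda>i. v (Suc i mod n)) {..<n} W"
    using bij_betw_trans[OF _ bij] by (simp add: comp_def)
  moreover have "adj (v (Suc i mod n)) (v (Suc j mod n)) \<longleftrightarrow> j = Suc i mod n \<or> i = Suc j mod n"
    if "i < n" "j < n" for i j
    using that n adj[of "Suc i mod n" "Suc j mod n"] inj[of j "Suc i mod n"] inj[of i "Suc j mod n"]
    by auto
  ultimately show ?thesis using n unfolding cycle_enum_def by blast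
qed

text \<open>Lets a statement proved at the first edge be used at every edge.\<close>

lemma cycle_enum_rotate:
  "cycle_enum n v W \<Longrightarrow> cycle_enum n (\<lambda>i. v ((i + k) mod n)) W"
proof (induction k)
  case 0
  then have "cycle_enum n (\<lambda>i. v (i mod n)) W \<longleftrightarrow> cycle_enum n v W"
    unfolding cycle_enum_def by (intro conj_cong refl bij_betw_cong) auto
  then show ?case using 0 by simp
next
  case (Suc k)
  from cycle_enum_rotate1[OF Suc.IH[OF Suc.prems]]
  have "cycle_enum n (\<lambda>i. v ((Suc i mod n + k) mod n)) W" .
  moreover have "(Suc i mod n + k) mod n = (i + Suc k) mod n" for i
    by (simp add: mod_add_left_eq)
  ultimately show ?case by simp
qed

end

locale critical_cycle = critical_block +
  fixes n :: nat and v :: "nat \<Rightarrow> 'a"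
  assumes cyc: "cycle_enum n v W" and two: "w \<in> W \<Longrightarrow> 2 \<le> card (supp g w)"
begin

lemma n3: "3 \<le> n" using cyc by (simp add: cycle_enum_def)

lemma nb_iff: "i < n \<Longrightarrow> j < n \<Longrightarrow> nb (v i) (v j) \<longleftrightarrow> j = Suc i mod n \<or> i = Suc j mod n"
  using cyc by (simp add: cycle_enum_def)

lemma nb_Suc: "Suc i < n \<Longrightarrow> nb (v i) (v (Suc i))"
  by (subst nb_iff) auto

lemma v_W: "i < n \<Longrightarrow> v i \<in> W"
  using cycle_enum_range[OF cyc] .

lemma v_eq: "i < n \<Longrightarrow> j < n \<Longrightarrow> v i = v j \<longleftrightarrow> i = j"
  using cycle_enum_eq_iff[OF cyc] .

text \<open>At least two support vertices, each of weight at least 1 in direction \<open>b\<close>,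
  share a total that is a degree of at most 2. Everything is therefore sharp: two vertices of weight
  1, and arcs in direction \<open>b\<close> to all neighbours.\<close>

lemma active:
  assumes w: "w \<in> W" and u: "u \<in> W" "A b w u"
  shows "card (supp g w) = 2"
    and "x \<in> supp g w \<Longrightarrow> g b x = 1"
    and "u' \<in> W \<Longrightarrow> nb w u' \<Longrightarrow> A b w u'"
proof -
  let ?S = "supp g w"
  have fin: "finite (X w)" "finite {u \<in> W. nb w u}" using finite_X w WV finite_W by auto
  have finS: "finite ?S" using finite_supp w .
  have sub: "{u \<in> W. A b w u} \<subseteq> {u \<in> W. nb w u}" by (auto simp: nb_def)
  then have le: "deg b W w \<le> card {u \<in> W. nb w u}" unfolding deg_def using fin by (intro card_mono)
  have ge1: "1 \<le> g b x" if "x \<in> ?S" for x using supp_pos[OF u(1) w u(2) that] .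
  have "(\<Sum>x\<in>?S. g b x) \<le> (\<Sum>x\<in>X w. g b x)"
    using fin by (intro sum_mono2) (auto simp: supp_def)
  also have "\<dots> = deg b W w" using sum_tight w .
  finally have sum: "(\<Sum>x\<in>?S. g b x) \<le> deg b W w" .
  have card: "card ?S \<le> (\<Sum>x\<in>?S. g b x)" using sum_mono[of ?S "\<lambda>_. 1" "g b"] ge1 by simp
  show c2: "card ?S = 2" using two[OF w] card sum le cycle_enum_card_nb[OF cyc w] by linarith
  have eq: "(\<Sum>x\<in>?S. 1) = (\<Sum>x\<in>?S. g b x)" using c2 card sum le cycle_enum_card_nb[OF cyc w] by simp
  show "x \<in> ?S \<Longrightarrow> g b x = 1"
    using sum_mono_inv[OF eq _ _ finS, of x] ge1 by simp
  have "card {u \<in> W. A b w u} = card {u \<in> W. nb w u}"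
    using le c2 card sum cycle_enum_card_nb[OF cyc w] by (simp add: deg_def)
  then have "{u \<in> W. A b w u} = {u \<in> W. nb w u}" using sub fin by (intro card_subset_eq) auto
  then show "u' \<in> W \<Longrightarrow> nb w u' \<Longrightarrow> A b w u'" by blast
qed

lemma card_supp2: "w \<in> W \<Longrightarrow> card (supp g w) = 2"
proof -
  assume w: "w \<in> W"
  then obtain i where i: "i < n" "w = v i" using cycle_enum_surj[OF cyc] by blast
  have "Suc i mod n < n" using n3 by simp
  then have "nb w (v (Suc i mod n))" using nb_iff i by simp
  then obtain b where "A b w (v (Suc i mod n))" by (auto simp: nb_def)
  then show ?thesis using active(1)[OF w v_W] \<open>Suc i mod n < n\<close> by blast
qed

text \<open>The weights on the supports depend on the arcs of the digraph alone; this is what makes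
  a cycle rigid in \<open>no_rigid_subblock\<close>.\<close>

lemma g_value:
  assumes "w \<in> W" "x \<in> supp g w"
  shows "g b x = (if \<exists>u\<in>W. A b w u then 1 else 0)"
  using active(2)[of w _ b x] supp_zero[of w b x] supp_X assms by auto

text \<open>Relative to the arcs of the digraph: on a digon, both arcs have to be present in
  \<open>H\<close>, so one missing arc already leaves room for a greedy step.\<close>

definition full :: "'a \<Rightarrow> 'a \<Rightarrow> 'b \<Rightarrow> 'b \<Rightarrow> bool" where
  "full w u x y \<longleftrightarrow> (\<forall>b. A b w u \<longrightarrow> E b x y)"

definition greedy :: "nat \<Rightarrow> ('a \<Rightarrow> 'b) \<Rightarrow> bool" where
  "greedy k \<phi> \<longleftrightarrow> (\<forall>i\<le>k. \<phi> (v i) \<in> supp g (v i)) \<and>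
     (\<forall>i<k. \<not> full (v i) (v (Suc i)) (\<phi> (v i)) (\<phi> (v (Suc i))))"

text \<open>The only earlier neighbour of the next vertex is its predecessor. If the arc in
  direction \<open>b\<close> from the predecessor's colour is missing, the next vertex has count 0
  and positive weight in the opposite direction. The bound on \<open>k\<close> keeps the closing
  edge out.\<close>

lemma greedy_col: "k < n - 1 \<Longrightarrow> greedy k \<phi> \<Longrightarrow> col g (v ` {..k}) \<phi>"
proof (induction k)
  case 0
  have "{..0::nat} = {0}" by auto
  moreover have "col g {v 0} \<phi>"
    using col_singleton[of "v 0" "\<phi> (v 0)" g] v_W[of 0] 0 n3 WV col_cong[of "{v 0}" "\<lambda>_. \<phi> (v 0)" \<phi>]
    by (auto simp: greedy_def)
  ultimately show ?case by simp
next
  case (Suc k)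
  let ?s = "v (Suc k)" let ?U = "v ` {..k}"
  have k: "Suc k < n" "k < n" using Suc.prems by auto
  have IH: "col g ?U \<phi>" using Suc by (auto simp: greedy_def)
  obtain b where b: "A b (v k) ?s" "\<not> E b (\<phi> (v k)) (\<phi> ?s)"
    using Suc.prems unfolding greedy_def full_def by blast
  have rng: "\<phi> (v i) \<in> supp g (v i)" if "i \<le> Suc k" for i using that Suc.prems by (simp add: greedy_def)
  have "\<not> E (\<not> b) (\<phi> ?s) (\<phi> (v i))" if i: "i \<le> k" for i
  proof
    assume E: "E (\<not> b) (\<phi> ?s) (\<phi> (v i))"
    have "A (\<not> b) ?s (v i)"
    proof (rule E_A[OF _ _ _ _ E])
      show "?s \<in> V" "v i \<in> V" using v_W k i WV by auto
      show "\<phi> ?s \<in> X ?s" "\<phi> (v i) \<in> X (v i)" using rng supp_X i by auto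
    qed
    then have "nb ?s (v i)" by (auto simp: nb_def)
    then have "i = Suc (Suc k) mod n \<or> Suc k = Suc i mod n" using nb_iff k i by simp
    moreover have "Suc (Suc k) < n" using Suc.prems by simp
    ultimately have "i = k" using i k by auto
    then show False using E b E_flip by blast
  qed
  then have "cnt (\<not> b) ?U \<phi> (\<phi> ?s) = 0"
    unfolding cnt_def using finite_sub by auto
  moreover have "1 \<le> g (\<not> b) (\<phi> ?s)"
    using supp_pos[of "v k" ?s "\<not> b" "\<phi> ?s"] v_W k rng b A_flip by auto
  ultimately have "col g (insert ?s ?U) (\<phi>(?s := \<phi> ?s))"
    using IH v_W k WV rng supp_X v_eq
    by (intro col_insert[where b = "\<not> b"]) (auto simp: subset_iff)
  moreover have "v ` {..Suc k} = insert ?s ?U" by (simp add: atMost_Suc)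
  ultimately show ?case by simp
qed

text \<open>When all vertices but the last are coloured, tightness on the single remaining vertex
  makes its residual zero. Its weight 1 in direction \<open>b\<close> is then used up by exactly one
  coloured vertex, which must be one of its two neighbours on the cycle.\<close>

lemma closing:
  assumes \<phi>: "greedy (n - 2) \<phi>" and z: "z \<in> supp g (v (n - 1))"
    and b: "A b (v (n - 1)) (v 0)"
  shows "E b z (\<phi> (v (n - 2))) \<longleftrightarrow> \<not> E b z (\<phi> (v 0))"
proof -
  let ?U = "v ` {..n - 2}" let ?l = "v (n - 1)"
  have c: "col g ?U \<phi>" using greedy_col[OF _ \<phi>] n3 by simp
  have lW: "?l \<in> W" using v_W n3 by simp
  have UW: "?U \<union> {?l} = W"
  proof -
    have "{..<n} = insert (n - 1) {..n - 2}" using n3 by auto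
    moreover have "W = v ` {..<n}" using cyc by (auto simp: cycle_enum_def bij_betw_def)
    ultimately show ?thesis by auto
  qed
  have sub: "?U \<subseteq> V" "{?l} \<subseteq> V" "?U \<inter> {?l} = {}"
    using UW WV lW v_eq n3 by auto
  have fU: "feas g (?U \<union> {?l})" and uU: "uncol g (?U \<union> {?l})" using UW fea unc by auto
  have "(\<Sum>x\<in>X ?l. res g ?U \<phi> b x) = deg b {?l} ?l"
    using tight[OF sub(2) conn_singleton res_feas[of ?U "{?l}" \<phi>, OF sub col_range[OF c] fU]
        res_uncol[OF sub c uU]] by blast
  also have "\<dots> = 0" using deg_pos_iff[of "{?l}" b ?l] A_irrefl by simp
  finally have "res g ?U \<phi> b z = 0" using supp_X[OF z] finite_X sub by auto
  moreover have "g b z = res g ?U \<phi> b z + cnt b ?U \<phi> z"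
    using res_tight(1)[OF sub c fU uU conn_singleton _ supp_X[OF z]] by blast
  moreover have "g b z = 1" using active(2)[OF lW v_W b z] n3 by simp
  ultimately have "card {u \<in> ?U. E b z (\<phi> u)} = 1" by (simp add: cnt_def)
  then obtain w where w: "{u \<in> ?U. E b z (\<phi> u)} = {w}" by (auto simp: card_1_singleton_iff)
  have ends: "v 0 \<in> ?U" "v (n - 2) \<in> ?U" "v 0 \<noteq> v (n - 2)" using n3 v_eq by auto
  have "w \<in> {u \<in> ?U. E b z (\<phi> u)}" unfolding w by simp
  then obtain i where i: "w = v i" "i \<le> n - 2" "E b z (\<phi> (v i))" by auto
  have only: "u = w" if "u \<in> ?U" "E b z (\<phi> u)" for u
    using that w by (metis (mono_tags, lifting) mem_Collect_eq singletonD)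
  have "nb ?l (v i)"
    using E_A[OF _ _ _ _ i(3), of ?l "v i"] sub i(2) supp_X[OF z] col_range[OF c, of "v i"]
    by (auto simp: nb_def)
  then have "i = Suc (n - 1) mod n \<or> n - 1 = Suc i mod n" using nb_iff i n3 by simp
  then have "i = 0 \<or> i = n - 2" using n3 i by auto
  then show ?thesis
  proof
    assume "i = 0"
    then show ?thesis using only[of "v (n - 2)"] i ends by auto
  next
    assume "i = n - 2"
    then show ?thesis using only[of "v 0"] i ends by auto
  qed
qed

text \<open>If the matchings of the first digon disagreed at \<open>x\<close>, no colour of
  \<open>v 1\<close> would be full with \<open>x\<close>. Starting from \<open>x\<close>, every
  colour of \<open>v (n - 2)\<close> could then be reached, and \<open>closing\<close> would join a
  vertex \<open>q\<close> over the last vertex to both colours there or to neither, although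
  \<open>q\<close> is matched to one of them only.\<close>

lemma untwisted0:
  assumes x: "x \<in> supp g (v 0)" and y: "y \<in> supp g (v 1)"
    and A: "A b (v 0) (v 1)" "A b' (v 0) (v 1)" and E: "E b x y"
  shows "E b' x y"
proof (rule ccontr)
  assume nE: "\<not> E b' x y"
  have V: "v i \<in> V" if "i < n" for i using v_W[OF that] WV by blast
  have reach: "\<exists>\<phi>. greedy k \<phi> \<and> \<phi> (v 0) = x \<and> \<phi> (v k) = z"
    if "1 \<le> k" "k < n" "z \<in> supp g (v k)" for k z
    using that
  proof (induction k arbitrary: z rule: nat_induct_at_least)
    case base
    have "\<not> full (v 0) (v 1) x z"
    proof (cases "z = y")
      case True
      then show ?thesis using nE A unfolding full_def by blast
    next
      case False
      then have "\<not> E b x z"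
        using E_fun[of "v 0" "v 1" x y z b] V x y base supp_X E n3 by auto
      then show ?thesis using A unfolding full_def by blast
    qed
    moreover have "v 0 \<noteq> v 1" using v_eq n3 by simp
    ultimately have "greedy 1 (\<lambda>w. if w = v 0 then x else z)"
      using x base unfolding greedy_def by (auto simp: le_Suc_eq)
    then show ?case using \<open>v 0 \<noteq> v 1\<close>
      by (intro exI[of _ "\<lambda>w. if w = v 0 then x else z"]) auto
  next
    case (Suc k)
    have k: "k < n" "Suc k < n" using Suc.prems by auto
    obtain b0 where b0: "A b0 (v k) (v (Suc k))" using nb_Suc[of k] k by (auto simp: nb_def)
    \<comment> \<open>The matching is injective and \<open>v k\<close> has two colours, so one of
      them is not joined to \<open>z\<close>.\<close>
    have "\<exists>w\<in>supp g (v k). \<not> E b0 w z"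
    proof (rule ccontr)
      assume "\<not> ?thesis"
      then have all: "\<And>w. w \<in> supp g (v k) \<Longrightarrow> E b0 w z" by blast
      have "w = w'" if "w \<in> supp g (v k)" "w' \<in> supp g (v k)" for w w'
        using E_inj[of "v k" "v (Suc k)" w w' z b0] all that V k supp_X Suc.prems by blast
      then have "card (supp g (v k)) \<le> 1"
        using card_le_Suc0_iff_eq[OF finite_supp[OF v_W[OF k(1)]]] by auto
      then show False using two[OF v_W[OF k(1)]] by simp
    qed
    then obtain w where w: "w \<in> supp g (v k)" "\<not> E b0 w z" by blast
    then obtain \<phi> where \<phi>: "greedy k \<phi>" "\<phi> (v 0) = x" "\<phi> (v k) = w"
      using Suc.IH k by blast
    have ne: "v i \<noteq> v (Suc k)" if "i \<le> k" for i using that v_eq k by simp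
    have "\<not> full (v k) (v (Suc k)) w z" using w b0 unfolding full_def by blast
    then have "greedy (Suc k) (\<phi>(v (Suc k) := z))"
      using \<phi> ne Suc.prems unfolding greedy_def by (auto simp: le_Suc_eq less_Suc_eq)
    moreover have "(\<phi>(v (Suc k) := z)) (v 0) = x" "(\<phi>(v (Suc k) := z)) (v (Suc k)) = z"
      using \<phi> ne[of 0] by auto
    ultimately show ?case by blast
  qed
  let ?m = "v (n - 2)" let ?l = "v (n - 1)"
  have "Suc (n - 2) = n - 1" using n3 by simp
  then have nbml: "nb ?m ?l" using nb_Suc[of "n - 2"] n3 by simp
  have nbl0: "nb ?l (v 0)" using nb_iff[of "n - 1" 0] n3 by simp
  obtain b1 where b1: "A b1 ?l (v 0)" using nbl0 by (auto simp: nb_def)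
  have W: "?m \<in> W" "?l \<in> W" "v 0 \<in> W" using v_W n3 by auto
  have b1': "A b1 ?l ?m" using active(3)[OF W(2,3) b1 W(1)] adj_sym[OF nbml] by blast
  have "\<not> card (supp g ?m) \<le> 1" using two[OF W(1)] by simp
  then obtain z1 z2 where z: "z1 \<in> supp g ?m" "z2 \<in> supp g ?m" "z1 \<noteq> z2"
    using card_le_Suc0_iff_eq[OF finite_supp[OF W(1)]] by auto
  obtain q where q: "q \<in> supp g ?l" "E b1 q z1" using match_supp[OF W(1,2) b1' z(1)] .
  have n12: "1 \<le> n - 2" "n - 2 < n" using n3 by linarith+
  \<comment> \<open>The right-hand side does not mention \<open>z'\<close>: both colours of
    \<open>?m\<close> get the same answer.\<close>
  have cl: "E b1 q z' \<longleftrightarrow> \<not> E b1 q x" if z': "z' \<in> supp g ?m" for z'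
  proof -
    obtain \<phi> where \<phi>: "greedy (n - 2) \<phi>" "\<phi> (v 0) = x" "\<phi> ?m = z'"
      using reach[OF _ _ z'] n12 by blast
    show ?thesis using closing[OF \<phi>(1) q(1) b1] \<phi>(2,3) by simp
  qed
  have "E b1 q z2" using cl[OF z(1)] cl[OF z(2)] q(2) by blast
  then show False using E_fun[of ?l ?m q z1 z2 b1] W WV q z supp_X by blast
qed

lemma untwisted:
  assumes i: "i < n" and x: "x \<in> supp g (v i)" and y: "y \<in> supp g (v (Suc i mod n))"
    and A: "A b (v i) (v (Suc i mod n))" "A b' (v i) (v (Suc i mod n))" and E: "E b x y"
  shows "E b' x y"
proof -
  interpret rot: critical_cycle V A X E W g n "\<lambda>j. v ((j + i) mod n)"
    by unfold_locales (use cycle_enum_rotate[OF cyc] two in auto)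
  show ?thesis using rot.untwisted0[of x y b b'] assms by simp
qed

text \<open>Two labels at \<open>v 0\<close> are carried along the path by the matchings; by
  \<open>untwisted\<close> it does not matter which arc of an edge is used.\<close>

lemma labels_path:
  obtains s :: "nat \<Rightarrow> bool \<Rightarrow> 'b" where
    "\<And>i. i < n \<Longrightarrow> supp g (v i) = {s i True, s i False}"
    "\<And>i. i < n \<Longrightarrow> s i True \<noteq> s i False"
    "\<And>i b c c'. Suc i < n \<Longrightarrow> A b (v i) (v (Suc i)) \<Longrightarrow> E b (s i c) (s (Suc i) c') \<longleftrightarrow> c = c'"
proof -
  have V: "v i \<in> V" if "i < n" for i using v_W[OF that] WV by blast
  obtain a0 a1 where a: "supp g (v 0) = {a0, a1}" "a0 \<noteq> a1"
    using card_supp2[OF v_W[of 0]] n3 by (auto simp: card_2_iff)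
  \<comment> \<open>The successor is chosen through any direction; \<open>step\<close> shows that it
    then serves all directions of the edge.\<close>
  define s where "s = rec_nat (\<lambda>c. if c then a0 else a1)
    (\<lambda>k f c. SOME y. y \<in> supp g (v (Suc k)) \<and> (\<exists>b. E b (f c) y))"
  have s0: "s 0 c = (if c then a0 else a1)" for c by (simp add: s_def)
  have sS: "s (Suc k) c = (SOME y. y \<in> supp g (v (Suc k)) \<and> (\<exists>b. E b (s k c) y))" for k c
    by (simp add: s_def)
  have step: "s (Suc k) c \<in> supp g (v (Suc k)) \<and> (\<forall>b. A b (v k) (v (Suc k)) \<longrightarrow> E b (s k c) (s (Suc k) c))"
    if k: "Suc k < n" "s k c \<in> supp g (v k)" for k c
  proof -
    obtain b where b: "A b (v k) (v (Suc k))" using nb_Suc[OF k(1)] by (auto simp: nb_def)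
    obtain y where "y \<in> supp g (v (Suc k))" "E b (s k c) y"
      using match_supp'[OF _ _ b k(2)] v_W k by auto
    then have "\<exists>y. y \<in> supp g (v (Suc k)) \<and> (\<exists>b. E b (s k c) y)" by blast
    from someI_ex[OF this] have *: "s (Suc k) c \<in> supp g (v (Suc k))" "\<exists>b. E b (s k c) (s (Suc k) c)"
      unfolding sS by auto
    then obtain b1 where b1: "E b1 (s k c) (s (Suc k) c)" by blast
    have A1: "A b1 (v k) (v (Suc k))"
      using E_A[OF _ _ _ _ b1] V k * supp_X by auto
    have "E b' (s k c) (s (Suc k) c)" if "A b' (v k) (v (Suc k))" for b'
      using untwisted[of k "s k c" "s (Suc k) c" b1 b'] k * b1 A1 that by simp
    then show ?thesis using * by blast
  qed
  have mem: "s k c \<in> supp g (v k)" if "k < n" for k c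
    using that by (induction k) (use a s0 step in auto)
  have dist: "s k True \<noteq> s k False" if "k < n" for k
    using that
  proof (induction k)
    case 0
    then show ?case using a s0 by simp
  next
    case (Suc k)
    obtain b where b: "A b (v k) (v (Suc k))" using nb_Suc[OF Suc.prems] by (auto simp: nb_def)
    show ?case
    proof
      assume eq: "s (Suc k) True = s (Suc k) False"
      have "E b (s k True) (s (Suc k) True)" "E b (s k False) (s (Suc k) True)"
        using step[of k True] step[of k False] Suc.prems mem[of k] b eq by auto
      then have "s k True = s k False"
        using E_inj[of "v k" "v (Suc k)"] V Suc.prems mem supp_X by (meson Suc_lessD)
      then show False using Suc by simp
    qed
  qed
  show ?thesis
  proof
    show "s i True \<noteq> s i False" if "i < n" for i using dist that .
    show "supp g (v i) = {s i True, s i False}" if "i < n" for i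
    proof -
      have "{s i True, s i False} \<subseteq> supp g (v i)" using mem that by simp
      moreover have "card {s i True, s i False} = 2" using dist that by simp
      ultimately show ?thesis
        using card_supp2[OF v_W[OF that]] finite_supp[OF v_W[OF that]]
        by (metis card_subset_eq)
    qed
    show "E b (s i c) (s (Suc i) c') \<longleftrightarrow> c = c'" if i: "Suc i < n" "A b (v i) (v (Suc i))" for i b c c'
    proof -
      have E: "E b (s i c) (s (Suc i) c)" using step[of i c] mem[of i c] i by auto
      show ?thesis
      proof
        assume "E b (s i c) (s (Suc i) c')"
        then have "s (Suc i) c = s (Suc i) c'"
          using E E_fun[of "v i" "v (Suc i)" "s i c" "s (Suc i) c" "s (Suc i) c'" b] V i mem supp_X
          by auto
        then show "c = c'" using dist[OF i(1)] by (cases c; cases c') auto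
      qed (use E in simp)
    qed
  qed
qed

text \<open>The alternating labels along the path form a greedy colouring, so the closing edge is
  forced to be twisted exactly when the cycle is even.\<close>

lemma labels:
  "\<exists>s :: nat \<Rightarrow> bool \<Rightarrow> 'b.
     (\<forall>i<n. supp g (v i) = {s i True, s i False}) \<and> (\<forall>i<n. s i True \<noteq> s i False) \<and>
     (\<forall>i b c c'. Suc i < n \<longrightarrow> A b (v i) (v (Suc i)) \<longrightarrow> (E b (s i c) (s (Suc i) c') \<longleftrightarrow> c = c')) \<and>
     (\<forall>b c c'. A b (v (n - 1)) (v 0) \<longrightarrow> (E b (s (n - 1) c) (s 0 c') \<longleftrightarrow> (c = c') = odd n))"
proof -
  obtain s :: "nat \<Rightarrow> bool \<Rightarrow> 'b" where s: "\<And>i. i < n \<Longrightarrow> supp g (v i) = {s i True, s i False}"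
    "\<And>i. i < n \<Longrightarrow> s i True \<noteq> s i False"
    "\<And>i b c c'. Suc i < n \<Longrightarrow> A b (v i) (v (Suc i)) \<Longrightarrow> E b (s i c) (s (Suc i) c') \<longleftrightarrow> c = c'"
    using labels_path by metis
  have mem: "s i c \<in> supp g (v i)" if "i < n" for i c using s(1)[OF that] by (cases c) auto
  \<comment> \<open>\<open>inv_into\<close> recovers the position on the cycle, whose parity is
    taken as the label.\<close>
  define \<phi> where "\<phi> w = s (inv_into {..<n} v w) (even (inv_into {..<n} v w))" for w
  have "inj_on v {..<n}" using cyc by (simp add: cycle_enum_def bij_betw_def)
  then have \<phi>: "\<phi> (v i) = s i (even i)" if "i < n" for i
    using that by (simp add: \<phi>_def inv_into_f_f)
  have "greedy (n - 2) \<phi>"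
    unfolding greedy_def
  proof (intro conjI allI impI)
    fix i assume "i \<le> n - 2"
    then show "\<phi> (v i) \<in> supp g (v i)" using \<phi>[of i] mem n3 by simp
  next
    fix i assume i: "i < n - 2"
    have i': "Suc i < n" using i by linarith
    obtain b where b: "A b (v i) (v (Suc i))" using nb_Suc[OF i'] by (auto simp: nb_def)
    have "\<not> E b (\<phi> (v i)) (\<phi> (v (Suc i)))" using \<phi>[of i] \<phi>[of "Suc i"] i' s(3)[OF i' b] by simp
    then show "\<not> full (v i) (v (Suc i)) (\<phi> (v i)) (\<phi> (v (Suc i)))" using b unfolding full_def by blast
  qed
  note cl = closing[OF this]
  let ?l = "v (n - 1)" and ?m = "v (n - 2)"
  have nn: "Suc (n - 2) = n - 1" "n - 1 < n" "n - 2 < n" "0 < n" using n3 by auto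
  have par: "even (n - 2) \<longleftrightarrow> even n" using n3 by auto
  \<comment> \<open>At \<open>v (n - 2)\<close> the alternating label is \<open>even n\<close>. A
    label \<open>c\<close> at the last vertex is joined to it exactly when
    \<open>c = even n\<close>, and by \<open>closing\<close> it is joined to \<open>s 0 True\<close>
    in exactly the other case.\<close>
  have T: "E b (s (n - 1) c) (s 0 True) \<longleftrightarrow> c = odd n" if b: "A b ?l (v 0)" for b c
  proof -
    have "nb ?m ?l" using nb_Suc[of "n - 2"] nn by simp
    then have "A b ?l ?m" using active(3)[OF v_W v_W b v_W] adj_sym nn by blast
    then have "A (\<not> b) ?m ?l" by (simp add: A_flip)
    then have "E (\<not> b) (s (n - 2) (even n)) (s (n - 1) c) \<longleftrightarrow> even n = c"
      using s(3)[of "n - 2" "\<not> b" "even n" c] nn by simp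
    moreover have "E b (s (n - 1) c) (s (n - 2) (even n)) \<longleftrightarrow> \<not> E b (s (n - 1) c) (s 0 True)"
      using cl[OF mem b] \<phi>[of 0] \<phi>[of "n - 2"] nn par by simp
    ultimately show ?thesis by (auto simp: E_flip)
  qed
  have "E b (s (n - 1) c) (s 0 c') \<longleftrightarrow> (c = c') = odd n" if b: "A b ?l (v 0)" for b c c'
  proof (cases c')
    case True
    then show ?thesis using T[OF b, of c] by auto
  next
    case False
    have V: "?l \<in> V" "v 0 \<in> V" using v_W nn WV by auto
    have X: "s (n - 1) c \<in> X ?l" "s 0 d \<in> X (v 0)" for d using mem supp_X nn by blast+
    \<comment> \<open>The support at \<open>v 0\<close> has two elements, and exactly one of them is
      matched to \<open>s (n - 1) c\<close>.\<close>
    have "E b (s (n - 1) c) (s 0 False) \<longleftrightarrow> \<not> E b (s (n - 1) c) (s 0 True)"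
    proof
      assume "E b (s (n - 1) c) (s 0 False)"
      then show "\<not> E b (s (n - 1) c) (s 0 True)"
        using E_fun[OF V X(1) X(2)[of True] X(2)[of False]] s(2)[of 0] nn by blast
    next
      assume "\<not> E b (s (n - 1) c) (s 0 True)"
      moreover obtain y where "y \<in> supp g (v 0)" "E b (s (n - 1) c) y"
        using match_supp'[OF v_W v_W b mem] nn by blast
      ultimately show "E b (s (n - 1) c) (s 0 False)" using s(1)[of 0] nn by auto
    qed
    then show ?thesis using False T[OF b, of c] by auto
  qed
  then show ?thesis using s by (intro exI[of _ s]) blast
qed

end

section \<open>Critical complete graphs\<close>

context cover_system
begin

text \<open>A K-configuration in local terms: on the supports, being equal or matched is an
  equivalence whose classes are the transversals, and the common weight on a class is its number
  \<open>n_i\<close>.\<close>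

definition complete_type :: "(bool \<Rightarrow> 'b \<Rightarrow> nat) \<Rightarrow> 'a set \<Rightarrow> bool" where
  "complete_type g W \<longleftrightarrow>
     (\<forall>u\<in>W. \<forall>v\<in>W. u \<noteq> v \<longrightarrow> (\<forall>b. A b u v)) \<and>
     (\<forall>u\<in>W. \<forall>v\<in>W. \<forall>x\<in>supp g u. \<forall>y\<in>supp g v. \<forall>b. E b x y \<longrightarrow>
        (\<forall>b'. E b' x y) \<and> (\<forall>b' b''. g b' x = g b'' y)) \<and>
     (\<forall>u\<in>W. \<forall>v\<in>W. \<forall>w\<in>W. \<forall>x\<in>supp g u. \<forall>y\<in>supp g v. \<forall>z\<in>supp g w. \<forall>b.
        v \<noteq> w \<longrightarrow> E b x y \<longrightarrow> E b x z \<longrightarrow> E b y z)"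

lemma complete_type_arc: "complete_type g W \<Longrightarrow> u \<in> W \<Longrightarrow> v \<in> W \<Longrightarrow> u \<noteq> v \<Longrightarrow> A b u v"
  by (simp add: complete_type_def)

lemma complete_type_sym:
  "complete_type g W \<Longrightarrow> u \<in> W \<Longrightarrow> v \<in> W \<Longrightarrow> x \<in> supp g u \<Longrightarrow> y \<in> supp g v \<Longrightarrow> E b x y \<Longrightarrow> E b' x y"
  unfolding complete_type_def by blast

lemma complete_type_eq:
  "complete_type g W \<Longrightarrow> u \<in> W \<Longrightarrow> v \<in> W \<Longrightarrow> x \<in> supp g u \<Longrightarrow> y \<in> supp g v \<Longrightarrow> E b x y \<Longrightarrow> g b' x = g b'' y"
  unfolding complete_type_def by blast

lemma complete_type_trans:
  "complete_type g W \<Longrightarrow> u \<in> W \<Longrightarrow> v \<in> W \<Longrightarrow> w \<in> W \<Longrightarrow> x \<in> supp g u \<Longrightarrow> y \<in> supp g v \<Longrightarrow> z \<in> supp g w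
    \<Longrightarrow> v \<noteq> w \<Longrightarrow> E b x y \<Longrightarrow> E b x z \<Longrightarrow> E b y z"
  unfolding complete_type_def by blast

end

context critical_cycle
begin

text \<open>By \<open>active\<close>, a direction present at a vertex is present on both of its
  edges. Going around the triangle, the direction seen from the current vertex alternates, and three
  is odd, so each edge carries both. The closing edge is untwisted for the same parity, so equal
  labels are joined throughout.\<close>

lemma triangle_complete_type:
  assumes n: "n = 3"
  shows "complete_type g W"
proof -
  have W: "W = {v 0, v 1, v 2}"
  proof -
    have "{..<n} = {0, 1, 2}" using n by auto
    then show ?thesis using cyc by (auto simp: cycle_enum_def bij_betw_def)
  qed
  have nbv: "nb (v i) (v j)" if "i < 3" "j < 3" "i \<noteq> j" for i j
  proof -
    have "i = 0 \<or> i = 1 \<or> i = 2" "j = 0 \<or> j = 1 \<or> j = 2" using that by auto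
    then show ?thesis using nb_iff[of i j] that n by auto
  qed
  have arc: "A b (v i) (v j)" if ij: "i < 3" "j < 3" "i \<noteq> j" for b i j
  proof -
    have "\<exists>k<3. k \<noteq> i \<and> k \<noteq> j" by presburger
    then obtain k where k: "k < 3" "k \<noteq> i" "k \<noteq> j" by blast
    have m: "v i \<in> W" "v j \<in> W" "v k \<in> W" using v_W ij k n by auto
    obtain d where d: "A d (v i) (v j)" using nbv[OF ij] by (auto simp: nb_def)
    have "A (\<not> d) (v j) (v i)" using d by (simp add: A_flip)
    then have "A (\<not> d) (v j) (v k)" using active(3)[OF m(2,1) _ m(3)] nbv[of j k] ij k by simp
    then have "A d (v k) (v j)" using A_flip by blast
    then have "A d (v k) (v i)" using active(3)[OF m(3,2) _ m(1)] nbv[of k i] ij k by simp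
    then have "A (\<not> d) (v i) (v k)" by (simp add: A_flip)
    then have "A (\<not> d) (v i) (v j)" using active(3)[OF m(1,3) _ m(2)] nbv[of i j] ij k by simp
    then show ?thesis using d by (cases "b = d") auto
  qed
  obtain s :: "nat \<Rightarrow> bool \<Rightarrow> 'b" where lab: "\<forall>i<n. supp g (v i) = {s i True, s i False}"
    "\<forall>i<n. s i True \<noteq> s i False"
    "\<forall>i b c c'. Suc i < n \<longrightarrow> A b (v i) (v (Suc i)) \<longrightarrow> (E b (s i c) (s (Suc i) c') \<longleftrightarrow> c = c')"
    "\<forall>b c c'. A b (v (n - 1)) (v 0) \<longrightarrow> (E b (s (n - 1) c) (s 0 c') \<longleftrightarrow> (c = c') = odd n)"
    using labels by (elim exE conjE) (rule that)
  note s = lab[rule_format]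
  have n1: "n - 1 = 2" "odd n" "Suc 0 < n" "Suc 1 < n" "Suc 1 = 2" using n by auto
  have fwd: "E b (s 0 c) (s 1 c') \<longleftrightarrow> c = c'" "E b (s 1 c) (s 2 c') \<longleftrightarrow> c = c'" "E b (s 2 c) (s 0 c') \<longleftrightarrow> c = c'"
    for b c c'
  proof -
    show "E b (s 0 c) (s 1 c') \<longleftrightarrow> c = c'" using s(3)[OF n1(3), of b c c'] arc[of 0 1 b] by simp
    show "E b (s 1 c) (s 2 c') \<longleftrightarrow> c = c'"
      using s(3)[OF n1(4), of b c c'] arc[of 1 2 b] unfolding n1(5) by simp
    show "E b (s 2 c) (s 0 c') \<longleftrightarrow> c = c'"
      using s(4)[of b c c'] arc[of 2 0 b] n1(2) unfolding n1(1) by simp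
  qed
  have E: "E b (s i c) (s j c') \<longleftrightarrow> c = c'" if "i < 3" "j < 3" "i \<noteq> j" for b i j c c'
  proof -
    have "i = 0 \<or> i = 1 \<or> i = 2" "j = 0 \<or> j = 1 \<or> j = 2" using that by auto
    then show ?thesis
      using that fwd[of b c c'] fwd[of "\<not> b" c' c] E_flip[of b] by auto
  qed
  have elem: "\<exists>i c. i < 3 \<and> u = v i \<and> x = s i c" if "u \<in> W" "x \<in> supp g u" for u x
  proof -
    obtain i where i: "i < n" "u = v i" using cycle_enum_surj[OF cyc \<open>u \<in> W\<close>] by blast
    then have "x = s i True \<or> x = s i False" using s(1)[of i] that by auto
    then show ?thesis using i n by blast
  qed
  have one: "g b x = 1" if ux: "u \<in> W" "x \<in> supp g u" for u x b
  proof -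
    obtain i where i: "i < 3" "u = v i" using elem[OF ux] by blast
    have "\<exists>k<3. k \<noteq> i" by presburger
    then obtain k where "k < 3" "k \<noteq> i" by blast
    then have "A b u (v k)" "v k \<in> W" using arc[of i k b] i v_W n by auto
    then show ?thesis using g_value[OF ux, of b] by auto
  qed
  have same: "\<not> E b (s i c) (s i c')" if "i < 3" for b i c c'
  proof -
    have m: "s i d \<in> X (v i)" for d using s(1)[of i] supp_X that n by (cases d) auto
    show ?thesis using E_irrefl[OF _ m m] v_W[of i] WV that n by auto
  qed
  show ?thesis
    unfolding complete_type_def
  proof (intro conjI ballI allI impI)
    fix u w b assume "u \<in> W" "w \<in> W" "u \<noteq> w"
    then obtain i j where "i < n" "u = v i" "j < n" "w = v j" using cycle_enum_surj[OF cyc] by metis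
    then show "A b u w" using arc n \<open>u \<noteq> w\<close> by auto
  next
    fix u w x y b b' assume *: "u \<in> W" "w \<in> W" "x \<in> supp g u" "y \<in> supp g w" "E b x y"
    obtain i c where i: "i < 3" "u = v i" "x = s i c" using elem[OF *(1,3)] by blast
    obtain j d where j: "j < 3" "w = v j" "y = s j d" using elem[OF *(2,4)] by blast
    have "i \<noteq> j" using same i j * by blast
    then show "E b' x y" using E i j * by simp
  next
    fix u w x y b b' b'' assume *: "u \<in> W" "w \<in> W" "x \<in> supp g u" "y \<in> supp g w" "E b x y"
    show "g b' x = g b'' y" using one[OF *(1,3)] one[OF *(2,4)] by simp
  next
    fix u u' w x y z b assume *: "u \<in> W" "u' \<in> W" "w \<in> W" "x \<in> supp g u" "y \<in> supp g u'" "z \<in> supp g w"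
      "u' \<noteq> w" "E b x y" "E b x z"
    obtain i c where i: "i < 3" "u = v i" "x = s i c" using elem[OF *(1,4)] by blast
    obtain j d where j: "j < 3" "u' = v j" "y = s j d" using elem[OF *(2,5)] by blast
    obtain k e where k: "k < 3" "w = v k" "z = s k e" using elem[OF *(3,6)] by blast
    have "i \<noteq> j" "i \<noteq> k" "j \<noteq> k" using same i j k * by auto
    then show "E b y z" using E i j k * by simp
  qed
qed

end

text \<open>\<open>IH\<close> is the induction hypothesis of \<open>block_structure\<close> for the
  sets \<open>W - {a}\<close>, with an arbitrary weight \<open>h\<close> so that it applies to every
  residual.\<close>

locale critical_complete = critical_block +
  assumes all_nb: "u \<in> W \<Longrightarrow> w \<in> W \<Longrightarrow> u \<noteq> w \<Longrightarrow> nb u w"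
    and card_W: "4 \<le> card W"
    and two: "w \<in> W \<Longrightarrow> 2 \<le> card (supp g w)"
    and IH: "a \<in> W \<Longrightarrow> feas h (W - {a}) \<Longrightarrow> uncol h (W - {a}) \<Longrightarrow> w \<in> W - {a} \<Longrightarrow>
      2 \<le> card (supp h w) \<Longrightarrow> complete_type h (W - {a})"
begin

lemma other: "\<exists>w\<in>W. w \<noteq> u \<and> w \<noteq> a"
proof -
  have "card {u, a} < card W" using card_W by (cases "u = a") auto
  then have "\<not> W \<subseteq> {u, a}" using card_mono[of "{u, a}" W] by auto
  then show ?thesis by blast
qed

lemma supp_other: "w \<in> W \<Longrightarrow> \<exists>x\<in>supp g w. x \<noteq> y"
proof (rule ccontr)
  assume w: "w \<in> W" and "\<not> ?thesis"
  then have "supp g w \<subseteq> {y}" by blast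
  then have "card (supp g w) \<le> 1" using card_mono[of "{y}" "supp g w"] by simp
  then show False using two[OF w] by simp
qed

abbreviation R :: "'a \<Rightarrow> 'b \<Rightarrow> bool \<Rightarrow> 'b \<Rightarrow> nat" where
  "R a x \<equiv> res g {a} (\<lambda>_. x)"

lemma R_eq:
  assumes "a \<in> W" "x \<in> supp g a" "w \<in> W" "w \<noteq> a" "y \<in> X w"
  shows "g b y = R a x b y + (if E b y x then 1 else 0)"
  using delete_vertex(1)[OF assms] .

lemma R_block:
  assumes a: "a \<in> W" "x \<in> supp g a"
  shows "critical_block V A X E (W - {a}) (R a x)"
proof -
  obtain w where w: "w \<in> W" "w \<noteq> a" using other by blast
  note d = delete_vertex[OF a w]
  have "biconn (W - {a})" using all_nb w by (intro biconn_complete) auto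
  then show ?thesis
    using WV d(3,4) by unfold_locales auto
qed

definition bidir :: "'a set \<Rightarrow> bool" where
  "bidir B \<longleftrightarrow> (\<forall>u\<in>B. \<forall>w\<in>B. u \<noteq> w \<longrightarrow> (\<forall>b. A b u w))"

text \<open>With two support vertices in a fibre the induction hypothesis applies. With only one,
  that vertex carries the whole degree \<open>card W - 2\<close>, which is the same everywhere and
  in both directions.\<close>

lemma R_const:
  assumes a: "a \<in> W" "x \<in> supp g a" and bi: "bidir (W - {a})"
    and u: "u \<in> W - {a}" "w \<in> W - {a}" and y: "y \<in> supp (R a x) u" "z \<in> supp (R a x) w" and E: "E b y z"
  shows "R a x b' y = R a x b'' z"
proof -
  interpret B: critical_block V A X E "W - {a}" "R a x" using R_block[OF a] .
  show ?thesis
  proof (cases "2 \<le> card (supp (R a x) u)")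
    case True
    then have "complete_type (R a x) (W - {a})" using IH[OF a(1) B.fea B.unc u(1)] by blast
    then show ?thesis using complete_type_eq u y E by blast
  next
    case False
    have val: "R a x b t = card W - 2" if t: "t \<in> supp (R a x) d" and d: "d \<in> W - {a}" for t d b
    proof -
      have fin: "finite (X d)" using finite_X d WV by auto
      have "card (supp (R a x) d) \<le> 1" using False B.card_supp[OF d u(1)] by simp
      then have "supp (R a x) d = {t}"
        using t B.finite_supp[OF d] card_le_Suc0_iff_eq by fastforce
      then have "R a x b s = 0" if "s \<in> X d - {t}" for s using that by (auto simp: supp_def)
      then have "(\<Sum>s\<in>X d. R a x b s) = (\<Sum>s\<in>{t}. R a x b s)"
        using supp_range[OF t] fin by (intro sum.mono_neutral_right) auto
      moreover have "deg b (W - {a}) d = card W - 2"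
      proof -
        have "{e \<in> W - {a}. A b d e} = W - {a} - {d}"
          using bi d A_irrefl unfolding bidir_def by auto
        then show ?thesis unfolding deg_def using d a(1) finite_W by simp
      qed
      ultimately show ?thesis using B.sum_tight[OF d, of b] by simp
    qed
    show ?thesis using val[OF y(1) u(1)] val[OF y(2) u(2)] by simp
  qed
qed

text \<open>Both weights of \<open>y\<close> equal one and the same weight of a partner
  \<open>z\<close>.\<close>

lemma R_balanced:
  assumes a: "a \<in> W" "x \<in> supp g a" and bi: "bidir (W - {a})" and u: "u \<in> W - {a}" "y \<in> X u"
  shows "R a x b y = R a x b' y"
proof (cases "y \<in> supp (R a x) u")
  case True
  interpret B: critical_block V A X E "W - {a}" "R a x" using R_block[OF a] .
  obtain w where w: "w \<in> W - {a}" "w \<noteq> u" using other[of a u] by blast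
  then have "A True u w" using bi u unfolding bidir_def by auto
  then obtain z where "z \<in> supp (R a x) w" "E True y z"
    using B.match_supp'[OF u(1) w(1) _ True] by blast
  then show ?thesis using R_const[OF a bi u(1) w(1) True] by metis
next
  case False
  then show ?thesis using u by (auto simp: supp_def)
qed

text \<open>If all residual supports had at most one element, each deletion would use up the whole
  weight of some vertex over \<open>u\<close>. This gives \<open>u\<close> arcs in direction
  \<open>b\<close> to every other vertex, but leaves only two support vertices of weight 1 over
  \<open>u\<close>: a total of 2 against a degree of at least 3.\<close>

lemma exists_large_residual:
  "\<exists>a\<in>W. \<exists>x\<in>supp g a. \<exists>w\<in>W - {a}. 2 \<le> card (supp (R a x) w)"
proof (rule ccontr)
  assume "\<not> ?thesis"
  then have small: "card (supp (R a x) w) \<le> 1" if "a \<in> W" "x \<in> supp g a" "w \<in> W" "w \<noteq> a" for a x w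
    using that by (metis DiffI One_nat_def Suc_1 not_less_eq_eq singletonD)
  obtain a where a: "a \<in> W" using W_conn conn_nonempty by blast
  obtain u where u: "u \<in> W" "u \<noteq> a" using other by blast
  have finu: "finite (X u)" using finite_X u WV by auto
  have unique: "y = y'" if "c \<in> W" "x \<in> supp g c" "c \<noteq> u" "y \<in> supp (R c x) u" "y' \<in> supp (R c x) u" for c x y y'
  proof -
    have "finite (supp (R c x) u)" using finu by (simp add: supp_def)
    then show ?thesis using small[OF that(1,2) u(1)] that card_le_Suc0_iff_eq by fastforce
  qed
  have killed: "\<exists>y\<in>supp g u. \<forall>b. g b y = (if E b y x then 1 else 0)"
    if c: "c \<in> W" "x \<in> supp g c" "c \<noteq> u" for c x
  proof -
    \<comment> \<open>There are at least two support vertices and at most one survives, so some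
      residual vanishes in both directions.\<close>
    have "\<not> supp g u \<subseteq> supp (R c x) u"
    proof
      assume "supp g u \<subseteq> supp (R c x) u"
      then have "card (supp g u) \<le> card (supp (R c x) u)"
        using finu by (intro card_mono) (auto simp: supp_def)
      then show False using two[OF u(1)] small[OF c(1,2) u(1)] c by simp
    qed
    then obtain y where y: "y \<in> supp g u" "y \<notin> supp (R c x) u" by blast
    have "R c x b y = 0" for b using supp_X[OF y(1)] y(2) by (auto simp: supp_def)
    then show ?thesis using y R_eq[OF c(1,2) u(1) _ supp_X[OF y(1)]] c by (intro bexI[of _ y]) auto
  qed
  obtain b where b: "A b u a" using all_nb[OF u(1) a] u by (auto simp: nb_def)
  have pos: "1 \<le> g b y" if "y \<in> supp g u" for y using supp_pos[OF a u(1) b that] .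
  have arcs: "A b u c" if c: "c \<in> W" "c \<noteq> u" for c
  proof -
    obtain x where x: "x \<in> supp g c" using supp_other[OF c(1)] by blast
    then obtain y where y: "y \<in> supp g u" "\<forall>b. g b y = (if E b y x then 1 else 0)"
      using killed c by blast
    then have "E b y x" using pos[OF y(1)] by (metis not_one_le_zero)
    then show ?thesis using E_A[of u c y x b] u c x y WV supp_X by blast
  qed
  have "{c \<in> W. A b u c} = W - {u}" using arcs A_irrefl by auto
  then have degu: "deg b W u = card W - 1" unfolding deg_def using u finite_W by simp
  obtain x1 where x1: "x1 \<in> supp g a" using supp_other[OF a] by blast
  obtain x2 where x2: "x2 \<in> supp g a" "x2 \<noteq> x1" using supp_other[OF a] by blast
  obtain y1 where y1: "y1 \<in> supp g u" "\<forall>b. g b y1 = (if E b y1 x1 then 1 else 0)" using killed a x1 u by blast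
  obtain y2 where y2: "y2 \<in> supp g u" "\<forall>b. g b y2 = (if E b y2 x2 then 1 else 0)" using killed a x2 u by blast
  have E1: "E b y1 x1" "g b y1 = 1" using pos[OF y1(1)] y1(2) by (metis not_one_le_zero)+
  have E2: "E b y2 x2" "g b y2 = 1" using pos[OF y2(1)] y2(2) by (metis not_one_le_zero)+
  have V: "u \<in> V" "a \<in> V" using u a WV by auto
  \<comment> \<open>Different colours of \<open>a\<close> use up different vertices over
    \<open>u\<close>, because \<open>y1\<close> has only one partner over \<open>a\<close>.\<close>
  have ne: "y1 \<noteq> y2"
    using E_fun[OF V supp_X[OF y1(1)] supp_X[OF x1] supp_X[OF x2(1)], of b] E1 E2 x2(2) by auto
  have surv: "y \<in> supp (R a x1) u" if y: "y \<in> supp g u" "y \<noteq> y1" for y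
  proof -
    have "\<not> E b y x1" using E_inj[OF V supp_X[OF y(1)] supp_X[OF y1(1)] supp_X[OF x1]] E1 y by blast
    then have "R a x1 b y = g b y" using R_eq[OF a x1 u supp_X[OF y(1)], of b] by simp
    then have "0 < R a x1 b y" using pos[OF y(1)] by simp
    then show ?thesis using supp_X[OF y(1)] by (auto simp: supp_def)
  qed
  have "supp g u = {y1, y2}"
    using surv unique[OF a x1] u y1(1) y2(1) ne by blast
  then have zero: "g b y = 0" if "y \<in> X u - {y1, y2}" for y using that by (auto simp: supp_def)
  have "(\<Sum>y\<in>X u. g b y) = (\<Sum>y\<in>{y1, y2}. g b y)"
    using zero finu y1(1) y2(1) supp_X by (intro sum.mono_neutral_right) auto
  also have "\<dots> = 2" using ne E1 E2 by simp
  finally have "card W - 1 = 2" using sum_tight[OF u(1), of b] degu by simp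
  then show False using card_W by simp
qed

text \<open>A large residual makes \<open>W - {a}\<close> bidirected by induction, so all residuals
  there are balanced. If \<open>u\<close> had an arc to \<open>a\<close> in direction
  \<open>d\<close> only, colouring \<open>a\<close> with the partner \<open>x\<close> of
  \<open>y\<close> would lower just the weight of \<open>y\<close> in direction \<open>d\<close>,
  while another colour \<open>x'\<close> would lower neither weight. Both results cannot be
  balanced.\<close>

lemma bidir_W: "bidir W"
proof -
  obtain a x w where a: "a \<in> W" "x \<in> supp g a" and w: "w \<in> W - {a}" "2 \<le> card (supp (R a x) w)"
    using exists_large_residual by blast
  interpret B: critical_block V A X E "W - {a}" "R a x" using R_block[OF a] .
  have "complete_type (R a x) (W - {a})" using IH[OF a(1) B.fea B.unc w] .
  then have bi: "bidir (W - {a})" unfolding bidir_def using complete_type_arc by blast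
  have arc: "A b u a" if u: "u \<in> W" "u \<noteq> a" for u b
  proof (rule ccontr)
    assume nA: "\<not> A b u a"
    obtain d where d: "A d u a" using all_nb[OF u(1) a(1) u(2)] by (auto simp: nb_def)
    then have db: "d = (\<not> b)" using nA by (cases "d = b") auto
    obtain y where y: "y \<in> supp g u" "E d y x" using match_supp[OF a(1) u(1) d a(2)] .
    obtain x' where x': "x' \<in> supp g a" "x' \<noteq> x" using supp_other[OF a(1)] by blast
    have V: "u \<in> V" "a \<in> V" using u a WV by auto
    have nE: "\<not> E b y t" if "t \<in> supp g a" for t
      using E_A[OF V supp_X[OF y(1)] supp_X[OF that]] nA by blast
    have nE': "\<not> E d y x'"
      using E_fun[OF V supp_X[OF y(1)] supp_X[OF a(2)] supp_X[OF x'(1)] y(2)] x'(2) by blast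
    have uW: "u \<in> W - {a}" using u by simp
    note e = R_eq[OF a u supp_X[OF y(1)]] and e' = R_eq[OF a(1) x'(1) u supp_X[OF y(1)]]
    have "g d y = R a x d y + 1" "g b y = R a x b y"
      using e[of d] e[of b] y(2) nE[OF a(2)] by simp_all
    moreover have "g d y = R a x' d y" "g b y = R a x' b y"
      using e'[of d] e'[of b] nE[OF x'(1)] nE' by simp_all
    ultimately show False
      using R_balanced[OF a bi uW supp_X[OF y(1)], of d b]
        R_balanced[OF a(1) x'(1) bi uW supp_X[OF y(1)], of d b] by simp
  qed
  then have "A b a u" if "u \<in> W" "u \<noteq> a" for u b
    using that A_flip[of "\<not> b" a u] by auto
  then show ?thesis using bi arc unfolding bidir_def by (metis DiffI singletonD)
qed

lemma bidir_delete: "bidir (W - {a})"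
  using bidir_W unfolding bidir_def by blast

text \<open>The same comparison of two colours \<open>x\<close> and \<open>x'\<close> of
  \<open>a\<close>, now applied to a digon whose two matchings differ at \<open>y\<close>.\<close>

lemma E_symmetric:
  assumes a: "a \<in> W" "x \<in> supp g a" and u: "u \<in> W" "u \<noteq> a" "y \<in> X u" and E: "E b y x"
  shows "E b' y x"
proof (rule ccontr)
  assume nE: "\<not> E b' y x"
  obtain x' where x': "x' \<in> supp g a" "x' \<noteq> x" using supp_other[OF a(1)] by blast
  have V: "u \<in> V" "a \<in> V" using u a WV by auto
  have nE': "\<not> E b y x'"
    using E_fun[OF V u(3) supp_X[OF a(2)] supp_X[OF x'(1)] E] x'(2) by blast
  have uW: "u \<in> W - {a}" using u by simp
  have "g b y = R a x b y + 1" "g b' y = R a x b' y"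
    using R_eq[OF a u, of b] R_eq[OF a u, of b'] E nE by simp_all
  moreover have "g b y = R a x' b y" "R a x' b' y \<le> g b' y"
    using R_eq[OF a(1) x'(1) u, of b] nE' by (simp_all add: res_def)
  ultimately show False
    using R_balanced[OF a bidir_delete uW u(3), of b b']
      R_balanced[OF a(1) x'(1) bidir_delete uW u(3), of b b'] by simp
qed

lemma g_balanced:
  assumes u: "u \<in> W" "y \<in> X u"
  shows "g b y = g b' y"
proof -
  obtain a where a: "a \<in> W" "a \<noteq> u" using other by blast
  obtain x where x: "x \<in> supp g a" using supp_other[OF a(1)] by blast
  have "E b y x \<longleftrightarrow> E b' y x" using E_symmetric[OF a(1) x u(1) _ u(2)] a by blast
  then show ?thesis
    using R_eq[OF a(1) x u(1) _ u(2), of b] R_eq[OF a(1) x u(1) _ u(2), of b'] a u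
      R_balanced[OF a(1) x bidir_delete _ u(2), of b b'] by auto
qed

lemma E_supp_symmetric:
  assumes a: "a \<in> W" "x \<in> supp g a" and u: "u \<in> W" "y \<in> supp g u" and E: "E b x y"
  shows "E b' x y" "E b' y x" "u \<noteq> a"
proof -
  show ua: "u \<noteq> a" using E_irrefl[of a x y b] a u E supp_X WV by blast
  have "E (\<not> b) y x" using E by (simp add: E_flip)
  then have *: "E d y x" for d using E_symmetric[OF a u(1) ua supp_X[OF u(2)]] by blast
  then show "E b' y x" .
  show "E b' x y" using *[of "\<not> b'"] E_flip by blast
qed

text \<open>Suppose that the partner \<open>y'\<close> of \<open>y\<close> over \<open>w\<close> is
  not \<open>z\<close>. A colour of \<open>a\<close> other than \<open>x\<close> leaves
  \<open>y\<close> intact, and constancy of the residual gives \<open>g b y \<le> g b y'\<close>.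
  The colour \<open>x\<close> lowers \<open>y\<close> but not \<open>y'\<close>, and constancy gives
  \<open>g b y = g b y' + 1\<close>.\<close>

lemma E_transitive:
  assumes a: "a \<in> W" "x \<in> supp g a" and u: "u \<in> W" "y \<in> supp g u" and w: "w \<in> W" "z \<in> supp g w"
    and uw: "u \<noteq> w" and E: "E b x y" "E b x z"
  shows "E b y z"
proof -
  note s = E_supp_symmetric[OF a u E(1)] E_supp_symmetric[OF a w E(2)]
  have V: "a \<in> V" "u \<in> V" "w \<in> V" using a u w WV by auto
  have uwA: "A b u w" "A b w u" using bidir_W u w uw unfolding bidir_def by auto
  have mem: "u \<in> W - {a}" "w \<in> W - {a}" using u w s by auto
  obtain y' where y': "y' \<in> supp g w" "E b y y'" using match_supp'[OF u(1) w(1) uwA(1) u(2)] .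
  have "y' = z"
  proof (rule ccontr)
    assume ne: "y' \<noteq> z"
    have pos: "1 \<le> g b y" using supp_pos[OF w(1) u(1) uwA(1) u(2)] .
    obtain x' where x': "x' \<in> supp g a" "x' \<noteq> x" using supp_other[OF a(1)] by blast
    have nE: "\<not> E b y x'"
      using E_fun[OF V(2,1) supp_X[OF u(2)] supp_X[OF a(2)] supp_X[OF x'(1)] s(2)] x'(2) by blast
    have ge: "g b y \<le> g b y'"
    proof -
      interpret B: critical_block V A X E "W - {a}" "R a x'" using R_block[OF a(1) x'(1)] .
      have Ry: "R a x' b y = g b y"
        using R_eq[OF a(1) x'(1) u(1) s(3) supp_X[OF u(2)], of b] nE by simp
      then have "0 < R a x' b y" using pos by simp
      then have ys: "y \<in> supp (R a x') u" using supp_X[OF u(2)] by (auto simp: supp_def)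
      obtain t where t: "t \<in> supp (R a x') w" "E b y t"
        using B.match_supp'[OF mem uwA(1) ys] .
      have "t = y'"
        using E_fun[OF V(2,3) supp_X[OF u(2)] supp_range[OF t(1)] supp_X[OF y'(1)] t(2) y'(2)] .
      then have "R a x' b y' = g b y"
        using R_const[OF a(1) x'(1) bidir_delete mem ys t, of b b] Ry by simp
      then show ?thesis by (simp add: res_def)
    qed
    interpret B: critical_block V A X E "W - {a}" "R a x" using R_block[OF a] .
    \<comment> \<open>The partner of \<open>x\<close> over \<open>w\<close> is \<open>z\<close>,
      hence not \<open>y'\<close>.\<close>
    have "\<not> E b y' x"
    proof
      assume "E b y' x"
      then have "E (\<not> b) x y'" by (simp add: E_flip)
      then have "E b x y'" using E_supp_symmetric(1)[OF a w(1) y'(1)] by blast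
      then show False
        using E_fun[OF V(1,3) supp_X[OF a(2)] supp_X[OF y'(1)] supp_X[OF w(2)] _ E(2)] ne by blast
    qed
    then have Ry': "R a x b y' = g b y'"
      using R_eq[OF a w(1) _ supp_X[OF y'(1)], of b] mem by simp
    then have "0 < R a x b y'" using ge pos by simp
    then have ys': "y' \<in> supp (R a x) w" using supp_X[OF y'(1)] by (auto simp: supp_def)
    obtain t where t: "t \<in> supp (R a x) u" "E b t y'"
      using B.match_supp[OF mem(2,1) uwA(1) ys'] .
    have ty: "t = y"
      using E_inj[OF V(2,3) supp_range[OF t(1)] supp_X[OF u(2)] supp_X[OF y'(1)] t(2) y'(2)] .
    have "R a x b t = R a x b y'" using R_const[OF a bidir_delete mem t(1) ys' t(2)] .
    moreover have "g b y = R a x b y + 1"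
      using R_eq[OF a u(1) s(3) supp_X[OF u(2)], of b] s(2) by simp
    ultimately show False using ty Ry' ge by simp
  qed
  then show ?thesis using y' by simp
qed

text \<open>A third vertex \<open>w\<close> receives a colour \<open>z'\<close> that is joined to
  neither \<open>x\<close> nor \<open>y\<close>. Their residuals then equal their weights, and
  residuals are constant along matched pairs.\<close>

lemma g_const:
  assumes a: "a \<in> W" "x \<in> supp g a" and u: "u \<in> W" "y \<in> supp g u" and E: "E b x y"
  shows "g b' x = g b'' y"
proof -
  note s = E_supp_symmetric[OF a u E]
  obtain w where w: "w \<in> W" "w \<noteq> a" "w \<noteq> u" using other by blast
  have V: "a \<in> V" "u \<in> V" "w \<in> V" using a u w WV by auto
  have arcs: "A b a w" "A b a u" "A b u a" using bidir_W a u w s(3) unfolding bidir_def by auto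
  obtain z where z: "z \<in> supp g w" "E b x z" using match_supp'[OF a(1) w(1) arcs(1) a(2)] .
  obtain z' where z': "z' \<in> supp g w" "z' \<noteq> z" using supp_other[OF w(1)] by blast
  have yz: "E b y z" using E_transitive[OF a u w(1) z(1) _ E z(2)] w by blast
  have n: "\<not> E b x z'" "\<not> E b y z'"
    using E_fun[OF V(1,3) supp_X[OF a(2)] supp_X[OF z(1)] supp_X[OF z'(1)] z(2)]
      E_fun[OF V(2,3) supp_X[OF u(2)] supp_X[OF z(1)] supp_X[OF z'(1)] yz] z'(2) by blast+
  have R: "R w z' b x = g b x" "R w z' b y = g b y"
    using R_eq[OF w(1) z'(1) a(1) _ supp_X[OF a(2)], of b] R_eq[OF w(1) z'(1) u(1) _ supp_X[OF u(2)], of b] n w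
    by auto
  have "0 < R w z' b x" "0 < R w z' b y"
    using R supp_pos[OF u(1) a(1) arcs(2) a(2)] supp_pos[OF a(1) u(1) arcs(3) u(2)] by auto
  then have "x \<in> supp (R w z') a" "y \<in> supp (R w z') u"
    using supp_X a u by (auto simp: supp_def)
  then have "R w z' b x = R w z' b y"
    using R_const[OF w(1) z'(1) bidir_delete _ _ _ _ E] a u w by blast
  then show ?thesis
    using R g_balanced[OF a(1) supp_X[OF a(2)], of b' b] g_balanced[OF u(1) supp_X[OF u(2)], of b'' b] by simp
qed

lemma complete_complete_type: "complete_type g W"
  unfolding complete_type_def
proof (intro conjI ballI allI impI)
  show "A b u v" if "u \<in> W" "v \<in> W" "u \<noteq> v" for b u v using bidir_W that unfolding bidir_def by blast
  show "E b' x y" if "u \<in> W" "v \<in> W" "x \<in> supp g u" "y \<in> supp g v" "E b x y" for u v x y b b'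
    using E_supp_symmetric(1)[OF that(1,3,2,4,5)] .
  show "g b' x = g b'' y" if "u \<in> W" "v \<in> W" "x \<in> supp g u" "y \<in> supp g v" "E b x y" for u v x y b b' b''
    using g_const[OF that(1,3,2,4,5)] .
  show "E b y z" if "u \<in> W" "v \<in> W" "w \<in> W" "x \<in> supp g u" "y \<in> supp g v" "z \<in> supp g w"
    "v \<noteq> w" "E b x y" "E b x z" for u v w x y z b
    using E_transitive[OF that(1,4,2,5,3,6,7,8,9)] .
qed

end

section \<open>Blocks and cut vertices\<close>

context ugraph
begin

text \<open>An edge that leaves a subset of \<open>P\<close> stays in \<open>insert c P\<close>,
  because \<open>P\<close> has no edges to the rest of \<open>W - {c}\<close>.\<close>

lemma conn_cut_part:
  assumes W: "conn W" "c \<in> W" and P: "P \<subseteq> W - {c}"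
    and closed: "\<And>u v. u \<in> P \<Longrightarrow> v \<in> W - {c} - P \<Longrightarrow> \<not> adj u v"
  shows "conn (insert c P)"
  unfolding conn_def
proof (intro conjI allI impI)
  fix R assume R: "R \<subseteq> insert c P" "R \<noteq> {}" "R \<noteq> insert c P"
  have half: "\<exists>u\<in>R. \<exists>v\<in>insert c P - R. adj u v" if R: "R \<subseteq> P" "R \<noteq> {}" for R
  proof -
    have "R \<noteq> W" "R \<subseteq> W" using R P W by auto
    then obtain u v where uv: "u \<in> R" "v \<in> W - R" "adj u v" using conn_cut[OF W(1)] R by metis
    then have "v \<in> insert c P" using closed[of u v] R by blast
    then show ?thesis using uv by blast
  qed
  show "\<exists>u\<in>R. \<exists>v\<in>insert c P - R. adj u v"
  proof (cases "c \<in> R")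
    case True
    then have "insert c P - R \<subseteq> P" "insert c P - R \<noteq> {}" using R by auto
    then obtain u v where "u \<in> insert c P - R" "v \<in> insert c P - (insert c P - R)" "adj u v"
      using half by blast
    then show ?thesis using adj_sym by blast
  next
    case False
    then show ?thesis using half[of R] R by blast
  qed
qed simp

end

context cover_system
begin

lemma cnt_zero: "(\<And>u. u \<in> U \<Longrightarrow> \<not> E b x (\<phi> u)) \<Longrightarrow> cnt b U \<phi> x = 0"
  unfolding cnt_def by (metis (mono_tags, lifting) card.empty empty_Collect_eq)

end

section \<open>Small blocks and the exclusion of rigid sub-blocks\<close>

context critical_block
begin

text \<open>On at most two vertices every degree is at most 1, whereas two support vertices carry a
  weight of at least 2 in some direction.\<close>

lemma card_ge_3:
  assumes w: "w \<in> W" "2 \<le> card (supp g w)"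
  shows "3 \<le> card W"
proof (rule ccontr)
  assume small: "\<not> 3 \<le> card W"
  have "W \<noteq> {w}"
  proof
    assume "W = {w}"
    then have "g b x = 0" if "x \<in> X w" for b x using supp_zero[of w b x] that A_irrefl by auto
    then have "supp g w = {}" by (auto simp: supp_def)
    then show False using w by simp
  qed
  then obtain u where u: "u \<in> W" "nb w u" using conn_neighbour[OF W_conn w(1)] by blast
  then obtain b where b: "A b w u" by (auto simp: nb_def)
  have "u \<noteq> w" using b A_irrefl by blast
  then have "card {w, u} = 2" by simp
  then have "{w, u} = W" using small u w finite_W by (intro card_subset_eq) (auto dest: card_mono[of W "{w, u}"])
  then have "{u' \<in> W. A b w u'} \<subseteq> {u}" using A_irrefl by auto
  then have "deg b W w \<le> 1" unfolding deg_def using card_mono[of "{u}"] by fastforce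
  moreover have "(\<Sum>x\<in>supp g w. 1) \<le> (\<Sum>x\<in>supp g w. g b x)"
    using supp_pos[OF u(1) w(1) b] by (intro sum_mono) auto
  moreover have "(\<Sum>x\<in>supp g w. g b x) \<le> (\<Sum>x\<in>X w. g b x)"
    using finite_X w(1) WV by (intro sum_mono2) (auto simp: supp_def)
  ultimately show False using w(2) sum_tight[OF w(1), of b] by simp
qed

text \<open>The two residuals on the block \<open>B\<close> obtained by giving \<open>u\<close> different colours agree with \<open>g\<close>
  at \<open>b0\<close>, hence have equally large supports, and a residual on \<open>B\<close> is determined by its values
  at \<open>b0\<close>. But they differ at \<open>c\<close>.\<close>

lemma no_rigid_subblock:
  assumes B: "B \<subset> W" "biconn B" and b0: "b0 \<in> B" "\<forall>u'\<in>W - B. \<not> nb b0 u'"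
    and c: "c \<in> B" "u \<in> W - B" "nb c u" "\<forall>u'\<in>W - B. nb c u' \<longrightarrow> u' = u"
    and two: "2 \<le> card (supp g b0)"
    and IH: "\<And>h w. feas h B \<Longrightarrow> uncol h B \<Longrightarrow> w \<in> B \<Longrightarrow> 2 \<le> card (supp h w) \<Longrightarrow>
      complete_type h B \<or> (\<exists>n v. cycle_enum n v B)"
  shows False
proof -
  let ?U = "W - B"
  have V: "?U \<subseteq> V" "B \<subseteq> V" "?U \<inter> B = {}" "c \<in> V" "u \<in> V" "b0 \<in> V" using B(1) WV c(1,2) b0(1) by auto
  have W: "?U \<union> B = W" using B by blast
  have uW: "u \<in> W" "u \<noteq> c" "c \<in> W" "b0 \<in> W" using c(1,2) B(1) b0(1) by auto
  have cb0: "c \<noteq> b0" using b0(2) c(2,3) by blast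
  have "\<not> card (supp g u) \<le> 1" using two card_supp[OF uW(1,4)] by simp
  then obtain x1 x2 where x: "x1 \<in> supp g u" "x2 \<in> supp g u" "x1 \<noteq> x2"
    using card_le_Suc0_iff_eq[OF finite_supp[OF uW(1)]] by auto
  \<comment> \<open>The vertex \<open>u\<close> is coloured in advance; the rest of
    \<open>?U\<close> is a proper part of the connected set \<open>W - {u}\<close> and can be
    coloured for the residual.\<close>
  have exc: "\<exists>\<phi>. col g ?U \<phi> \<and> \<phi> u = z" if z: "z \<in> supp g u" for z
  proof -
    note d = delete_vertex[OF uW(1) z uW(3) uW(2)[symmetric]]
    have "?U - {u} \<subset> W - {u}" using uW c by blast
    then obtain \<psi> where \<psi>: "col (res g {u} (\<lambda>_. z)) (?U - {u}) \<psi>"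
      using proper_colorable[OF _ d(5,3)] WV by blast
    have "col g ({u} \<union> (?U - {u})) (\<lambda>v. if v \<in> {u} then z else \<psi> v)"
      using col_compose[OF _ _ _ col_singleton[OF V(5) z] \<psi>] V by auto
    moreover have "{u} \<union> (?U - {u}) = ?U" using c by blast
    ultimately have "col g ?U (\<lambda>v. if v \<in> {u} then z else \<psi> v)" by simp
    then show ?thesis by (intro exI[of _ "\<lambda>v. if v \<in> {u} then z else \<psi> v"]) simp
  qed
  have blk: "critical_block V A X E B (res g ?U \<phi>)" if \<phi>: "col g ?U \<phi>" for \<phi>
  proof
    show "B \<subseteq> V" "biconn B" using V B by auto
    show "feas (res g ?U \<phi>) B" using res_feas[of ?U B \<phi> g, OF V(1-3) col_range[OF \<phi>]] W fea by simp
    show "uncol (res g ?U \<phi>) B" using res_uncol[OF V(1-3) \<phi>] W unc by simp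
  qed
  have eq: "g b y = res g ?U \<phi> b y + cnt b ?U \<phi> y" if \<phi>: "col g ?U \<phi>" and y: "y \<in> X w" "w \<in> B" for \<phi> b y w
    using res_tight(1)[OF V(1-3) \<phi> _ _ biconn_conn[OF B(2)] y(2,1)] W fea unc by simp
  have at_b0: "res g ?U \<phi> b y = g b y" if \<phi>: "col g ?U \<phi>" and y: "y \<in> X b0" for \<phi> b y
  proof -
    have "\<not> E b y (\<phi> u')" if u': "u' \<in> ?U" for u'
      using E_A[OF V(6) _ y col_range[OF \<phi> u'], of b] u' V b0(2) unfolding nb_def by blast
    then have "cnt b ?U \<phi> y = 0" by (rule cnt_zero)
    then show ?thesis using eq[OF \<phi> y b0(1), of b] by simp
  qed
  \<comment> \<open>All supports are as large as the one at \<open>b0\<close>, where the residual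
    coincides with \<open>g\<close>, and a residual support is contained in the support of
    \<open>g\<close>.\<close>
  have supp_eq: "supp (res g ?U \<phi>) w = supp g w" if \<phi>: "col g ?U \<phi>" and w: "w \<in> B" for \<phi> w
  proof -
    interpret B: critical_block V A X E B "res g ?U \<phi>" using blk[OF \<phi>] .
    have wW: "w \<in> W" using w B by blast
    have "supp (res g ?U \<phi>) b0 = supp g b0" using at_b0[OF \<phi>] by (auto simp: supp_def)
    then have "card (supp (res g ?U \<phi>) w) = card (supp g w)"
      using B.card_supp[OF w b0(1)] card_supp[OF wW uW(4)] by simp
    moreover have "supp (res g ?U \<phi>) w \<subseteq> supp g w"
      by (auto simp: supp_def res_def) (metis diff_is_0_eq less_nat_zero_code neq0_conv zero_less_diff zero_le)
    ultimately show ?thesis using finite_supp[OF wW] by (intro card_subset_eq)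
  qed
  have large: "2 \<le> card (supp (res g ?U \<phi>) w)" if \<phi>: "col g ?U \<phi>" and w: "w \<in> B" for \<phi> w
    using supp_eq[OF \<phi> w] card_supp[of w b0] w B uW two by auto
  obtain b where b: "A b c u" using c(3) by (auto simp: nb_def)
  \<comment> \<open>If \<open>B\<close> is a cycle, the value at \<open>y\<close> is 0 or 1
    according to the arcs of \<open>B\<close>. In the complete case it equals the weight of the
    partner of \<open>y\<close> over \<open>b0\<close>, which no colouring of \<open>?U\<close> can
    change.\<close>
  have rigid: "res g ?U \<phi>1 b y = res g ?U \<phi>2 b y"
    if \<phi>: "col g ?U \<phi>1" "col g ?U \<phi>2" and y: "y \<in> supp g c" for \<phi>1 \<phi>2 y
  proof (cases "\<exists>n v. cycle_enum n v B")
    case True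
    then obtain n v where cyc: "cycle_enum n v B" by blast
    have "res g ?U \<phi> b y = (if \<exists>u\<in>B. A b c u then 1 else 0)" if \<phi>: "col g ?U \<phi>" for \<phi>
    proof -
      interpret B: critical_block V A X E B "res g ?U \<phi>" using blk[OF \<phi>] .
      interpret B: critical_cycle V A X E B "res g ?U \<phi>" n v
        using cyc large[OF \<phi>] by unfold_locales
      show ?thesis using B.g_value[OF c(1)] supp_eq[OF \<phi> c(1)] y by simp
    qed
    then show ?thesis using \<phi> by simp
  next
    case False
    have val: "\<exists>y0\<in>X b0. E b y y0 \<and> res g ?U \<phi> b y = g b y0" if \<phi>: "col g ?U \<phi>" for \<phi>
    proof -
      interpret B: critical_block V A X E B "res g ?U \<phi>" using blk[OF \<phi>] .
      have ct: "complete_type (res g ?U \<phi>) B"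
        using IH[OF B.fea B.unc b0(1) large[OF \<phi> b0(1)]] False by blast
      have y': "y \<in> supp (res g ?U \<phi>) c" using supp_eq[OF \<phi> c(1)] y by simp
      obtain y0 where y0: "y0 \<in> supp (res g ?U \<phi>) b0" "E b y y0"
        using B.match_supp'[OF c(1) b0(1) complete_type_arc[OF ct c(1) b0(1) cb0] y'] .
      then have "res g ?U \<phi> b y = res g ?U \<phi> b y0"
        using complete_type_eq[OF ct c(1) b0(1) y'] by blast
      then show ?thesis using at_b0[OF \<phi>] supp_range[OF y0(1)] y0(2) by metis
    qed
    obtain y1 where y1: "y1 \<in> X b0" "E b y y1" "res g ?U \<phi>1 b y = g b y1" using val[OF \<phi>(1)] by blast
    obtain y2 where y2: "y2 \<in> X b0" "E b y y2" "res g ?U \<phi>2 b y = g b y2" using val[OF \<phi>(2)] by blast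
    have "y1 = y2" using E_fun[OF V(4,6) supp_X[OF y] y1(1) y2(1) y1(2) y2(2)] .
    then show ?thesis using y1 y2 by simp
  qed
  obtain \<phi>1 where \<phi>1: "col g ?U \<phi>1" "\<phi>1 u = x1" using exc[OF x(1)] by blast
  obtain \<phi>2 where \<phi>2: "col g ?U \<phi>2" "\<phi>2 u = x2" using exc[OF x(2)] by blast
  \<comment> \<open>As \<open>u\<close> is the only neighbour of \<open>c\<close> in
    \<open>?U\<close>, the vertex \<open>y\<close> loses weight when \<open>u\<close> has colour
    \<open>x1\<close> and none when it has colour \<open>x2\<close>.\<close>
  obtain y where y: "y \<in> supp g c" "E b y x1" using match_supp[OF uW(1,3) b x(1)] .
  have "u \<in> {u' \<in> ?U. E b y (\<phi>1 u')}" using y(2) \<phi>1(2) c(2) by simp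
  then have "0 < cnt b ?U \<phi>1 y" unfolding cnt_def using finite_W by (auto simp: card_gt_0_iff)
  moreover have "cnt b ?U \<phi>2 y = 0"
  proof -
    have "\<not> E b y (\<phi>2 u')" if u': "u' \<in> ?U" for u'
    proof
      assume e: "E b y (\<phi>2 u')"
      then have "nb c u'"
        using E_A[OF V(4) _ supp_X[OF y(1)] col_range[OF \<phi>2(1) u'] e] u' V(1) unfolding nb_def by blast
      then have "u' = u" using c(4) u' by blast
      then show False
        using E_fun[OF V(4,5) supp_X[OF y(1)] supp_X[OF x(1)] supp_X[OF x(2)] y(2)] e \<phi>2(2) x(3) by simp
    qed
    then show ?thesis by (rule cnt_zero)
  qed
  ultimately show False
    using eq[OF \<phi>1(1) supp_X[OF y(1)] c(1), of b] eq[OF \<phi>2(1) supp_X[OF y(1)] c(1), of b]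
      rigid[OF \<phi>1(1) \<phi>2(1) y(1)] by simp
qed

end

section \<open>The two types of blocks with large supports, and the splitting at a cut
  vertex\<close>

context cover_system
begin

text \<open>Induction on the size of \<open>W\<close>. A triangle is counted as complete, hence the
  bound 4. A block that is neither a cycle nor complete has the sub-block of
  \<open>biconn_split\<close>, which \<open>no_rigid_subblock\<close> refutes.\<close>

theorem block_structure:
  assumes "W \<subseteq> V" "biconn W" "feas g W" "uncol g W" "w \<in> W" "2 \<le> card (supp g w)"
  shows "complete_type g W \<or> (\<exists>n v. 4 \<le> n \<and> cycle_enum n v W)"
  using assms
proof (induction "card W" arbitrary: W g w rule: less_induct)
  case less
  interpret critical_block V A X E W g using less.prems by unfold_locales auto
  have two: "2 \<le> card (supp g u)" if "u \<in> W" for u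
    using card_supp[OF that less.prems(5)] less.prems(6) by simp
  have c3: "3 \<le> card W" using card_ge_3 less.prems(5,6) .
  have sub: "card B < card W" if "B \<subset> W" for B using that finite_W by (rule psubset_card_mono[rotated])
  show ?case
  proof (cases "\<exists>n v. cycle_enum n v W")
    case True
    then obtain n v where cyc: "cycle_enum n v W" by blast
    interpret critical_cycle V A X E W g n v using cyc two by unfold_locales auto
    show ?thesis
    proof (cases "n = 3")
      case True
      then show ?thesis using triangle_complete_type by blast
    next
      case False
      then have "4 \<le> n" using n3 by simp
      then show ?thesis using cyc by blast
    qed
  next
    case False
    have c4: "4 \<le> card W"
    proof (rule ccontr)
      assume "\<not> 4 \<le> card W"
      then have "card W = 3" using c3 by simp
      \<comment> \<open>A chordless cycle has at least three vertices, so it would exhaust a block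
        of size 3 and make it a cycle.\<close>
      obtain n v C where C: "C \<subseteq> W" "cycle_enum n v C" using exists_chordless_cycle[OF bic c3] by blast
      then have "card C = n" "3 \<le> n" by (auto simp: cycle_enum_def dest: bij_betw_same_card)
      then have "C = W" using C \<open>card W = 3\<close> finite_W by (intro card_seteq) auto
      then show False using C False by blast
    qed
    show ?thesis
    proof (cases "\<forall>u\<in>W. \<forall>w\<in>W. u \<noteq> w \<longrightarrow> nb u w")
      case True
      interpret critical_complete V A X E W g
      proof
        show "nb u w" if "u \<in> W" "w \<in> W" "u \<noteq> w" for u w using True that by blast
        show "4 \<le> card W" by (fact c4)
        show "2 \<le> card (supp g w)" if "w \<in> W" for w using two that .
        show "complete_type h (W - {a})"
          if a: "a \<in> W" and h: "feas h (W - {a})" "uncol h (W - {a})" "w \<in> W - {a}" "2 \<le> card (supp h w)" for a h w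
        proof -
          have "biconn (W - {a})" using True h(3) by (intro biconn_complete) auto
          then have "complete_type h (W - {a}) \<or> (\<exists>n v. 4 \<le> n \<and> cycle_enum n v (W - {a}))"
            using less.hyps[of "W - {a}" h w] sub[of "W - {a}"] a h WV by blast
          \<comment> \<open>A complete graph is no induced cycle of length four or more:
            \<open>v 0\<close> and \<open>v 2\<close> would be adjacent without being
            consecutive.\<close>
          moreover have "\<not> (4 \<le> n \<and> cycle_enum n v (W - {a}))" for n v
          proof
            assume cyc: "4 \<le> n \<and> cycle_enum n v (W - {a})"
            have "v 0 \<in> W" "v 2 \<in> W" "v 0 \<noteq> v 2"
              using cycle_enum_range[of n v "W - {a}"] cycle_enum_eq_iff[of n v "W - {a}" 0 2] cyc by auto
            then have "nb (v 0) (v 2)" using True by blast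
            moreover have "nb (v 0) (v 2) \<longleftrightarrow> 2 = Suc 0 mod n \<or> 0 = Suc 2 mod n"
              using cyc unfolding cycle_enum_def by auto
            ultimately show False using cyc by auto
          qed
          ultimately show ?thesis by blast
        qed
      qed
      show ?thesis using complete_complete_type by blast
    next
      case nonadjacent: False
      then obtain x y where xy: "x \<in> W" "y \<in> W" "x \<noteq> y" "\<not> nb x y" by blast
      obtain B b c u where B: "B \<subset> W" "biconn B" "b \<in> B" "\<forall>u'\<in>W - B. \<not> nb b u'"
        "c \<in> B" "u \<in> W - B" "nb c u" "\<forall>u'\<in>W - B. nb c u' \<longrightarrow> u' = u"
        using biconn_split[OF finite_W bic c3 xy] False by blast
      have "complete_type h B \<or> (\<exists>n v. cycle_enum n v B)"
        if "feas h B" "uncol h B" "w \<in> B" "2 \<le> card (supp h w)" for h w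
        using less.hyps[OF sub[OF B(1)], of h w] B(1,2) WV that by blast
      then have False
        using no_rigid_subblock[OF B] two B(1,3) by blast
      then show ?thesis ..
    qed
  qed
qed

lemma col_weight_cong:
  assumes "\<And>v x b. v \<in> W \<Longrightarrow> x \<in> X v \<Longrightarrow> g b x = h b x" "col g W \<phi>"
  shows "col h W \<phi>"
  unfolding col_def
proof (intro conjI allI impI ballI)
  fix v assume "v \<in> W"
  then show "\<phi> v \<in> X v" using col_range[OF assms(2)] by blast
next
  fix U assume U: "U \<subseteq> W" "U \<noteq> {}"
  then obtain v b where "v \<in> U" "cnt b U \<phi> (\<phi> v) < g b (\<phi> v)" using assms(2) unfolding col_def by blast
  moreover have "g b (\<phi> v) = h b (\<phi> v)"
    using assms(1)[OF _ col_range[OF assms(2)]] U calculation(1) by blast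
  ultimately show "\<exists>v\<in>U. \<exists>b. cnt b U \<phi> (\<phi> v) < h b (\<phi> v)" by (metis)
qed

text \<open>Let \<open>P\<close> and \<open>?Q\<close> be the two sides without \<open>c\<close>.
  Each side together with \<open>c\<close> gets the residual after the other side is coloured; away
  from \<open>c\<close> this is \<open>g\<close>, as no edges cross. Colouring both sides leaves
  residual 0 at \<open>c\<close>, so there \<open>g\<close> is the sum of the counts into
  \<open>P\<close> and into \<open>?Q\<close>, and these counts are the values of \<open>?g1\<close>
  and \<open>?g2\<close>.\<close>

lemma cut_vertex_split:
  assumes W: "W \<subseteq> V" "conn W" "feas g W" "uncol g W" and c: "c \<in> W" "W \<noteq> {c}" "\<not> conn (W - {c})"
  obtains W1 W2 g1 g2 where "W1 \<union> W2 = W" "W1 \<inter> W2 = {c}" "W1 \<subset> W" "W2 \<subset> W" "conn W1" "conn W2"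
    "\<And>u v. u \<in> W1 - {c} \<Longrightarrow> v \<in> W2 - {c} \<Longrightarrow> \<not> nb u v"
    "feas g1 W1" "uncol g1 W1" "feas g2 W2" "uncol g2 W2"
    "\<And>b x. x \<in> X c \<Longrightarrow> g b x = g1 b x + g2 b x"
    "\<And>v b x. v \<in> W1 - {c} \<Longrightarrow> x \<in> X v \<Longrightarrow> g1 b x = g b x"
    "\<And>v b x. v \<in> W2 - {c} \<Longrightarrow> x \<in> X v \<Longrightarrow> g2 b x = g b x"
proof -
  have "W - {c} \<noteq> {}" using c by blast
  then obtain P where P: "P \<subseteq> W - {c}" "P \<noteq> {}" "P \<noteq> W - {c}"
    "\<And>u v. u \<in> P \<Longrightarrow> v \<in> W - {c} - P \<Longrightarrow> \<not> nb u v"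
    using c(3) unfolding conn_def by blast
  let ?Q = "W - {c} - P"
  have Pc: "conn (insert c P)" using conn_cut_part[OF W(2) c(1) P(1,4)] .
  have nbQ: "\<not> nb u v" if "u \<in> ?Q" "v \<in> W - {c} - ?Q" for u v
    using P(4)[of v u] adj_sym[of u v] that by blast
  have Qc: "conn (insert c ?Q)" by (rule conn_cut_part[OF W(2) c(1) _ nbQ]) auto
  obtain \<phi>P where \<phi>P: "col g P \<phi>P" using proper_colorable[OF W(1-3), of P] P c by blast
  obtain \<phi>Q where \<phi>Q: "col g ?Q \<phi>Q" using proper_colorable[OF W(1-3), of ?Q] c by blast
  have V: "P \<subseteq> V" "?Q \<subseteq> V" "insert c P \<subseteq> V" "insert c ?Q \<subseteq> V" "c \<in> V" using P W c by auto
  have un: "P \<union> insert c ?Q = W" "?Q \<union> insert c P = W" using P c by auto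
  have dis: "P \<inter> insert c ?Q = {}" "?Q \<inter> insert c P = {}" using P by auto
  let ?g1 = "res g ?Q \<phi>Q" and ?g2 = "res g P \<phi>P"
  have fP: "feas g (P \<union> insert c ?Q)" "uncol g (P \<union> insert c ?Q)" unfolding un using W by auto
  have fQ: "feas g (?Q \<union> insert c P)" "uncol g (?Q \<union> insert c P)" unfolding un using W by auto
  have cntP: "cnt b P \<phi>P x = 0" if v: "v \<in> ?Q" and x: "x \<in> X v" for v b x
  proof -
    have "\<not> E b x (\<phi>P u)" if u: "u \<in> P" for u
      using E_A[of v u x "\<phi>P u" b] v x u V col_range[OF \<phi>P u] P(4)[OF u v] adj_sym[of v u] unfolding nb_def by blast
    then show ?thesis by (rule cnt_zero)
  qed
  have cntQ: "cnt b ?Q \<phi>Q x = 0" if v: "v \<in> P" and x: "x \<in> X v" for v b x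
  proof -
    have "\<not> E b x (\<phi>Q u)" if u: "u \<in> ?Q" for u
      using E_A[of v u x "\<phi>Q u" b] v x u V col_range[OF \<phi>Q u] P(4)[OF v u] unfolding nb_def by blast
    then show ?thesis by (rule cnt_zero)
  qed
  have eq2: "g b x = ?g2 b x + cnt b P \<phi>P x" if "v \<in> insert c ?Q" "x \<in> X v" for v b x
    using res_tight(1)[OF V(1,4) dis(1) \<phi>P fP Qc that] .
  have eq1: "g b x = ?g1 b x + cnt b ?Q \<phi>Q x" if "v \<in> insert c P" "x \<in> X v" for v b x
    using res_tight(1)[OF V(2,3) dis(2) \<phi>Q fQ Pc that] .
  \<comment> \<open>On \<open>?Q\<close> the residual after colouring \<open>P\<close> is
    \<open>g\<close> itself, so \<open>\<phi>Q\<close> also colours this residual and the two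
    colourings can be composed.\<close>
  have "col ?g2 ?Q \<phi>Q"
  proof (rule col_weight_cong[OF _ \<phi>Q])
    fix v x b assume "v \<in> ?Q" "x \<in> X v"
    then show "g b x = ?g2 b x" using eq2[of v x b] cntP by simp
  qed
  then have join: "col g (P \<union> ?Q) (\<lambda>v. if v \<in> P then \<phi>P v else \<phi>Q v)" (is "col _ _ ?\<phi>")
    using col_compose[OF V(1,2) _ \<phi>P] by blast
  have at_c: "g b x = cnt b P \<phi>P x + cnt b ?Q \<phi>Q x" if x: "x \<in> X c" for b x
  proof -
    have U: "P \<union> ?Q \<subseteq> V" "{c} \<subseteq> V" "(P \<union> ?Q) \<inter> {c} = {}" using V P by auto
    have U': "P \<union> ?Q \<union> {c} = W" using un by blast
    have f: "feas g (P \<union> ?Q \<union> {c})" "uncol g (P \<union> ?Q \<union> {c})" unfolding U' using W by auto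
    have "(\<Sum>x\<in>X c. res g (P \<union> ?Q) ?\<phi> b x) = deg b {c} c"
      using tight[OF U(2) conn_singleton res_feas[of _ _ ?\<phi>, OF U col_range[OF join] f(1)]
          res_uncol[OF U join f(2)]] by blast
    also have "\<dots> = 0" using deg_pos_iff[of "{c}" b c] A_irrefl by simp
    finally have "res g (P \<union> ?Q) ?\<phi> b x = 0" using x finite_X V by auto
    then have "g b x = cnt b (P \<union> ?Q) ?\<phi> x"
      using res_tight(1)[OF U join f conn_singleton _ x, of b] by simp
    also have "\<dots> = cnt b P ?\<phi> x + cnt b ?Q ?\<phi> x"
      using V finite_sub by (intro cnt_Un) auto
    also have "cnt b P ?\<phi> x = cnt b P \<phi>P x" by (intro cnt_cong) auto
    also have "cnt b ?Q ?\<phi> x = cnt b ?Q \<phi>Q x" by (intro cnt_cong) auto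
    finally show ?thesis .
  qed
  show ?thesis
  proof (rule that[of "insert c P" "insert c ?Q" ?g1 ?g2])
    show "insert c P \<union> insert c ?Q = W" "insert c P \<inter> insert c ?Q = {c}" using un P by auto
    show "insert c P \<subset> W" "insert c ?Q \<subset> W" using P c by auto
    show "conn (insert c P)" "conn (insert c ?Q)" by fact+
    show "\<not> nb u v" if "u \<in> insert c P - {c}" "v \<in> insert c ?Q - {c}" for u v
      using P(4) that by auto
    show "feas ?g1 (insert c P)" using res_feas[of _ _ \<phi>Q, OF V(2,3) dis(2) col_range[OF \<phi>Q] fQ(1)] .
    show "uncol ?g1 (insert c P)" using res_uncol[OF V(2,3) dis(2) \<phi>Q fQ(2)] .
    show "feas ?g2 (insert c ?Q)" using res_feas[of _ _ \<phi>P, OF V(1,4) dis(1) col_range[OF \<phi>P] fP(1)] .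
    show "uncol ?g2 (insert c ?Q)" using res_uncol[OF V(1,4) dis(1) \<phi>P fP(2)] .
    show "g b x = ?g1 b x + ?g2 b x" if "x \<in> X c" for b x
      using eq1[OF _ that, of b] eq2[OF _ that, of b] at_c[OF that, of b] by simp
    show "?g1 b x = g b x" if "v \<in> insert c P - {c}" "x \<in> X v" for v b x
      using eq1[of v x b] cntQ[of v x b] that by auto
    show "?g2 b x = g b x" if "v \<in> insert c ?Q - {c}" "x \<in> X v" for v b x
      using eq2[of v x b] cntP[of v x b] that by auto
  qed
qed

end

section \<open>Translation from digraphs\<close>

lemma out_degree_induce:
  assumes "x \<in> U"
  shows "out_degree (with_proj H \<restriction> U) x = card {y \<in> U. (x, y) \<in> parcs H}"
proof -
  have "out_arcs (with_proj H \<restriction> U) x = Pair x ` {y \<in> U. (x, y) \<in> parcs H}"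
    using assms by (auto simp: out_arcs_def)
  then show ?thesis unfolding out_degree_def by (simp add: card_image inj_on_def)
qed

lemma in_degree_induce:
  assumes "x \<in> U"
  shows "in_degree (with_proj H \<restriction> U) x = card {y \<in> U. (y, x) \<in> parcs H}"
proof -
  have "in_arcs (with_proj H \<restriction> U) x = (\<lambda>y. (y, x)) ` {y \<in> U. (y, x) \<in> parcs H}"
    using assms by (auto simp: in_arcs_def)
  then show ?thesis unfolding in_degree_def by (simp add: card_image inj_on_def)
qed

lemma induce_whole:
  assumes "pair_wf_digraph H"
  shows "with_proj H \<restriction> pverts H = with_proj H"
proof -
  interpret pair_wf_digraph H by fact
  show ?thesis
    unfolding with_proj_def induce_subgraph_def by (auto dest: arc_fst_in_verts arc_snd_in_verts)
qed

text \<open>Passing to all subdigraphs or only to the induced ones makes no difference, as the latter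
  have the largest degrees.\<close>

lemma strictly_degenerate_iff:
  assumes H: "pair_digraph H" and T: "T \<subseteq> pverts H"
  shows "strictly_degenerate (with_proj H \<restriction> T) f \<longleftrightarrow>
    (\<forall>U. U \<subseteq> T \<longrightarrow> U \<noteq> {} \<longrightarrow>
      (\<exists>x\<in>U. card {y \<in> U. (x, y) \<in> parcs H} < fst (f x) \<or> card {y \<in> U. (y, x) \<in> parcs H} < snd (f x)))"
    (is "_ \<longleftrightarrow> ?R")
proof -
  interpret pair_digraph H by fact
  have fin: "finite U" if "U \<subseteq> T" for U
    using finite_subset[OF subset_trans[OF that T] pair_finite_verts] .
  show ?thesis
  proof
    assume sd: "strictly_degenerate (with_proj H \<restriction> T) f"
    show ?R
    proof (intro allI impI)
      fix U assume U: "U \<subseteq> T" "U \<noteq> {}"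
      have wf: "wf_digraph (with_proj H \<restriction> U)" "wf_digraph (with_proj H \<restriction> T)"
        by (unfold_locales; simp)+
      have "subgraph (with_proj H \<restriction> U) (with_proj H \<restriction> T)"
        unfolding subgraph_def compatible_def using U wf by auto
      then obtain x where "x \<in> U"
        "out_degree (with_proj H \<restriction> U) x < fst (f x) \<or> in_degree (with_proj H \<restriction> U) x < snd (f x)"
        using sd U(2) unfolding strictly_degenerate_def by (metis induce_subgraph_verts)
      then show "\<exists>x\<in>U. card {y \<in> U. (x, y) \<in> parcs H} < fst (f x) \<or> card {y \<in> U. (y, x) \<in> parcs H} < snd (f x)"
        using out_degree_induce[of x U H] in_degree_induce[of x U H] by (intro bexI[of _ x]) auto
    qed
  next
    assume R: ?R
    show "strictly_degenerate (with_proj H \<restriction> T) f"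
      unfolding strictly_degenerate_def
    proof (intro allI impI, elim conjE)
      fix H' assume H': "subgraph H' (with_proj H \<restriction> T)" "verts H' \<noteq> {}"
      let ?U = "verts H'"
      have U: "?U \<subseteq> T" and arcs: "arcs H' \<subseteq> parcs H" and wf: "wf_digraph H'"
        and th: "tail H' = fst" "head H' = snd"
        using H'(1) by (auto simp: subgraph_def compatible_def)
      obtain x where x: "x \<in> ?U" "card {y \<in> ?U. (x, y) \<in> parcs H} < fst (f x) \<or> card {y \<in> ?U. (y, x) \<in> parcs H} < snd (f x)"
        using R U H'(2) by blast
      have mem: "fst e \<in> ?U" "snd e \<in> ?U" if "e \<in> arcs H'" for e
        using wf_digraph.tail_in_verts[OF wf that] wf_digraph.head_in_verts[OF wf that] th by auto
      have "out_arcs H' x \<subseteq> Pair x ` {y \<in> ?U. (x, y) \<in> parcs H}"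
        using arcs mem th by (fastforce simp: out_arcs_def)
      then have o: "out_degree H' x \<le> card {y \<in> ?U. (x, y) \<in> parcs H}"
        unfolding out_degree_def using fin[OF U] by (intro surj_card_le) auto
      have "in_arcs H' x \<subseteq> (\<lambda>y. (y, x)) ` {y \<in> ?U. (y, x) \<in> parcs H}"
        using arcs mem th by (fastforce simp: in_arcs_def)
      then have i: "in_degree H' x \<le> card {y \<in> ?U. (y, x) \<in> parcs H}"
        unfolding in_degree_def using fin[OF U] by (intro surj_card_le) auto
      show "\<exists>x\<in>verts H'. out_degree H' x < fst (f x) \<or> in_degree H' x < snd (f x)"
        using x o i by (intro bexI[of _ x]) auto
    qed
  qed
qed

text \<open>Arcs are pairs of their ends, so the vertex map determines the arc map. Reading the
  isomorphism from the standard graph to \<open>G\<close> turns it into an enumeration of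
  \<open>G\<close>.\<close>

lemma digraph_iso_enum_iff:
  assumes G: "wf_digraph G" "tail G = fst" "head G = snd" and G': "pair_wf_digraph G'"
  shows "digraph_iso G (with_proj G') \<longleftrightarrow>
    (\<exists>v. bij_betw v (pverts G') (verts G) \<and>
      (\<forall>i\<in>pverts G'. \<forall>j\<in>pverts G'. (v i, v j) \<in> arcs G \<longleftrightarrow> (i, j) \<in> parcs G'))"
proof
  assume "digraph_iso G (with_proj G')"
  then obtain f where f: "pre_digraph.digraph_isomorphism G f" "with_proj G' = app_iso f G"
    unfolding digraph_iso_def by blast
  let ?h = "iso_verts f"
  have inj: "inj_on ?h (verts G)" "inj_on (iso_arcs f) (arcs G)"
    and ends: "\<And>a. a \<in> arcs G \<Longrightarrow> ?h (fst a) = iso_tail f (iso_arcs f a) \<and> ?h (snd a) = iso_head f (iso_arcs f a)"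
    using f(1) G unfolding pre_digraph.digraph_isomorphism_def by auto
  have eqs: "pverts G' = ?h ` verts G" "parcs G' = iso_arcs f ` arcs G" "iso_tail f = fst" "iso_head f = snd"
    using f(2) by (auto simp: with_proj_def app_iso_def)
  have arcs: "iso_arcs f a = (?h (fst a), ?h (snd a))" if "a \<in> arcs G" for a
    using ends[OF that] eqs by (simp add: prod_eq_iff)
  have bij: "bij_betw ?h (verts G) (pverts G')" using inj eqs by (simp add: bij_betw_def)
  let ?v = "the_inv_into (verts G) ?h"
  have v: "bij_betw ?v (pverts G') (verts G)" using bij_betw_the_inv_into[OF bij] .
  have hv: "?h (?v i) = i" "?v i \<in> verts G" if "i \<in> pverts G'" for i
    using that f_the_inv_into_f_bij_betw[OF bij] bij_betwE[OF v] by auto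
  have "(?v i, ?v j) \<in> arcs G \<longleftrightarrow> (i, j) \<in> parcs G'" if "i \<in> pverts G'" "j \<in> pverts G'" for i j
  proof
    assume "(?v i, ?v j) \<in> arcs G"
    then have "iso_arcs f (?v i, ?v j) = (i, j)" using arcs hv that by simp
    then show "(i, j) \<in> parcs G'" using eqs(2) \<open>(?v i, ?v j) \<in> arcs G\<close> by (metis image_eqI)
  next
    assume "(i, j) \<in> parcs G'"
    then obtain a where a: "a \<in> arcs G" "(i, j) = iso_arcs f a" using eqs by auto
    have "fst a \<in> verts G" "snd a \<in> verts G"
      using wf_digraph.tail_in_verts[OF G(1) a(1)] wf_digraph.head_in_verts[OF G(1) a(1)] G by auto
    then have "?v i = fst a" "?v j = snd a"
      using a arcs[OF a(1)] inj(1) by (auto simp: the_inv_into_f_f)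
    then show "(?v i, ?v j) \<in> arcs G" using a by simp
  qed
  then show "\<exists>v. bij_betw v (pverts G') (verts G) \<and>
      (\<forall>i\<in>pverts G'. \<forall>j\<in>pverts G'. (v i, v j) \<in> arcs G \<longleftrightarrow> (i, j) \<in> parcs G')"
    using v by blast
next
  assume "\<exists>v. bij_betw v (pverts G') (verts G) \<and>
      (\<forall>i\<in>pverts G'. \<forall>j\<in>pverts G'. (v i, v j) \<in> arcs G \<longleftrightarrow> (i, j) \<in> parcs G')"
  then obtain v where v: "bij_betw v (pverts G') (verts G)"
    "\<And>i j. i \<in> pverts G' \<Longrightarrow> j \<in> pverts G' \<Longrightarrow> (v i, v j) \<in> arcs G \<longleftrightarrow> (i, j) \<in> parcs G'" by blast
  let ?h = "the_inv_into (pverts G') v"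
  have h: "bij_betw ?h (verts G) (pverts G')" using bij_betw_the_inv_into[OF v(1)] .
  have vh: "v (?h x) = x" "?h x \<in> pverts G'" if "x \<in> verts G" for x
    using that f_the_inv_into_f_bij_betw[OF v(1)] bij_betwE[OF h] by auto
  have hv: "?h (v i) = i" "v i \<in> verts G" if "i \<in> pverts G'" for i
    using that v(1) by (auto simp: bij_betw_def the_inv_into_f_f)
  interpret G: wf_digraph G by fact
  interpret G': pair_wf_digraph G' by fact
  have Gv: "fst a \<in> verts G" "snd a \<in> verts G" if "a \<in> arcs G" for a
    using G.tail_in_verts[OF that] G.head_in_verts[OF that] G by auto
  let ?f = "\<lparr>iso_verts = ?h, iso_arcs = map_prod ?h ?h, iso_head = snd, iso_tail = fst\<rparr>"
  have injh: "inj_on ?h (verts G)" "?h ` verts G = pverts G'" using h by (auto simp: bij_betw_def)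
  have "inj_on (map_prod ?h ?h) (arcs G)"
    by (rule inj_onI) (metis Gv injh(1) inj_onD fst_map_prod snd_map_prod prod_eqI)
  then have "G.digraph_isomorphism ?f"
    unfolding G.digraph_isomorphism_def using injh G by (auto intro: G.wf_digraph_axioms)
  moreover have "with_proj G' = app_iso ?f G"
  proof -
    have "map_prod ?h ?h ` arcs G = parcs G'"
    proof (intro equalityI subsetI)
      fix e assume "e \<in> map_prod ?h ?h ` arcs G"
      then obtain a where a: "a \<in> arcs G" "e = (?h (fst a), ?h (snd a))" by (auto simp: map_prod_def split_beta)
      then show "e \<in> parcs G'" using v(2)[of "?h (fst a)" "?h (snd a)"] vh Gv[OF a(1)] by simp
    next
      fix e assume e: "e \<in> parcs G'"
      obtain i j where ij: "e = (i, j)" by (cases e)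
      then have m: "i \<in> pverts G'" "j \<in> pverts G'" using e G'.in_arcsD1 G'.in_arcsD2 by auto
      then have "(v i, v j) \<in> arcs G" using v(2) e ij by blast
      then have "map_prod ?h ?h (v i, v j) \<in> map_prod ?h ?h ` arcs G" by (rule imageI)
      then show "e \<in> map_prod ?h ?h ` arcs G" using hv m ij by simp
    qed
    then show ?thesis using injh by (simp add: with_proj_def app_iso_def)
  qed
  ultimately show "digraph_iso G (with_proj G')" unfolding digraph_iso_def by blast
qed

lemma bidirected_complete_simps:
  "pverts (bidirected_complete n) = {..<n}"
  "(i, j) \<in> parcs (bidirected_complete n) \<longleftrightarrow> i < n \<and> j < n \<and> i \<noteq> j"
  by (auto simp: bidirected_complete_def bidirect_def)

lemma bidirected_cycle_simps:
  "pverts (bidirected_cycle n) = {..<n}"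
  "(i, j) \<in> parcs (bidirected_cycle n) \<longleftrightarrow>
     i < n \<and> j < n \<and> i \<noteq> j \<and> (j = Suc i mod n \<or> i = Suc j mod n)"
  by (auto simp: bidirected_cycle_def bidirect_def doubleton_eq_iff)

lemma pair_wf_bidirected:
  "pair_wf_digraph (bidirected_complete n)" "pair_wf_digraph (bidirected_cycle n)"
  by (unfold_locales; auto simp: bidirected_complete_simps bidirected_cycle_simps)+

text \<open>Reachability cannot leave a set without outgoing edges, and the set reachable from a
  vertex is such a set.\<close>

lemma (in ugraph) connected_iff_conn:
  assumes G: "wf_digraph G"
    and nb: "\<And>u v. u \<in> verts G \<Longrightarrow> v \<in> verts G \<Longrightarrow> adj u v \<longleftrightarrow> (u, v) \<in> arcs_ends G \<or> (v, u) \<in> arcs_ends G"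
  shows "Digraph_Component.connected G \<longleftrightarrow> conn (verts G)"
proof -
  interpret G: wf_digraph G by fact
  interpret S: pair_wf_digraph "mk_symmetric G" by (rule G.wellformed_mk_symmetric)
  have arc: "(u, v) \<in> parcs (mk_symmetric G) \<longleftrightarrow> u \<in> verts G \<and> v \<in> verts G \<and> adj u v" for u v
  proof -
    have "(u, v) \<in> parcs (mk_symmetric G) \<longleftrightarrow> (u, v) \<in> arcs_ends G \<or> (v, u) \<in> arcs_ends G"
      by (auto simp: parcs_mk_symmetric arcs_ends_conv)
    then show ?thesis using nb G.adj_in_verts by blast
  qed
  show ?thesis
    unfolding connected_def strongly_connected_def
  proof (simp, intro iffI)
    assume *: "verts G \<noteq> {} \<and> (\<forall>u\<in>verts G. \<forall>v\<in>verts G. u \<rightarrow>\<^sup>*\<^bsub>with_proj (mk_symmetric G)\<^esub> v)"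
    show "conn (verts G)"
      unfolding conn_def
    proof (intro conjI allI impI)
      fix P assume P: "P \<subseteq> verts G" "P \<noteq> {}" "P \<noteq> verts G"
      then obtain u v where uv: "u \<in> P" "v \<in> verts G" "v \<notin> P" by blast
      show "\<exists>u\<in>P. \<exists>v\<in>verts G - P. adj u v"
      proof (rule ccontr)
        assume no: "\<not> ?thesis"
        have "u \<rightarrow>\<^sup>*\<^bsub>with_proj (mk_symmetric G)\<^esub> v" using * uv P by blast
        then have "v \<in> P"
        proof (induction rule: S.reachable_induct)
          case (step x y)
          then show ?case using no arc by auto
        qed (use uv in simp)
        then show False using uv by simp
      qed
    qed (use * in simp)
  next
    assume c: "conn (verts G)"
    have "u \<rightarrow>\<^sup>*\<^bsub>with_proj (mk_symmetric G)\<^esub> v" if u: "u \<in> verts G" and v: "v \<in> verts G" for u v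
    proof -
      let ?P = "{w \<in> verts G. u \<rightarrow>\<^sup>*\<^bsub>with_proj (mk_symmetric G)\<^esub> w}"
      have uP: "u \<in> ?P" using u S.reachable_refl by simp
      have "?P = verts G"
      proof (rule ccontr)
        assume "?P \<noteq> verts G"
        then obtain x y where xy: "x \<in> ?P" "y \<in> verts G - ?P" "adj x y"
          using conn_cut[OF c, of ?P] uP by blast
        then have "(x, y) \<in> parcs (mk_symmetric G)" using arc by auto
        moreover have "u \<rightarrow>\<^sup>*\<^bsub>with_proj (mk_symmetric G)\<^esub> x" using xy(1) by simp
        ultimately have "u \<rightarrow>\<^sup>*\<^bsub>with_proj (mk_symmetric G)\<^esub> y"
          using S.reachable_adj_trans[of u x y] by simp
        then show False using xy(2) by simp
      qed
      then show ?thesis using v by blast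
    qed
    then show "verts G \<noteq> {} \<and> (\<forall>u\<in>verts G. \<forall>v\<in>verts G. u \<rightarrow>\<^sup>*\<^bsub>with_proj (mk_symmetric G)\<^esub> v)"
      using conn_nonempty[OF c] by blast
  qed
qed

definition arc_rel :: "'a pair_pre_digraph \<Rightarrow> bool \<Rightarrow> 'a \<Rightarrow> 'a \<Rightarrow> bool" where
  "arc_rel D b u v \<longleftrightarrow> (if b then (u, v) \<in> parcs D else (v, u) \<in> parcs D)"

definition weight :: "('b \<Rightarrow> nat \<times> nat) \<Rightarrow> bool \<Rightarrow> 'b \<Rightarrow> nat" where
  "weight f b x = (if b then fst (f x) else snd (f x))"

lemma weight_simps: "weight f True x = fst (f x)" "weight f False x = snd (f x)"
  by (simp_all add: weight_def)

lemma matching_arcs: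
  assumes "matching M" "(x, y) \<in> M" "(x', y') \<in> M" "x = x' \<or> y = y'"
  shows "(x, y) = (x', y')"
  using assms unfolding matching_def by fastforce

lemma cover_system_of_cover:
  assumes D: "pair_digraph D" and cov: "is_cover D X H"
  shows "cover_system (pverts D) (arc_rel D) X (arc_rel H)"
proof -
  interpret D: pair_digraph D by fact
  interpret H: pair_digraph H using cov by (simp add: is_cover_def)
  have X: "disjoint_family_on X (pverts D)" "(\<Union>v\<in>pverts D. X v) = pverts H"
    using cov by (auto simp: is_cover_def)
  have loop: "arcs_from_to H (X v) (X v) = {}" if "v \<in> pverts D" for v
    using cov that by (simp add: is_cover_def)
  have between: "if (u, v) \<in> parcs D then matching (arcs_from_to H (X u) (X v)) else arcs_from_to H (X u) (X v) = {}"
    if "u \<in> pverts D" "v \<in> pverts D" "u \<noteq> v" for u v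
    using cov that unfolding is_cover_def by blast
  have aft: "(x, y) \<in> arcs_from_to H (X u) (X v)" if "(x, y) \<in> parcs H" "x \<in> X u" "y \<in> X v" for x y u v
    using that by (simp add: arcs_from_to_def)
  have proj: "u \<noteq> v \<and> (u, v) \<in> parcs D" if "u \<in> pverts D" "v \<in> pverts D" "x \<in> X u" "y \<in> X v" "(x, y) \<in> parcs H" for u v x y
  proof -
    have "u \<noteq> v" using loop aft that by blast
    then show ?thesis using between[of u v] aft[of x y u v] that by (auto split: if_splits)
  qed
  show ?thesis
  proof
    show "finite (pverts D)" by (rule D.pair_finite_verts)
    show "finite (X v)" if "v \<in> pverts D" for v
    proof (rule finite_subset[OF _ H.pair_finite_verts])
      show "X v \<subseteq> pverts H" using X that by blast
    qed
    show "u = v" if "u \<in> pverts D" "v \<in> pverts D" "x \<in> X u" "x \<in> X v" for u v x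
      using X(1) that unfolding disjoint_family_on_def by blast
    show "\<not> arc_rel D b v v" for b v unfolding arc_rel_def using D.no_loops' by auto
    show "arc_rel D (\<not> b) u v = arc_rel D b v u" for b u v by (simp add: arc_rel_def)
    show "arc_rel H (\<not> b) x y = arc_rel H b y x" for b x y by (simp add: arc_rel_def)
    show "arc_rel D b u v" if "u \<in> pverts D" "v \<in> pverts D" "x \<in> X u" "y \<in> X v" "arc_rel H b x y" for u v x y b
      using proj[of u v x y] proj[of v u y x] that by (cases b) (auto simp: arc_rel_def)
    show "y = y'" if "u \<in> pverts D" "v \<in> pverts D" "x \<in> X u" "y \<in> X v" "y' \<in> X v" "arc_rel H b x y" "arc_rel H b x y'"
      for u v x y y' b
    proof (cases b)
      case True
      then have "(x, y) \<in> parcs H" "(x, y') \<in> parcs H" using that by (auto simp: arc_rel_def)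
      then show ?thesis
        using matching_arcs[of "arcs_from_to H (X u) (X v)" x y x y'] between[of u v] proj[of u v x y] aft that
        by auto
    next
      case False
      then have "(y, x) \<in> parcs H" "(y', x) \<in> parcs H" using that by (auto simp: arc_rel_def)
      then show ?thesis
        using matching_arcs[of "arcs_from_to H (X v) (X u)" y x y' x] between[of v u] proj[of v u y x] aft that
        by auto
    qed
  qed
qed

section \<open>Restriction of a configuration to a set of base vertices\<close>

context cover_system
begin

text \<open>All subconfigurations are cut from one fixed cover: only the vertex set varies, while
  \<open>X\<close> stays the same function. This lets both parts at a cut vertex live in the
  original types.\<close>

definition sub_digraph :: "'a set \<Rightarrow> 'a pair_pre_digraph" where
  "sub_digraph W = \<lparr>pverts = W, parcs = {(u, v). u \<in> W \<and> v \<in> W \<and> A True u v}\<rparr>"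

definition sub_cover :: "'a set \<Rightarrow> 'b pair_pre_digraph" where
  "sub_cover W = \<lparr>pverts = (\<Union>v\<in>W. X v),
     parcs = {(x, y). x \<in> (\<Union>v\<in>W. X v) \<and> y \<in> (\<Union>v\<in>W. X v) \<and> E True x y}\<rparr>"

lemma sub_digraph_simps:
  "pverts (sub_digraph W) = W"
  "(u, v) \<in> parcs (sub_digraph W) \<longleftrightarrow> u \<in> W \<and> v \<in> W \<and> A True u v"
  by (simp_all add: sub_digraph_def)

lemma sub_cover_simps:
  "pverts (sub_cover W) = (\<Union>v\<in>W. X v)"
  "(x, y) \<in> parcs (sub_cover W) \<longleftrightarrow> x \<in> (\<Union>v\<in>W. X v) \<and> y \<in> (\<Union>v\<in>W. X v) \<and> E True x y"
  by (simp_all add: sub_cover_def)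

lemma A_False: "A False u v \<longleftrightarrow> A True v u"
  using A_flip[of True u v] by simp

lemma E_False: "E False x y \<longleftrightarrow> E True y x"
  using E_flip[of True x y] by simp

lemma sub_pair_digraph:
  assumes "W \<subseteq> V"
  shows "pair_digraph (sub_digraph W)"
proof -
  have fin: "finite W" using finite_sub assms .
  show ?thesis
  proof
    show "finite (parcs (sub_digraph W))"
      by (rule finite_subset[of _ "W \<times> W"]) (auto simp: sub_digraph_def fin)
  qed (auto simp: sub_digraph_def fin A_irrefl)
qed

lemma sub_cover_pair_digraph:
  assumes W: "W \<subseteq> V"
  shows "pair_digraph (sub_cover W)"
proof -
  have fin: "finite (\<Union>v\<in>W. X v)" using finite_sub[OF W] finite_X W by auto
  show ?thesis
  proof
    show "finite (parcs (sub_cover W))"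
      by (rule finite_subset[of _ "(\<Union>v\<in>W. X v) \<times> (\<Union>v\<in>W. X v)"]) (auto simp: sub_cover_def fin)
    fix e assume "e \<in> parcs (sub_cover W)"
    then obtain x y v where e: "e = (x, y)" "v \<in> W" "x \<in> X v" "E True x y" by (auto simp: sub_cover_def)
    then show "fst e \<noteq> snd e" using E_irrefl[of v x x True] W by auto
  qed (auto simp: sub_cover_def fin)
qed

lemma sub_is_cover:
  assumes W: "W \<subseteq> V"
  shows "is_cover (sub_digraph W) X (sub_cover W)"
  unfolding is_cover_def sub_digraph_simps(1)
proof (intro conjI ballI impI)
  show "pair_digraph (sub_cover W)" using sub_cover_pair_digraph[OF W] .
  show "disjoint_family_on X W"
    unfolding disjoint_family_on_def using X_disjoint W by blast
  show "(\<Union>v\<in>W. X v) = pverts (sub_cover W)" by (simp add: sub_cover_simps)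
  show "arcs_from_to (with_proj (sub_cover W)) (X v) (X v) = {}" if "v \<in> W" for v
    using E_irrefl that W by (auto simp: arcs_from_to_def sub_cover_simps)
  fix u v assume uv: "u \<in> W" "v \<in> W" "u \<noteq> v"
  then have V: "u \<in> V" "v \<in> V" using W by auto
  show "if (u, v) \<in> parcs (sub_digraph W) then matching (arcs_from_to (with_proj (sub_cover W)) (X u) (X v))
    else arcs_from_to (with_proj (sub_cover W)) (X u) (X v) = {}"
  proof (cases "A True u v")
    case True
    have "matching (arcs_from_to (with_proj (sub_cover W)) (X u) (X v))"
      unfolding matching_def
    proof (intro ballI impI)
      fix e e' assume e: "e \<in> arcs_from_to (with_proj (sub_cover W)) (X u) (X v)"
        "e' \<in> arcs_from_to (with_proj (sub_cover W)) (X u) (X v)" "e \<noteq> e'"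
      obtain x y x' y' where xy: "e = (x, y)" "e' = (x', y')" by (metis surj_pair)
      then have m: "x \<in> X u" "x' \<in> X u" "y \<in> X v" "y' \<in> X v" "E True x y" "E True x' y'"
        using e by (auto simp: arcs_from_to_def sub_cover_simps)
      have "x \<noteq> x'" using E_fun[OF V m(1,3,4,5)] m(6) e(3) xy by blast
      moreover have "y \<noteq> y'" using E_inj[OF V m(1,2,3,5)] m(6) e(3) xy by blast
      moreover have "x \<noteq> y'" "y \<noteq> x'" using X_disjoint[OF V] m uv(3) by blast+
      ultimately show "{fst e, snd e} \<inter> {fst e', snd e'} = {}" using xy by auto
    qed
    then show ?thesis using True uv by (simp add: sub_digraph_simps)
  next
    case False
    then have "arcs_from_to (with_proj (sub_cover W)) (X u) (X v) = {}"
      using E_A[OF V, of _ _ True] by (auto simp: arcs_from_to_def sub_cover_simps)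
    then show ?thesis using False by (simp add: sub_digraph_simps)
  qed
qed

lemma sub_configuration:
  assumes "W \<subseteq> V"
  shows "configuration (sub_digraph W) X (sub_cover W) f"
  using sub_pair_digraph[OF assms] sub_is_cover[OF assms] by (simp add: configuration_def)

lemma degree_pair_sub:
  assumes "v \<in> W"
  shows "degree_pair (with_proj (sub_digraph W)) v = (deg True W v, deg False W v)"
proof -
  have "out_arcs (with_proj (sub_digraph W)) v = Pair v ` {u \<in> W. A True v u}"
    using assms by (auto simp: out_arcs_def sub_digraph_def)
  moreover have "in_arcs (with_proj (sub_digraph W)) v = (\<lambda>u. (u, v)) ` {u \<in> W. A False v u}"
    using assms by (auto simp: in_arcs_def sub_digraph_def A_False)
  ultimately show ?thesis
    unfolding degree_pair_def out_degree_def in_degree_def deg_def by (simp add: card_image inj_on_def)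
qed

lemma degree_feasible_sub_iff:
  assumes "W \<subseteq> V"
  shows "degree_feasible (sub_digraph W) X (sub_cover W) f \<longleftrightarrow> feas (weight f) W"
proof -
  have "degree_pair (with_proj (sub_digraph W)) v \<le> (\<Sum>x\<in>X v. f x) \<longleftrightarrow>
      (\<forall>b. deg b W v \<le> (\<Sum>x\<in>X v. weight f b x))" if "v \<in> W" for v
    unfolding degree_pair_sub[OF that] less_eq_prod_def fst_sum snd_sum
    by (auto simp: weight_simps all_bool_eq)
  then show ?thesis
    using sub_configuration[OF assms] by (simp add: degree_feasible_def feas_def sub_digraph_simps)
qed

lemma inj_on_choice:
  assumes "W \<subseteq> V" "\<And>v. v \<in> W \<Longrightarrow> \<phi> v \<in> X v"
  shows "inj_on \<phi> W"
proof (rule inj_onI)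
  fix u v assume uv: "u \<in> W" "v \<in> W" "\<phi> u = \<phi> v"
  have "\<phi> u \<in> X u" "\<phi> u \<in> X v" using assms(2)[OF uv(1)] assms(2)[OF uv(2)] uv(3) by simp_all
  then show "u = v" using X_disjoint[of u v "\<phi> u"] uv assms(1) by blast
qed

text \<open>A choice function is injective, so the subsets of its image correspond to sets of base
  vertices with the same counts.\<close>

lemma strictly_degenerate_sub_iff:
  assumes W: "W \<subseteq> V" and \<phi>: "\<And>v. v \<in> W \<Longrightarrow> \<phi> v \<in> X v"
  shows "strictly_degenerate (with_proj (sub_cover W) \<restriction> (\<phi> ` W)) f \<longleftrightarrow> col (weight f) W \<phi>"
proof -
  have inj: "inj_on \<phi> W" using inj_on_choice W \<phi> .
  have sub: "\<phi> ` W \<subseteq> pverts (sub_cover W)" using \<phi> by (auto simp: sub_cover_simps)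
  have card: "card {y \<in> \<phi> ` U. (\<phi> v, y) \<in> parcs (sub_cover W)} = cnt True U \<phi> (\<phi> v)"
    "card {y \<in> \<phi> ` U. (y, \<phi> v) \<in> parcs (sub_cover W)} = cnt False U \<phi> (\<phi> v)"
    if U: "U \<subseteq> W" "v \<in> U" for U v
  proof -
    have i: "inj_on \<phi> {u \<in> U. E b (\<phi> v) (\<phi> u)}" for b using inj U by (auto intro: inj_on_subset)
    have m: "\<phi> u \<in> (\<Union>v\<in>W. X v)" if "u \<in> U" for u using \<phi> that U by blast
    have "{y \<in> \<phi> ` U. (\<phi> v, y) \<in> parcs (sub_cover W)} = \<phi> ` {u \<in> U. E True (\<phi> v) (\<phi> u)}"
      using m U by (auto simp: sub_cover_simps)
    then show "card {y \<in> \<phi> ` U. (\<phi> v, y) \<in> parcs (sub_cover W)} = cnt True U \<phi> (\<phi> v)"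
      unfolding cnt_def using card_image[OF i] by simp
    have "{y \<in> \<phi> ` U. (y, \<phi> v) \<in> parcs (sub_cover W)} = \<phi> ` {u \<in> U. E False (\<phi> v) (\<phi> u)}"
      using m U by (auto simp: sub_cover_simps E_False)
    then show "card {y \<in> \<phi> ` U. (y, \<phi> v) \<in> parcs (sub_cover W)} = cnt False U \<phi> (\<phi> v)"
      unfolding cnt_def using card_image[OF i] by simp
  qed
  have ex: "(\<exists>x\<in>\<phi> ` U. card {y \<in> \<phi> ` U. (x, y) \<in> parcs (sub_cover W)} < fst (f x) \<or>
      card {y \<in> \<phi> ` U. (y, x) \<in> parcs (sub_cover W)} < snd (f x)) \<longleftrightarrow>
    (\<exists>v\<in>U. \<exists>b. cnt b U \<phi> (\<phi> v) < weight f b (\<phi> v))" if U: "U \<subseteq> W" for U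
    unfolding bex_simps(7) ex_bool_eq weight_simps using card[OF U] by (intro bex_cong refl) auto
  have all: "(\<forall>U'. U' \<subseteq> \<phi> ` W \<longrightarrow> U' \<noteq> {} \<longrightarrow> P U') \<longleftrightarrow> (\<forall>U. U \<subseteq> W \<longrightarrow> U \<noteq> {} \<longrightarrow> P (\<phi> ` U))" for P
    by (metis image_is_empty image_mono subset_imageE)
  show ?thesis
    unfolding strictly_degenerate_iff[OF sub_cover_pair_digraph[OF W] sub] all col_def
    using ex \<phi> by auto
qed

lemma transversal_sub_iff:
  "transversal (sub_digraph W) X (sub_cover W) T \<longleftrightarrow> T \<subseteq> (\<Union>v\<in>W. X v) \<and> (\<forall>v\<in>W. card (T \<inter> X v) = 1)"
  by (simp add: transversal_def sub_digraph_simps sub_cover_simps)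

lemma transversal_choice:
  assumes W: "W \<subseteq> V"
  shows "transversal (sub_digraph W) X (sub_cover W) T \<longleftrightarrow> (\<exists>\<phi>. (\<forall>v\<in>W. \<phi> v \<in> X v) \<and> T = \<phi> ` W)"
proof
  assume T: "transversal (sub_digraph W) X (sub_cover W) T"
  define \<phi> where "\<phi> v = (THE x. x \<in> T \<inter> X v)" for v
  have \<phi>: "T \<inter> X v = {\<phi> v}" if v: "v \<in> W" for v
  proof -
    obtain x where x: "T \<inter> X v = {x}"
      using T v unfolding transversal_sub_iff by (auto simp: card_1_singleton_iff)
    then have "\<phi> v = x" unfolding \<phi>_def by (intro the_equality) auto
    then show ?thesis using x by simp
  qed
  have "T = \<phi> ` W"
  proof (intro equalityI subsetI)
    fix x assume x: "x \<in> T"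
    then obtain v where "v \<in> W" "x \<in> X v" using T unfolding transversal_sub_iff by blast
    then show "x \<in> \<phi> ` W" using \<phi> x by blast
  qed (use \<phi> in blast)
  then show "\<exists>\<phi>. (\<forall>v\<in>W. \<phi> v \<in> X v) \<and> T = \<phi> ` W" using \<phi> by blast
next
  assume "\<exists>\<phi>. (\<forall>v\<in>W. \<phi> v \<in> X v) \<and> T = \<phi> ` W"
  then obtain \<phi> where \<phi>: "\<And>v. v \<in> W \<Longrightarrow> \<phi> v \<in> X v" "T = \<phi> ` W" by blast
  have "T \<inter> X v = {\<phi> v}" if v: "v \<in> W" for v
  proof -
    have "u = v" if "u \<in> W" "\<phi> u \<in> X v" for u
      using X_disjoint[of u v "\<phi> u"] \<phi>(1)[OF that(1)] that v W by blast
    then show ?thesis using \<phi> v by auto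
  qed
  then show "transversal (sub_digraph W) X (sub_cover W) T"
    unfolding transversal_sub_iff using \<phi> by auto
qed

lemma colorable_sub_iff:
  assumes W: "W \<subseteq> V"
  shows "colorable (sub_digraph W) X (sub_cover W) f \<longleftrightarrow> (\<exists>\<phi>. col (weight f) W \<phi>)"
proof
  assume "colorable (sub_digraph W) X (sub_cover W) f"
  then show "\<exists>\<phi>. col (weight f) W \<phi>"
    unfolding colorable_def transversal_choice[OF W] using strictly_degenerate_sub_iff[OF W] by blast
next
  assume "\<exists>\<phi>. col (weight f) W \<phi>"
  then obtain \<phi> where \<phi>: "col (weight f) W \<phi>" by blast
  then have "strictly_degenerate (with_proj (sub_cover W) \<restriction> (\<phi> ` W)) f"
    using strictly_degenerate_sub_iff[OF W, of \<phi> f] col_range[OF \<phi>] by blast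
  moreover have "transversal (sub_digraph W) X (sub_cover W) (\<phi> ` W)"
    unfolding transversal_choice[OF W] using col_range[OF \<phi>] by blast
  ultimately show "colorable (sub_digraph W) X (sub_cover W) f"
    unfolding colorable_def using sub_configuration[OF W] by blast
qed

lemma uncolorable_sub_iff:
  assumes W: "W \<subseteq> V"
  shows "uncolorable (sub_digraph W) X (sub_cover W) f \<longleftrightarrow> uncol (weight f) W"
  unfolding uncolorable_def colorable_sub_iff[OF W] uncol_def using sub_configuration[OF W] by blast

lemma connected_sub_iff:
  assumes W: "W \<subseteq> V"
  shows "Digraph_Component.connected (with_proj (sub_digraph W)) \<longleftrightarrow> conn W"
proof -
  interpret D: pair_digraph "sub_digraph W" using sub_pair_digraph[OF W] .
  have "nb u v \<longleftrightarrow> (u, v) \<in> parcs (sub_digraph W) \<or> (v, u) \<in> parcs (sub_digraph W)"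
    if "u \<in> W" "v \<in> W" for u v
    using that by (simp add: nb_def ex_bool_eq A_False sub_digraph_simps)
  then show ?thesis
    using connected_iff_conn[of "with_proj (sub_digraph W)"] D.wf_digraph by (simp add: sub_digraph_simps)
qed

text \<open>The subgraph relation is antisymmetric, so maximality inside the digraph itself is
  automatic and only the two defining properties remain.\<close>

lemma is_block_sub_iff:
  assumes W: "W \<subseteq> V"
  shows "is_block (with_proj (sub_digraph W)) \<longleftrightarrow> biconn W"
proof -
  interpret D: pair_digraph "sub_digraph W" using sub_pair_digraph[OF W] .
  let ?D = "with_proj (sub_digraph W)"
  have sg: "subgraph ?D ?D" unfolding subgraph_def compatible_def using D.wf_digraph by simp
  have anti: "H' = ?D" if "subgraph ?D H'" "subgraph H' ?D" for H' :: "('a, 'a \<times> 'a) pre_digraph"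
    using that unfolding subgraph_def compatible_def by (intro pre_digraph.equality) auto
  have del: "Digraph_Component.connected (pre_digraph.del_vert ?D v) \<longleftrightarrow> conn (W - {v})" if v: "v \<in> W" for v
  proof -
    let ?G = "pre_digraph.del_vert ?D v"
    have G: "verts ?G = W - {v}" "arcs ?G = {(x, y). x \<in> W - {v} \<and> y \<in> W - {v} \<and> A True x y}"
      "tail ?G = fst" "head ?G = snd"
      by (auto simp: pre_digraph.del_vert_def sub_digraph_def)
    have ends: "arcs_ends ?G = arcs ?G" unfolding arcs_ends_conv G(3,4) by simp
    have wf: "wf_digraph ?G"
      by unfold_locales (auto simp: G)
    have "nb x y \<longleftrightarrow> (x, y) \<in> arcs_ends ?G \<or> (y, x) \<in> arcs_ends ?G"
      if "x \<in> verts ?G" "y \<in> verts ?G" for x y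
      using that unfolding ends G by (simp add: nb_def ex_bool_eq A_False)
    from connected_iff_conn[OF wf this] show ?thesis unfolding G by simp
  qed
  have "no_separating_vertex ?D \<longleftrightarrow> (\<forall>v\<in>W. W - {v} \<noteq> {} \<longrightarrow> conn (W - {v}))"
    unfolding no_separating_vertex_def using del by (simp add: sub_digraph_simps)
  then have "biconn W \<longleftrightarrow> Digraph_Component.connected ?D \<and> no_separating_vertex ?D"
    unfolding biconn_def connected_sub_iff[OF W] by simp
  then show ?thesis
    unfolding is_block_of_def pre_digraph.max_subgraph_def using sg anti by blast
qed

text \<open>On a transversal the fibres are singletons, and a perfect matching from one singleton to
  another is a single arc.\<close>

lemma saturated_sub_iff:
  assumes W: "W \<subseteq> V" and T: "transversal (sub_digraph W) X (sub_cover W) T"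
  shows "saturated_subcover (sub_digraph W) X (sub_cover W) T \<longleftrightarrow>
    (\<forall>u\<in>W. \<forall>v\<in>W. \<forall>x\<in>T \<inter> X u. \<forall>y\<in>T \<inter> X v. A True u v \<longrightarrow> E True x y)"
proof -
  obtain \<phi> where \<phi>: "\<And>v. v \<in> W \<Longrightarrow> \<phi> v \<in> X v" "T = \<phi> ` W"
    using T unfolding transversal_choice[OF W] by blast
  have TX: "T \<inter> X v = {\<phi> v}" "X v \<inter> T = {\<phi> v}" if v: "v \<in> W" for v
  proof -
    have "card (T \<inter> X v) = 1" using T v by (simp add: transversal_sub_iff)
    then obtain x where "T \<inter> X v = {x}" by (rule card_1_singletonE)
    moreover have "\<phi> v \<in> T \<inter> X v" using \<phi> v by blast
    ultimately show "T \<inter> X v = {\<phi> v}" by simp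
    then show "X v \<inter> T = {\<phi> v}" by (simp add: Int_commute)
  qed
  have sel: "{v \<in> W. X v \<inter> T \<noteq> {}} = W" using TX by auto
  interpret D: pair_digraph "sub_digraph W" using sub_pair_digraph[OF W] .
  have Dr: "with_proj (sub_digraph W) \<restriction> W = with_proj (sub_digraph W)"
    using induce_whole[OF D.pair_wf_digraph] by (simp add: sub_digraph_simps)
  have ends: "arcs_ends (with_proj (sub_cover W) \<restriction> T) = {(x, y). x \<in> T \<and> y \<in> T \<and> (x, y) \<in> parcs (sub_cover W)}"
    "arcs_ends ((with_proj (sub_cover W) \<restriction> T) \<restriction> S) = {(x, y). x \<in> T \<inter> S \<and> y \<in> T \<inter> S \<and> (x, y) \<in> parcs (sub_cover W)}"
    for S by (auto simp: arcs_ends_conv image_iff)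
  have pm: "perfect_matching ((with_proj (sub_cover W) \<restriction> T) \<restriction> (X u \<inter> T \<union> X v \<inter> T))
      (arcs_from_to (with_proj (sub_cover W) \<restriction> T) (X u \<inter> T) (X v \<inter> T)) \<longleftrightarrow> E True (\<phi> u) (\<phi> v)"
    if uv: "u \<in> W" "v \<in> W" for u v
  proof -
    have m: "\<phi> u \<in> T" "\<phi> v \<in> T" "\<phi> u \<in> (\<Union>v\<in>W. X v)" "\<phi> v \<in> (\<Union>v\<in>W. X v)" using \<phi> uv by auto
    have aft: "arcs_from_to (with_proj (sub_cover W) \<restriction> T) {\<phi> u} {\<phi> v} =
        (if E True (\<phi> u) (\<phi> v) then {(\<phi> u, \<phi> v)} else {})"
      unfolding arcs_from_to_def ends using m by (auto simp: sub_cover_simps)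
    show ?thesis
      unfolding TX(2)[OF uv(1)] TX(2)[OF uv(2)] aft perfect_matching_def ends
      using m by (auto simp: matching_def sub_cover_simps)
  qed
  have ball: "(\<forall>(u, v)\<in>arcs_ends (with_proj (sub_digraph W)). P u v) \<longleftrightarrow>
      (\<forall>u\<in>W. \<forall>v\<in>W. A True u v \<longrightarrow> P u v)" for P
    by (auto simp: sub_digraph_def)
  have "saturated_subcover (sub_digraph W) X (sub_cover W) T \<longleftrightarrow>
      (\<forall>u\<in>W. \<forall>v\<in>W. A True u v \<longrightarrow> E True (\<phi> u) (\<phi> v))"
    unfolding saturated_subcover_def saturated_def sub_digraph_simps(1) sel Dr ball
    using pm by simp
  also have "\<dots> \<longleftrightarrow> (\<forall>u\<in>W. \<forall>v\<in>W. \<forall>x\<in>T \<inter> X u. \<forall>y\<in>T \<inter> X v. A True u v \<longrightarrow> E True x y)"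
    using TX by simp
  finally show ?thesis .
qed

end

lemma sub_digraph_of_cover:
  assumes D: "pair_digraph D" and cov: "is_cover D X H"
  shows "cover_system.sub_digraph (arc_rel D) (pverts D) = D"
    and "cover_system.sub_cover X (arc_rel H) (pverts D) = H"
proof -
  interpret cover_system "pverts D" "arc_rel D" X "arc_rel H" using cover_system_of_cover[OF D cov] .
  interpret D: pair_digraph D by fact
  interpret H: pair_digraph H using cov by (simp add: is_cover_def)
  have "{(u, v). u \<in> pverts D \<and> v \<in> pverts D \<and> arc_rel D True u v} = parcs D"
    by (auto simp: arc_rel_def dest: D.in_arcsD1 D.in_arcsD2)
  then show "sub_digraph (pverts D) = D" by (simp add: sub_digraph_def)
  have u: "(\<Union>v\<in>pverts D. X v) = pverts H" using cov by (simp add: is_cover_def)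
  have "{(x, y). x \<in> pverts H \<and> y \<in> pverts H \<and> arc_rel H True x y} = parcs H"
    by (auto simp: arc_rel_def dest: H.in_arcsD1 H.in_arcsD2)
  then show "sub_cover (pverts D) = H" unfolding sub_cover_def u by simp
qed

section \<open>Constructing configurations\<close>

context critical_block
begin

lemma f_zero: "g = weight f \<Longrightarrow> x \<in> X v \<Longrightarrow> x \<notin> supp g v \<Longrightarrow> f x = (0, 0)"
  by (auto simp: supp_def weight_def prod_eq_iff split: if_splits)

text \<open>A lone support vertex carries the whole degree of its fibre, and
  \<open>match_supp'\<close> joins the lone support vertices along every arc.\<close>

lemma M_config:
  assumes gf: "g = weight f" and X: "\<And>v. v \<in> W \<Longrightarrow> X v \<noteq> {}"
    and one: "\<And>w. w \<in> W \<Longrightarrow> card (supp g w) \<le> 1"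
  shows "M_configuration (sub_digraph W) X (sub_cover W) f"
proof -
  \<comment> \<open>An empty support occurs only where the degree is 0; any element of the fibre
    then serves, with weight (0, 0).\<close>
  have "\<exists>x. x \<in> X v \<and> supp g v \<subseteq> {x}" if v: "v \<in> W" for v
  proof (cases "supp g v = {}")
    case True
    then show ?thesis using X[OF v] by blast
  next
    case False
    then have "card (supp g v) = 1" using one[OF v] finite_supp[OF v] by (simp add: le_Suc_eq)
    then obtain x where "supp g v = {x}" by (rule card_1_singletonE)
    then show ?thesis using supp_X by blast
  qed
  then obtain \<phi> where \<phi>: "\<And>v. v \<in> W \<Longrightarrow> \<phi> v \<in> X v" "\<And>v. v \<in> W \<Longrightarrow> supp g v \<subseteq> {\<phi> v}" by metis
  let ?T = "\<phi> ` W"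
  have T: "transversal (sub_digraph W) X (sub_cover W) ?T"
    unfolding transversal_choice[OF WV] using \<phi> by blast
  have TX: "x = \<phi> v" if v: "v \<in> W" "x \<in> ?T \<inter> X v" for x v
  proof -
    have "card (?T \<inter> X v) = 1" using T v by (simp add: transversal_sub_iff)
    then obtain y where "?T \<inter> X v = {y}" by (rule card_1_singletonE)
    moreover have "\<phi> v \<in> ?T \<inter> X v" using \<phi> v by blast
    ultimately show ?thesis using v by auto
  qed
  have val: "g b (\<phi> v) = deg b W v" if v: "v \<in> W" for v b
  proof -
    have fin: "finite (X v)" using finite_X v WV by blast
    have "g b x = 0" if "x \<in> X v - {\<phi> v}" for x using \<phi>(2)[OF v] that by (auto simp: supp_def)
    then have "(\<Sum>x\<in>X v. g b x) = (\<Sum>x\<in>{\<phi> v}. g b x)"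
      using \<phi>(1)[OF v] fin by (intro sum.mono_neutral_right) auto
    then show ?thesis using sum_tight[OF v, of b] by simp
  qed
  have sat: "E True (\<phi> u) (\<phi> v)" if uv: "u \<in> W" "v \<in> W" "A True u v" for u v
  proof -
    have "0 < deg True W u" using deg_pos_iff[OF finite_W] uv by blast
    then have "0 < g True (\<phi> u)" using val[OF uv(1)] by simp
    then have "\<phi> u \<in> supp g u" using \<phi>(1)[OF uv(1)] by (auto simp: supp_def)
    then obtain y where "y \<in> supp g v" "E True (\<phi> u) y" using match_supp'[OF uv] by blast
    then show ?thesis using \<phi>(2)[OF uv(2)] by blast
  qed
  have "saturated_subcover (sub_digraph W) X (sub_cover W) ?T"
    unfolding saturated_sub_iff[OF WV T] using TX sat by metis
  moreover have "\<forall>v\<in>W. \<forall>x\<in>?T \<inter> X v. f x = degree_pair (with_proj (sub_digraph W)) v"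
  proof (intro ballI)
    fix v x assume v: "v \<in> W" and x: "x \<in> ?T \<inter> X v"
    show "f x = degree_pair (with_proj (sub_digraph W)) v"
      using TX[OF v x] val[OF v, of True] val[OF v, of False] degree_pair_sub[OF v]
      by (simp add: gf weight_simps prod_eq_iff)
  qed
  moreover have "\<forall>x\<in>pverts (sub_cover W) - ?T. f x = (0, 0)"
  proof
    fix x assume x: "x \<in> pverts (sub_cover W) - ?T"
    then obtain v where v: "v \<in> W" "x \<in> X v" by (auto simp: sub_cover_simps)
    then have "x \<noteq> \<phi> v" using x by blast
    then have "x \<notin> supp g v" using \<phi>(2)[OF v(1)] by blast
    then show "f x = (0, 0)" using f_zero[OF gf v(2)] by blast
  qed
  ultimately show ?thesis
    unfolding M_configuration_def sub_digraph_simps(1)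
    using sub_configuration[OF WV] is_block_sub_iff[OF WV] bic T by blast
qed

text \<open>The transversals are the classes of the matching relation, indexed by an enumeration
  \<open>e\<close> of one support. Their weights add up to \<open>card W - 1\<close> because this is
  the degree at \<open>w0\<close>.\<close>

lemma K_config:
  assumes gf: "g = weight f" and ct: "complete_type g W"
    and w0: "w0 \<in> W" "2 \<le> card (supp g w0)"
  shows "K_configuration (sub_digraph W) X (sub_cover W) f"
proof -
  let ?n = "card W" and ?p = "card (supp g w0)"
  note arc = complete_type_arc[OF ct]
  interpret D: pair_digraph "sub_digraph W" using sub_pair_digraph[OF WV] .
  have n1: "1 \<le> ?n" using w0 finite_W by (auto simp: Suc_le_eq card_gt_0_iff)
  obtain h where h: "bij_betw h {..<?n} W" using ex_bij_betw_nat_finite[OF finite_W] by (auto simp: atLeast0LessThan)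
  have "(h i, h j) \<in> parcs (sub_digraph W) \<longleftrightarrow> (i, j) \<in> parcs (bidirected_complete ?n)"
    if "i < ?n" "j < ?n" for i j
  proof -
    have m: "h i \<in> W" "h j \<in> W" "h i = h j \<longleftrightarrow> i = j"
      using h that by (auto simp: bij_betw_def inj_on_eq_iff)
    then have "A True (h i) (h j) \<longleftrightarrow> i \<noteq> j" using arc A_irrefl by metis
    then show ?thesis using m that by (simp add: sub_digraph_simps bidirected_complete_simps)
  qed
  then have iso: "digraph_iso (with_proj (sub_digraph W)) (with_proj (bidirected_complete ?n))"
    using digraph_iso_enum_iff[OF D.wf_digraph _ _ pair_wf_bidirected(1)[of ?n]] h
    by (auto simp: sub_digraph_simps(1) bidirected_complete_simps(1))
  obtain e where e: "bij_betw e {1..?p} (supp g w0)"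
    using ex_bij_betw_nat_finite_1[OF finite_supp[OF w0(1)]] by blast
  have e_mem: "e i \<in> supp g w0" if "i \<in> {1..?p}" for i using e that bij_betwE by blast
  define T where "T i = {y. \<exists>v\<in>W. y \<in> supp g v \<and> (y = e i \<or> E True (e i) y)}" for i
  have V: "w0 \<in> V" "\<And>v. v \<in> W \<Longrightarrow> v \<in> V" using w0 WV by auto
  have Tv: "\<exists>z. T i \<inter> X v = {z} \<and> z \<in> supp g v \<and> (if v = w0 then z = e i else E True (e i) z)"
    if i: "i \<in> {1..?p}" and v: "v \<in> W" for i v
  proof -
    have mem: "y \<in> T i \<inter> X v \<longleftrightarrow> y \<in> supp g v \<and> (y = e i \<or> E True (e i) y)" for y
    proof
      assume "y \<in> T i \<inter> X v"
      then obtain u where u: "u \<in> W" "y \<in> supp g u" "y = e i \<or> E True (e i) y" "y \<in> X v" by (auto simp: T_def)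
      then have "u = v" using X_disjoint[of u v y] V v supp_X by blast
      then show "y \<in> supp g v \<and> (y = e i \<or> E True (e i) y)" using u by blast
    qed (use v supp_X in \<open>auto simp: T_def\<close>)
    show ?thesis
    proof (cases "v = w0")
      case True
      have "\<not> E True (e i) y" if "y \<in> supp g w0" for y
        using E_irrefl[OF V(1)] supp_X that e_mem[OF i] by blast
      then have "T i \<inter> X v = {e i}" using mem True e_mem[OF i] by blast
      then show ?thesis using True e_mem[OF i] by auto
    next
      case False
      obtain z where z: "z \<in> supp g v" "E True (e i) z"
        using match_supp'[OF w0(1) v arc[OF w0(1) v] e_mem[OF i]] False by blast
      have ne: "e i \<notin> supp g v" using X_disjoint[OF V(1) V(2)[OF v]] supp_X e_mem[OF i] False by blast
      have uniq: "y = z" if "y \<in> supp g v" "E True (e i) y" for y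
        using E_fun[OF V(1) V(2)[OF v] supp_X[OF e_mem[OF i]] supp_X[OF that(1)] supp_X[OF z(1)] that(2) z(2)] .
      have "y \<in> T i \<inter> X v \<longleftrightarrow> y = z" for y
        unfolding mem using ne uniq[of y] z by metis
      then have "T i \<inter> X v = {z}" by blast
      then show ?thesis using False z by auto
    qed
  qed
  have Tin: "y \<in> supp g v" "if v = w0 then y = e i else E True (e i) y"
    if i: "i \<in> {1..?p}" and v: "v \<in> W" and y: "y \<in> T i" "y \<in> X v" for i v y
  proof -
    obtain z where z: "T i \<inter> X v = {z}" "z \<in> supp g v" "if v = w0 then z = e i else E True (e i) z"
      using Tv[OF i v] by blast
    moreover have "y = z" using z(1) y by blast
    ultimately show "y \<in> supp g v" "if v = w0 then y = e i else E True (e i) y" by simp_all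
  qed
  have T_sub: "T i \<subseteq> (\<Union>v\<in>W. X v)" for i unfolding T_def using supp_X by blast
  have T_owner: "\<exists>v\<in>W. y \<in> T i \<inter> X v" if "y \<in> T i" for y i using T_sub that by blast
  have trans: "transversal (sub_digraph W) X (sub_cover W) (T i)" if i: "i \<in> {1..?p}" for i
    unfolding transversal_sub_iff using T_sub Tv[OF i] by (metis card_1_singleton_iff One_nat_def)
  have sat: "saturated_subcover (sub_digraph W) X (sub_cover W) (T i)" if i: "i \<in> {1..?p}" for i
    unfolding saturated_sub_iff[OF WV trans[OF i]]
  proof (intro ballI impI)
    fix u v x y assume u: "u \<in> W" "x \<in> T i \<inter> X u" and v: "v \<in> W" "y \<in> T i \<inter> X v" and A: "A True u v"
    have uv: "u \<noteq> v" using A A_irrefl by blast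
    have x: "x \<in> supp g u" "if u = w0 then x = e i else E True (e i) x" using Tin[OF i u(1), of x] u(2) by auto
    have y: "y \<in> supp g v" "if v = w0 then y = e i else E True (e i) y" using Tin[OF i v(1), of y] v(2) by auto
    \<comment> \<open>Transitivity joins two partners of \<open>e i\<close>; if one of the two
      vertices is \<open>e i\<close> itself, symmetry is enough.\<close>
    consider "u = w0" | "v = w0" | "u \<noteq> w0" "v \<noteq> w0" by blast
    then show "E True x y"
    proof cases
      case 1
      then show ?thesis using x y uv by auto
    next
      case 2
      then have "E True y x" using x y uv by auto
      then have "E False y x" using complete_type_sym[OF ct v(1) u(1) y(1) x(1)] by blast
      then show ?thesis using E_False by blast
    next
      case 3
      then show ?thesis
        using complete_type_trans[OF ct w0(1) u(1) v(1) e_mem[OF i] x(1) y(1) uv] x y by simp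
    qed
  qed
  have val: "f y = (g True (e i), g True (e i))" if i: "i \<in> {1..?p}" and y: "y \<in> T i" for i y
  proof -
    obtain v where v: "v \<in> W" "y \<in> T i \<inter> X v" using T_owner[OF y] by blast
    then have z: "y \<in> supp g v" "if v = w0 then y = e i else E True (e i) y" using Tin[OF i v(1), of y] v(2) by auto
    have "g b y = g True (e i)" for b
    proof (cases "v = w0")
      case False
      then show ?thesis
        using complete_type_eq[OF ct w0(1) v(1) e_mem[OF i] z(1), of True True b] z(2) by simp
    next
      case True
      \<comment> \<open>That the two weights of \<open>e i\<close> agree is read off at a partner
        over another vertex.\<close>
      have "\<exists>u\<in>W. u \<noteq> w0"
        using not_singleton_if_card[of W w0] card_ge_3[OF w0] w0(1) by fastforce
      then obtain u where u: "u \<in> W" "u \<noteq> w0" by blast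
      obtain t where t: "t \<in> supp g u" "E True (e i) t"
        using match_supp'[OF w0(1) u(1) arc[OF w0(1) u(1)] e_mem[OF i]] u(2) by blast
      have "g b (e i) = g True t" "g True (e i) = g True t"
        using complete_type_eq[OF ct w0(1) u(1) e_mem[OF i] t] by blast+
      then show ?thesis using True z(2) by simp
    qed
    from this[of True] this[of False] show ?thesis by (simp add: gf weight_simps prod_eq_iff)
  qed
  have "(\<Sum>i = 1..?p. g True (e i)) = (\<Sum>x\<in>supp g w0. g True x)"
    using sum.reindex_bij_betw[OF e] .
  also have "\<dots> = (\<Sum>x\<in>X w0. g True x)"
    using finite_X[OF V(1)] by (intro sum.mono_neutral_left) (auto simp: supp_def)
  also have "\<dots> = deg True W w0" using sum_tight[OF w0(1)] .
  also have "\<dots> = ?n - 1"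
  proof -
    have "{u \<in> W. A True w0 u} = W - {w0}" using arc[OF w0(1)] A_irrefl by auto
    then show ?thesis unfolding deg_def using w0(1) finite_W by simp
  qed
  finally have sum: "(\<Sum>i = 1..?p. g True (e i)) = ?n - 1" .
  have pos: "1 \<le> g True (e i)" if i: "i \<in> {1..?p}" for i
  proof -
    have "e i \<in> T i" using e_mem[OF i] w0(1) by (auto simp: T_def)
    then have "g False (e i) = g True (e i)" using val[OF i] by (metis gf snd_conv weight_simps(2))
    moreover obtain b where "0 < g b (e i)" using e_mem[OF i] by (auto simp: supp_def)
    ultimately show ?thesis by (cases b) auto
  qed
  have disj: "disjoint_family_on T {1..?p}"
    unfolding disjoint_family_on_def
  proof (intro ballI impI)
    fix i j assume ij: "i \<in> {1..?p}" "j \<in> {1..?p}" "i \<noteq> j"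
    have "e i \<noteq> e j" using inj_onD[OF bij_betw_imp_inj_on[OF e] _ ij(1,2)] ij(3) by blast
    show "T i \<inter> T j = {}"
    proof (rule ccontr)
      assume "T i \<inter> T j \<noteq> {}"
      then obtain y where y: "y \<in> T i" "y \<in> T j" by blast
      then obtain v where v: "v \<in> W" "y \<in> X v" using T_owner by blast
      have *: "y \<in> supp g v" "if v = w0 then y = e i else E True (e i) y" "if v = w0 then y = e j else E True (e j) y"
        using Tin[OF ij(1) v(1) y(1) v(2)] Tin[OF ij(2) v(1) y(2) v(2)] by blast+
      show False
      proof (cases "v = w0")
        case False
        then have "e i = e j"
          using E_inj[OF V(1) V(2)[OF v(1)] supp_X[OF e_mem[OF ij(1)]] supp_X[OF e_mem[OF ij(2)]] v(2)] * by simp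
        then show False using \<open>e i \<noteq> e j\<close> by blast
      qed (use * \<open>e i \<noteq> e j\<close> in simp)
    qed
  qed
  have zero: "f x = (0, 0)" if x: "x \<in> pverts (sub_cover W) - (\<Union>i\<in>{1..?p}. T i)" for x
  proof -
    obtain v where v: "v \<in> W" "x \<in> X v" using x by (auto simp: sub_cover_simps)
    have "x \<notin> supp g v"
    proof
      assume xs: "x \<in> supp g v"
      have "\<exists>y\<in>supp g w0. x = y \<or> E True y x"
      proof (cases "v = w0")
        case False
        then have "A True w0 v" using arc[OF w0(1) v(1)] by simp
        then show ?thesis using match_supp[OF v(1) w0(1) _ xs] by blast
      qed (use xs in blast)
      then obtain y where y: "y \<in> supp g w0" "x = y \<or> E True y x" by blast
      then obtain i where "i \<in> {1..?p}" "y = e i"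
        using y(1) bij_betw_imp_surj_on[OF e] by blast
      then have "x \<in> T i" using y v xs by (auto simp: T_def)
      then show False using x \<open>i \<in> {1..?p}\<close> by blast
    qed
    then show ?thesis using f_zero[OF gf v(2)] by blast
  qed
  have p1: "1 \<le> ?p" using w0(2) by simp
  show ?thesis
    unfolding K_configuration_def
  proof (rule conjI[OF sub_configuration[OF WV]], rule exI[of _ ?n], rule conjI[OF n1],
      rule conjI[OF iso], rule exI[of _ ?p], rule conjI[OF p1],
      rule exI[of _ "\<lambda>i. g True (e i)"], rule exI[of _ T], intro conjI ballI)
    show "(\<Sum>i = 1..?p. g True (e i)) = ?n - 1" by (rule sum)
    show "disjoint_family_on T {1..?p}" by (rule disj)
    fix i assume i: "i \<in> {1..?p}"
    show "1 \<le> g True (e i)" by (rule pos[OF i])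
    show "transversal (sub_digraph W) X (sub_cover W) (T i)" by (rule trans[OF i])
    show "saturated_subcover (sub_digraph W) X (sub_cover W) (T i)" by (rule sat[OF i])
    show "f x = (g True (e i), g True (e i))" if "x \<in> T i" for x by (rule val[OF i that])
  next
    show "f x = (0, 0)" if "x \<in> pverts (sub_cover W) - (\<Union>i\<in>{1..?p}. T i)" for x
      by (rule zero[OF that])
  qed
qed

end

lemma digraph_iso_symmetric_enum_iff:
  assumes G: "wf_digraph G" "tail G = fst" "head G = snd"
  shows "digraph_iso (with_proj (mk_symmetric G)) (with_proj (bidirected_cycle m)) \<longleftrightarrow>
    (\<exists>v. bij_betw v {..<m} (verts G) \<and>
      (\<forall>i<m. \<forall>j<m. (v i, v j) \<in> arcs G \<or> (v j, v i) \<in> arcs G \<longleftrightarrow> i \<noteq> j \<and> (j = Suc i mod m \<or> i = Suc j mod m)))"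
proof -
  interpret S: pair_wf_digraph "mk_symmetric G" using wf_digraph.wellformed_mk_symmetric[OF G(1)] .
  have arcs: "(x, y) \<in> parcs (mk_symmetric G) \<longleftrightarrow> (x, y) \<in> arcs G \<or> (y, x) \<in> arcs G" for x y
  proof
    assume "(x, y) \<in> arcs G \<or> (y, x) \<in> arcs G"
    then show "(x, y) \<in> parcs (mk_symmetric G)"
      unfolding parcs_mk_symmetric G by (elim disjE) (rule UN_I, assumption, simp)+
  qed (auto simp: parcs_mk_symmetric G)
  show ?thesis
    unfolding digraph_iso_enum_iff[OF S.wf_digraph with_proj_simps(4,5) pair_wf_bidirected(2)]
    by (simp add: arcs bidirected_cycle_simps Ball_def)
qed

context critical_cycle
begin

text \<open>If every vertex has arcs in both directions, all edges are digons, and the parity of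
  \<open>n\<close> decides between two disjoint cycles of equal labels and one long cycle. If some
  vertex lacks a direction, all do, and sources and sinks alternate.\<close>

lemma cycle_config:
  assumes gf: "g = weight f" and n4: "4 \<le> n"
  shows "odd_C_configuration (sub_digraph W) X (sub_cover W) f \<or>
    even_C_configuration (sub_digraph W) X (sub_cover W) f \<or>
    A_configuration (sub_digraph W) X (sub_cover W) f"
proof -
  interpret D: pair_digraph "sub_digraph W" using sub_pair_digraph[OF WV] .
  have bij: "bij_betw v {..<n} W" using cyc by (simp add: cycle_enum_def)
  obtain s :: "nat \<Rightarrow> bool \<Rightarrow> 'b" where lab: "\<forall>i<n. supp g (v i) = {s i True, s i False}"
    "\<forall>i<n. s i True \<noteq> s i False"
    "\<forall>i b c c'. Suc i < n \<longrightarrow> A b (v i) (v (Suc i)) \<longrightarrow> (E b (s i c) (s (Suc i) c') \<longleftrightarrow> c = c')"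
    "\<forall>b c c'. A b (v (n - 1)) (v 0) \<longrightarrow> (E b (s (n - 1) c) (s 0 c') \<longleftrightarrow> (c = c') = odd n)"
    using labels by (elim exE conjE) (rule that)
  have V: "v i \<in> V" if "i < n" for i using v_W[OF that] WV by blast
  have s_supp: "s i c \<in> supp g (v i)" if "i < n" for i c using lab(1) that by (cases c) auto
  have s_X: "s i c \<in> X (v i)" if "i < n" for i c using s_supp[OF that] by (rule supp_X)
  have s_eq: "s i c = s j d \<longleftrightarrow> i = j \<and> c = d" if "i < n" "j < n" for i j c d
  proof
    assume eq: "s i c = s j d"
    have "v i = v j" using X_disjoint[OF V[OF that(1)] V[OF that(2)] s_X[OF that(1), of c]] s_X[OF that(2), of d] eq by simp
    then have "i = j" using v_eq that by blast
    then show "i = j \<and> c = d" using eq lab(2) that by (cases c; cases d) auto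
  qed simp
  define T where "T c = (\<lambda>i. s i c) ` {..<n}" for c
  have TX: "x = s i c" if x: "x \<in> T c" "x \<in> X (v i)" and i: "i < n" for x c i
  proof -
    obtain j where j: "j < n" "x = s j c" using x(1) by (auto simp: T_def)
    then have "v j = v i" using X_disjoint[OF V[OF j(1)] V[OF i] s_X[OF j(1), of c]] x(2) by simp
    then show ?thesis using j i v_eq by simp
  qed
  have trans: "transversal (sub_digraph W) X (sub_cover W) (T c)" for c
    unfolding transversal_choice[OF WV]
  proof (intro exI[of _ "\<lambda>w. s (inv_into {..<n} v w) c"] conjI ballI)
    have inv: "inv_into {..<n} v w < n" "v (inv_into {..<n} v w) = w" if "w \<in> W" for w
      using that bij inv_into_into[of w v "{..<n}"] f_inv_into_f[of w v "{..<n}"] by (auto simp: bij_betw_def)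
    show "s (inv_into {..<n} v w) c \<in> X w" if "w \<in> W" for w using s_X[OF inv(1)[OF that]] inv(2)[OF that] by simp
    have img: "inv_into {..<n} v ` W = {..<n}"
      using bij_betw_inv_into[OF bij] by (simp add: bij_betw_def)
    have "(\<lambda>w. s (inv_into {..<n} v w) c) ` W = (\<lambda>i. s i c) ` (inv_into {..<n} v ` W)"
      by (simp add: image_image)
    then show "T c = (\<lambda>w. s (inv_into {..<n} v w) c) ` W" unfolding T_def img by (rule sym)
  qed
  have T_disj: "T True \<inter> T False = {}" using s_eq by (auto simp: T_def)
  have supp_T: "x \<in> T True \<union> T False \<longleftrightarrow> x \<in> supp g w" if w: "w \<in> W" "x \<in> X w" for x w
  proof -
    obtain i where i: "i < n" "w = v i" using cycle_enum_surj[OF cyc w(1)] .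
    have mem: "s i True \<in> T True" "s i False \<in> T False" using i(1) by (auto simp: T_def)
    have S: "supp g w = {s i True, s i False}" using lab(1) i by simp
    show ?thesis
    proof
      assume "x \<in> T True \<union> T False"
      then have "x = s i True \<or> x = s i False" using TX[of x True i] TX[of x False i] w(2) i by blast
      then show "x \<in> supp g w" unfolding S by blast
    next
      assume "x \<in> supp g w"
      then show "x \<in> T True \<union> T False" unfolding S using mem by blast
    qed
  qed
  have zero: "f x = (0, 0)" if x: "x \<in> pverts (sub_cover W) - (T True \<union> T False)" for x
  proof -
    obtain w where w: "w \<in> W" "x \<in> X w" using x by (auto simp: sub_cover_simps)
    then show ?thesis using supp_T[OF w] f_zero[OF gf w(2)] x by blast
  qed
  have T_sub: "T c \<subseteq> (\<Union>w\<in>W. X w)" for c using s_X v_W by (auto simp: T_def)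
  have T_owner: "\<exists>w\<in>W. x \<in> X w \<and> x \<in> supp g w" if "x \<in> T True \<union> T False" for x
    using T_sub supp_T that by blast
  have E_step: "E b (s i c) (s j c') \<longleftrightarrow> (c = c') = (Suc i < n \<or> odd n)"
    if i: "i < n" and j: "j = Suc i mod n" and A: "A b (v i) (v j)" for b i j c c'
  proof (cases "Suc i < n")
    case True
    then show ?thesis using lab(3) j A by simp
  next
    case False
    then have "Suc i = n" using i by simp
    then have "i = n - 1" "j = 0" using j by auto
    then show ?thesis using lab(4) A False by simp
  qed
  have E_nb: "nb (v i) (v j)" if "i < n" "j < n" "E b (s i c) (s j c')" for i j b c c'
    using E_A[OF V[OF that(1)] V[OF that(2)] s_X[OF that(1)] s_X[OF that(2)] that(3)] by (auto simp: nb_def)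
  have some_active: "\<exists>b. \<exists>u\<in>W. A b w u" if w: "w \<in> W" for w
  proof -
    have "W \<noteq> {w}" using two[OF w] card_ge_3[OF w] not_singleton_if_card[of W w] by auto
    then obtain u where "u \<in> W" "nb w u" using conn_neighbour[OF W_conn w] by blast
    then show ?thesis by (auto simp: nb_def)
  qed
  \<comment> \<open>Two rounds of the cycle, with label \<open>True\<close> on the first and
    \<open>False\<close> on the second. For even \<open>n\<close> the closing edge swaps the labels,
    which makes this the long cycle.\<close>
  define t where "t k = s (k mod n) (k < n)" for k
  have modn: "k mod n = (if k < n then k else k - n)" if "k < 2 * n" for k
    using that by (simp add: le_mod_geq)
  have tT: "bij_betw t {..<2 * n} (T True \<union> T False)"
  proof -
    have "inj_on t {..<2 * n}"
    proof (rule inj_onI)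
      fix k l assume kl: "k \<in> {..<2 * n}" "l \<in> {..<2 * n}" "t k = t l"
      then have *: "k mod n = l mod n" "k < n \<longleftrightarrow> l < n" using s_eq n4 by (auto simp: t_def)
      show "k = l"
      proof (cases "k < n")
        case False
        then have "k mod n = k - n" "l mod n = l - n" using kl * modn by auto
        then show ?thesis using * False by simp
      qed (use * in simp)
    qed
    moreover have "t ` {..<2 * n} = T True \<union> T False"
    proof (intro equalityI subsetI)
      fix x assume "x \<in> T True \<union> T False"
      then obtain i c where "i < n" "x = s i c" by (auto simp: T_def)
      then have "x = t (if c then i else i + n)" "(if c then i else i + n) < 2 * n" by (auto simp: t_def)
      then show "x \<in> t ` {..<2 * n}" by blast
    next
      fix x assume "x \<in> t ` {..<2 * n}"
      then obtain k where "x = s (k mod n) (k < n)" by (auto simp: t_def)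
      moreover have "k mod n < n" using n4 by simp
      ultimately show "x \<in> T True \<union> T False" unfolding T_def by (cases "k < n") auto
    qed
    ultimately show ?thesis by (simp add: bij_betw_def)
  qed
  \<comment> \<open>For even \<open>n\<close> the label changes exactly at the closing edge, and
    \<open>t\<close> changes it at \<open>k = n - 1\<close> and at
    \<open>k = 2 * n - 1\<close>.\<close>
  have t_step: "E b (t k) (t l) \<longleftrightarrow> l = Suc k mod (2 * n)"
    if ev: "even n" and k: "k < 2 * n" "l < 2 * n" and step: "l mod n = Suc (k mod n) mod n"
      and A: "A b (v (k mod n)) (v (l mod n))" for b k l
  proof -
    have "E b (t k) (t l) \<longleftrightarrow> ((k < n) = (l < n)) = (Suc (k mod n) < n)"
      unfolding t_def using E_step[OF _ step A, of "k < n" "l < n"] ev n4 by simp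
    also have "\<dots> \<longleftrightarrow> l = Suc k mod (2 * n)"
    proof -
      have km: "k mod n = (if k < n then k else k - n)" "l mod n = (if l < n then l else l - n)"
        using k modn by blast+
      have S2: "Suc k mod (2 * n) = (if Suc k = 2 * n then 0 else Suc k)" using k by simp
      have S1: "Suc (k mod n) mod n = (if Suc (k mod n) = n then 0 else Suc (k mod n))"
        using n4 mod_less_divisor[of n k] by (auto simp: mod_Suc)
      show ?thesis using step k n4 unfolding S1 S2 unfolding km by (cases "k < n"; cases "l < n") auto
    qed
    finally show ?thesis .
  qed
  have t_E: "E b (t k) (t l) \<longleftrightarrow>
      A b (v (k mod n)) (v (l mod n)) \<and> (l = Suc k mod (2 * n) \<or> k = Suc l mod (2 * n))"
    if ev: "even n" and k: "k < 2 * n" "l < 2 * n" for b k l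
  proof -
    have mn: "k mod n < n" "l mod n < n" using n4 by auto
    have proj: "b mod n = Suc (a mod n) mod n" if "b = Suc a mod (2 * n)" for a b
      using that by (simp add: mod_mod_cancel mod_Suc_eq)
    show ?thesis
    proof
      assume E: "E b (t k) (t l)"
      have A: "A b (v (k mod n)) (v (l mod n))"
        using E_A[OF V[OF mn(1)] V[OF mn(2)] s_X[OF mn(1)] s_X[OF mn(2)]] E unfolding t_def by blast
      have A': "A (\<not> b) (v (l mod n)) (v (k mod n))" and E': "E (\<not> b) (t l) (t k)"
        using A E by (simp_all add: A_flip E_flip)
      have "nb (v (k mod n)) (v (l mod n))" using A by (auto simp: nb_def)
      then consider "l mod n = Suc (k mod n) mod n" | "k mod n = Suc (l mod n) mod n"
        using nb_iff[OF mn] by blast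
      then have "l = Suc k mod (2 * n) \<or> k = Suc l mod (2 * n)"
      proof cases
        case 1
        then show ?thesis using t_step[OF ev k 1 A] E by blast
      next
        case 2
        then show ?thesis using t_step[OF ev k(2,1) 2 A'] E' by blast
      qed
      then show "A b (v (k mod n)) (v (l mod n)) \<and> (l = Suc k mod (2 * n) \<or> k = Suc l mod (2 * n))" using A by blast
    next
      assume *: "A b (v (k mod n)) (v (l mod n)) \<and> (l = Suc k mod (2 * n) \<or> k = Suc l mod (2 * n))"
      then have A: "A b (v (k mod n)) (v (l mod n))" "A (\<not> b) (v (l mod n)) (v (k mod n))" by (simp_all add: A_flip)
      consider "l = Suc k mod (2 * n)" | "k = Suc l mod (2 * n)" using * by blast
      then show "E b (t k) (t l)"
      proof cases
        case 1
        then show ?thesis using t_step[OF ev k proj[OF 1] A(1)] by blast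
      next
        case 2
        then show ?thesis using t_step[OF ev k(2,1) proj[OF 2] A(2)] by (simp add: E_flip)
      qed
    qed
  qed
  have t_nb: "nb (v (k mod n)) (v (l mod n))" if "l = Suc k mod (2 * n) \<or> k = Suc l mod (2 * n)" for k l
  proof -
    have "l mod n = Suc (k mod n) mod n \<or> k mod n = Suc (l mod n) mod n"
      using that by (auto simp: mod_mod_cancel mod_Suc_eq)
    then show ?thesis using nb_iff[of "k mod n" "l mod n"] n4 by simp
  qed
  have t_neq: "k \<noteq> l" if "l = Suc k mod (2 * n) \<or> k = Suc l mod (2 * n)" for k l
    using t_nb[OF that] adj_irrefl by blast
  let ?H = "with_proj (sub_cover W) \<restriction> (T True \<union> T False)"
  have wfH: "wf_digraph ?H" "tail ?H = fst" "head ?H = snd" by (unfold_locales; simp) simp_all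
  have arcsH: "(t k, t l) \<in> arcs ?H \<longleftrightarrow> E True (t k) (t l)" if "k < 2 * n" "l < 2 * n" for k l
  proof -
    have "t k \<in> T True \<union> T False" "t l \<in> T True \<union> T False" using that bij_betwE[OF tT] by auto
    moreover then have "t k \<in> (\<Union>w\<in>W. X w)" "t l \<in> (\<Union>w\<in>W. X w)" using T_sub by blast+
    ultimately show ?thesis by (simp add: sub_cover_simps)
  qed
  show ?thesis
  proof (cases "\<forall>w\<in>W. \<forall>b. \<exists>u\<in>W. A b w u")
    case True
    have dig: "A b w u \<longleftrightarrow> nb w u" if wu: "w \<in> W" "u \<in> W" for b w u
    proof
      assume "nb w u"
      moreover obtain u' where "u' \<in> W" "A b w u'" using True wu by blast
      ultimately show "A b w u" using active(3)[OF wu(1) _ _ wu(2)] by blast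
    qed (auto simp: nb_def)
    have one: "f x = (1, 1)" if x: "x \<in> T True \<union> T False" for x
    proof -
      obtain w where w: "w \<in> W" "x \<in> supp g w" using T_owner[OF x] by blast
      have "g b x = 1" for b using g_value[OF w, of b] True w(1) by simp
      from this[of True] this[of False] show ?thesis by (simp add: gf weight_simps prod_eq_iff)
    qed
    have iso: "digraph_iso (with_proj (sub_digraph W)) (with_proj (bidirected_cycle n))"
    proof -
      have "(v i, v j) \<in> parcs (sub_digraph W) \<longleftrightarrow> (i, j) \<in> parcs (bidirected_cycle n)" if "i < n" "j < n" for i j
      proof -
        have "A True (v i) (v j) \<longleftrightarrow> nb (v i) (v j)" using dig v_W that by blast
        moreover have "nb (v i) (v j) \<Longrightarrow> i \<noteq> j" using adj_irrefl by blast
        ultimately show ?thesis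
          using nb_iff[OF that] v_W that by (auto simp: sub_digraph_simps bidirected_cycle_simps)
      qed
      then show ?thesis
        using digraph_iso_enum_iff[OF D.wf_digraph _ _ pair_wf_bidirected(2)[of n]] bij
        by (auto simp: sub_digraph_simps(1) bidirected_cycle_simps(1))
    qed
    show ?thesis
    proof (cases "odd n")
      case odd: True
      have sat: "saturated_subcover (sub_digraph W) X (sub_cover W) (T c)" for c
        unfolding saturated_sub_iff[OF WV trans]
      proof (intro ballI impI)
        fix u w x y assume u: "u \<in> W" "x \<in> T c \<inter> X u" and w: "w \<in> W" "y \<in> T c \<inter> X w" and A: "A True u w"
        obtain i where i: "i < n" "u = v i" using cycle_enum_surj[OF cyc u(1)] .
        obtain j where j: "j < n" "w = v j" using cycle_enum_surj[OF cyc w(1)] .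
        have xy: "x = s i c" "y = s j c" using TX u w i j by auto
        have "nb (v i) (v j)" using A i j by (auto simp: nb_def)
        then consider "j = Suc i mod n" | "i = Suc j mod n" using nb_iff[OF i(1) j(1)] by blast
        then show "E True x y"
        proof cases
          case 1
          then show ?thesis using E_step[OF i(1) 1, of True c c] A odd xy i j by simp
        next
          case 2
          have "A False (v j) (v i)" using A i j A_False by simp
          then have "E False y x" using E_step[OF j(1) 2, of False c c] odd xy by simp
          then show ?thesis using E_False by blast
        qed
      qed
      have "5 \<le> n" using odd n4 by (cases "n = 4") auto
      then have "odd_C_configuration (sub_digraph W) X (sub_cover W) f"
        unfolding odd_C_configuration_def
        using sub_configuration[OF WV] iso odd trans T_disj sat one zero by blast
      then show ?thesis by blast
    next
      case False
      then have ev: "even n" by simp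
      have "(t k, t l) \<in> arcs ?H \<longleftrightarrow> (k, l) \<in> parcs (bidirected_cycle (2 * n))" if k: "k < 2 * n" "l < 2 * n" for k l
      proof -
        have "k mod n < n" "l mod n < n" using n4 by auto
        then have "E True (t k) (t l) \<longleftrightarrow> l = Suc k mod (2 * n) \<or> k = Suc l mod (2 * n)"
          using t_E[OF ev k, of True] t_nb[of l k] dig[of "v (k mod n)" "v (l mod n)" True] v_W by blast
        then show ?thesis using arcsH[OF k] t_neq[of l k] k by (auto simp: bidirected_cycle_simps)
      qed
      then have "digraph_iso ?H (with_proj (bidirected_cycle (2 * n)))"
        using digraph_iso_enum_iff[OF wfH pair_wf_bidirected(2)[of "2 * n"]] tT
        by (auto simp: bidirected_cycle_simps(1))
      then have "even_C_configuration (sub_digraph W) X (sub_cover W) f"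
        unfolding even_C_configuration_def
        using sub_configuration[OF WV] n4 ev iso trans T_disj one zero by blast
      then show ?thesis by blast
    qed
  next
    case False
    \<comment> \<open>By \<open>active\<close>, having both directions spreads along edges, so one
      exceptional vertex makes all vertices exceptional.\<close>
    have notboth: "\<exists>b. \<forall>u\<in>W. \<not> A b w u" if w: "w \<in> W" for w
    proof (rule ccontr)
      assume both: "\<not> ?thesis"
      let ?P = "{w \<in> W. \<forall>b. \<exists>u\<in>W. A b w u}"
      have "w \<in> ?P" using both w by blast
      moreover have "?P \<noteq> W" using False by blast
      ultimately obtain a a' where a: "a \<in> ?P" "a' \<in> W - ?P" "nb a a'"
        using conn_cut[OF W_conn, of ?P] by blast
      have "A b a a'" for b using active(3)[of a _ b a'] a by blast
      then have "A b a' a" for b using A_flip[of b a a'] by simp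
      then show False using a by blast
    qed
    have excl: "(\<exists>u\<in>W. A False w u) \<longleftrightarrow> \<not> (\<exists>u\<in>W. A True w u)" if w: "w \<in> W" for w
      using some_active[OF w] notboth[OF w] by (metis (full_types))
    let ?act = "\<lambda>i. \<exists>u\<in>W. A True (v i) u"
    \<comment> \<open>An arc out of \<open>v i\<close> enters its successor, and every vertex has
      one direction only. Being active thus alternates around the cycle, which forces
      \<open>n\<close> to be even.\<close>
    have flip: "?act (Suc i mod n) \<longleftrightarrow> \<not> ?act i" if i: "i < n" for i
    proof -
      have j: "Suc i mod n < n" using n4 by simp
      have nb: "nb (v i) (v (Suc i mod n))" using nb_iff[OF i j] by blast
      show ?thesis
      proof
        assume "?act (Suc i mod n)"
        then have "A True (v (Suc i mod n)) (v i)"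
          using active(3)[OF v_W[OF j] _ _ v_W[OF i]] adj_sym[OF nb] by blast
        then have "A False (v i) (v (Suc i mod n))" using A_False by blast
        then show "\<not> ?act i" using excl[OF v_W[OF i]] v_W[OF j] by blast
      next
        assume "\<not> ?act i"
        then obtain u where "u \<in> W" "A False (v i) u" using excl[OF v_W[OF i]] by blast
        then have "A False (v i) (v (Suc i mod n))" using active(3)[OF v_W[OF i] _ _ v_W[OF j] nb] by blast
        then show "?act (Suc i mod n)" using A_False v_W[OF i] by blast
      qed
    qed
    have par: "?act i \<longleftrightarrow> (?act 0 = even i)" if "i < n" for i
      using that
    proof (induction i)
      case (Suc i)
      then show ?case using flip[of i] by auto
    qed simp
    have ev: "even n"
      using flip[of "n - 1"] par[of "n - 1"] n4 by auto
    have src: "is_source (with_proj (sub_digraph W)) w \<longleftrightarrow> w \<in> W \<and> (\<forall>u\<in>W. \<not> A False w u)" for w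
      using degree_pair_sub[of w W] deg_pos_iff[OF finite_W, of False w]
      by (auto simp: is_source_def sub_digraph_simps degree_pair_def)
    have snk: "is_sink (with_proj (sub_digraph W)) w \<longleftrightarrow> w \<in> W \<and> (\<forall>u\<in>W. \<not> A True w u)" for w
      using degree_pair_sub[of w W] deg_pos_iff[OF finite_W, of True w]
      by (auto simp: is_sink_def sub_digraph_simps degree_pair_def)
    have antiD: "antidirected_cycle n (with_proj (sub_digraph W))"
      unfolding antidirected_cycle_def
    proof (intro conjI ballI)
      show "3 \<le> n" by (rule n3)
      show "is_source (with_proj (sub_digraph W)) w \<or> is_sink (with_proj (sub_digraph W)) w"
        if "w \<in> verts (with_proj (sub_digraph W))" for w
        using that excl[of w] unfolding src snk by (auto simp: sub_digraph_simps)
      have "(v i, v j) \<in> parcs (sub_digraph W) \<or> (v j, v i) \<in> parcs (sub_digraph W) \<longleftrightarrow>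
          i \<noteq> j \<and> (j = Suc i mod n \<or> i = Suc j mod n)" if "i < n" "j < n" for i j
      proof -
        have "(v i, v j) \<in> parcs (sub_digraph W) \<or> (v j, v i) \<in> parcs (sub_digraph W) \<longleftrightarrow> nb (v i) (v j)"
          using v_W that by (auto simp: sub_digraph_simps nb_def ex_bool_eq A_False)
        moreover have "nb (v i) (v j) \<Longrightarrow> i \<noteq> j" using adj_irrefl by blast
        ultimately show ?thesis using nb_iff[OF that] by blast
      qed
      then show "digraph_iso (with_proj (mk_symmetric (with_proj (sub_digraph W)))) (with_proj (bidirected_cycle n))"
        using digraph_iso_symmetric_enum_iff[OF D.wf_digraph, of n] bij
        by (auto simp: sub_digraph_simps(1))
    qed
    have antiH: "antidirected_cycle (2 * n) ?H"
      unfolding antidirected_cycle_def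
    proof (intro conjI ballI)
      show "3 \<le> 2 * n" using n4 by simp
      show "is_source ?H x \<or> is_sink ?H x" if x: "x \<in> verts ?H" for x
      proof -
        have xT: "x \<in> T True \<union> T False" using x by simp
        then obtain w where w: "w \<in> W" "x \<in> X w" using T_owner by blast
        have noE: "\<not> E b x y" if "\<forall>u\<in>W. \<not> A b w u" "y \<in> T True \<union> T False" for b y
        proof
          assume e: "E b x y"
          obtain u where u: "u \<in> W" "y \<in> X u" using T_owner \<open>y \<in> T True \<union> T False\<close> by blast
          show False using E_A[of w u x y b] w u e WV that by blast
        qed
        obtain b where b: "\<forall>u\<in>W. \<not> A b w u" using notboth[OF w(1)] by blast
        show ?thesis
        proof (cases b)
          case True
          then have "\<forall>u\<in>W. \<not> A True w u" using b by simp
          from noE[OF this] have "{y \<in> T True \<union> T False. (x, y) \<in> parcs (sub_cover W)} = {}"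
            unfolding sub_cover_simps by blast
          then have "out_degree ?H x = 0" unfolding out_degree_induce[OF xT] by (simp only: card.empty)
          then show ?thesis using x by (simp add: is_sink_def)
        next
          case False
          then have "\<forall>u\<in>W. \<not> A False w u" using b by simp
          from noE[OF this] have "{y \<in> T True \<union> T False. (y, x) \<in> parcs (sub_cover W)} = {}"
            unfolding sub_cover_simps E_False by blast
          then have "in_degree ?H x = 0" unfolding in_degree_induce[OF xT] by (simp only: card.empty)
          then show ?thesis using x by (simp add: is_source_def)
        qed
      qed
      have "(t k, t l) \<in> arcs ?H \<or> (t l, t k) \<in> arcs ?H \<longleftrightarrow>
          k \<noteq> l \<and> (l = Suc k mod (2 * n) \<or> k = Suc l mod (2 * n))" if k: "k < 2 * n" "l < 2 * n" for k l
      proof -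
        have "(t k, t l) \<in> arcs ?H \<or> (t l, t k) \<in> arcs ?H \<longleftrightarrow> (\<exists>b. E b (t k) (t l))"
          using arcsH k E_False by (auto simp: ex_bool_eq)
        also have "\<dots> \<longleftrightarrow> k \<noteq> l \<and> (l = Suc k mod (2 * n) \<or> k = Suc l mod (2 * n))"
          using t_E[OF ev k] t_nb[of l k] t_neq[of l k] unfolding nb_def by blast
        finally show ?thesis .
      qed
      then show "digraph_iso (with_proj (mk_symmetric ?H)) (with_proj (bidirected_cycle (2 * n)))"
        using digraph_iso_symmetric_enum_iff[OF wfH, of "2 * n"] tT by auto
    qed
    have fval: "(x \<in> T True \<union> T False \<and> is_source (with_proj (sub_digraph W)) w \<longrightarrow> f x = (1, 0)) \<and>
        (x \<in> T True \<union> T False \<and> is_sink (with_proj (sub_digraph W)) w \<longrightarrow> f x = (0, 1)) \<and>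
        (x \<notin> T True \<union> T False \<longrightarrow> f x = (0, 0))" if w: "w \<in> W" "x \<in> X w" for w x
    proof (intro conjI impI)
      assume "x \<notin> T True \<union> T False"
      then show "f x = (0, 0)" using zero w by (auto simp: sub_cover_simps)
    next
      assume *: "x \<in> T True \<union> T False \<and> is_source (with_proj (sub_digraph W)) w"
      then have xs: "x \<in> supp g w" using supp_T[OF w] by blast
      have "g True x = 1" "g False x = 0"
        using g_value[OF w(1) xs] excl[OF w(1)] * unfolding src by auto
      then show "f x = (1, 0)" by (simp add: gf weight_simps prod_eq_iff)
    next
      assume *: "x \<in> T True \<union> T False \<and> is_sink (with_proj (sub_digraph W)) w"
      then have xs: "x \<in> supp g w" using supp_T[OF w] by blast
      have "g True x = 0" "g False x = 1"
        using g_value[OF w(1) xs] excl[OF w(1)] * unfolding snk by auto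
      then show "f x = (0, 1)" by (simp add: gf weight_simps prod_eq_iff)
    qed
    have "A_configuration (sub_digraph W) X (sub_cover W) f"
      unfolding A_configuration_def sub_digraph_simps(1)
      using sub_configuration[OF WV] n4 ev antiD antiH trans T_disj fval
      by (intro conjI exI[of _ n] exI[of _ "T True"] exI[of _ "T False"] ballI) blast+
    then show ?thesis by blast
  qed
qed

end

section \<open>Merging at a cut vertex and the induction that constructs the configuration\<close>

context cover_system
begin

lemma weight_pair: "weight (\<lambda>x. (g True x, g False x)) = g"
  by (intro ext) (simp add: weight_def)

text \<open>The two parts share exactly \<open>c\<close> and its fibre, so identity maps serve for
  the identification. No arc of the base crosses between the sides, hence none of the cover
  does.\<close>

lemma merging_sub:
  assumes W: "W \<subseteq> V" and un: "W1 \<union> W2 = W" and int: "W1 \<inter> W2 = {c}"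
    and sep: "\<And>u v. u \<in> W1 - {c} \<Longrightarrow> v \<in> W2 - {c} \<Longrightarrow> \<not> nb u v"
    and f: "\<And>x. x \<in> X c \<Longrightarrow> f x = f1 x + f2 x"
      "\<And>v x. v \<in> W1 - {c} \<Longrightarrow> x \<in> X v \<Longrightarrow> f x = f1 x"
      "\<And>v x. v \<in> W2 - {c} \<Longrightarrow> x \<in> X v \<Longrightarrow> f x = f2 x"
  shows "merging (sub_digraph W1) X (sub_cover W1) f1 (sub_digraph W2) X (sub_cover W2) f2
    (sub_digraph W) X (sub_cover W) f"
proof -
  have c: "c \<in> W1" "c \<in> W2" using int by auto
  have same: "u \<in> W1 \<and> v \<in> W1 \<or> u \<in> W2 \<and> v \<in> W2" if "u \<in> W" "v \<in> W" "A b u v" for u v b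
  proof (rule ccontr)
    assume no: "\<not> ?thesis"
    have "nb u v" "nb v u" using that(3) adj_sym by (auto simp: nb_def)
    moreover have "u \<noteq> c" "v \<noteq> c" using no that un c by auto
    ultimately show False using no that un sep by blast
  qed
  have idD: "identification (\<lambda>u. u) (sub_digraph W1) (\<lambda>u. u) (sub_digraph W2) {(c, c)} (sub_digraph W)"
    unfolding identification_def sub_digraph_simps(1)
  proof (intro conjI ballI)
    show "x = y \<longleftrightarrow> (x, y) \<in> {(c, c)}" if "x \<in> W1" "y \<in> W2" for x y
      using that int by blast
    have "e \<in> parcs (sub_digraph W) \<longleftrightarrow> e \<in> parcs (sub_digraph W1) \<union> parcs (sub_digraph W2)" for e
      using same un by (cases e) (auto simp: sub_digraph_simps)
    then have "parcs (sub_digraph W) = parcs (sub_digraph W1) \<union> parcs (sub_digraph W2)" by blast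
    then show "parcs (sub_digraph W) = map_prod (\<lambda>u. u) (\<lambda>u. u) ` parcs (sub_digraph W1) \<union>
        map_prod (\<lambda>u. u) (\<lambda>u. u) ` parcs (sub_digraph W2)"
      by (simp add: map_prod.identity[unfolded id_def])
  qed (use un in auto)
  have idH: "identification (\<lambda>x. x) (sub_cover W1) (\<lambda>x. x) (sub_cover W2) {(x, x) | x. x \<in> X c} (sub_cover W)"
    unfolding identification_def sub_cover_simps(1)
  proof (intro conjI ballI)
    show "x = y \<longleftrightarrow> (x, y) \<in> {(x, x) | x. x \<in> X c}" if xy: "x \<in> (\<Union>v\<in>W1. X v)" "y \<in> (\<Union>v\<in>W2. X v)" for x y
    proof
      assume "x = y"
      then obtain u v where uv: "u \<in> W1" "v \<in> W2" "x \<in> X u" "x \<in> X v" using xy by blast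
      then have "u = v" using X_disjoint[of u v x] W un by blast
      then have "u = c" using uv int by blast
      then show "(x, y) \<in> {(x, x) | x. x \<in> X c}" using uv \<open>x = y\<close> by blast
    qed blast
    have "e \<in> parcs (sub_cover W) \<longleftrightarrow> e \<in> parcs (sub_cover W1) \<union> parcs (sub_cover W2)" for e
    proof
      assume e: "e \<in> parcs (sub_cover W)"
      obtain x y where xy: "e = (x, y)" by (cases e)
      then obtain u v where uv: "u \<in> W" "v \<in> W" "x \<in> X u" "y \<in> X v" "E True x y"
        using e by (auto simp: sub_cover_simps)
      have "A True u v" using E_A[OF _ _ uv(3-5)] uv(1,2) W by blast
      then have "u \<in> W1 \<and> v \<in> W1 \<or> u \<in> W2 \<and> v \<in> W2" using same uv(1,2) by blast
      then show "e \<in> parcs (sub_cover W1) \<union> parcs (sub_cover W2)"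
        using uv xy by (auto simp: sub_cover_simps)
    next
      assume "e \<in> parcs (sub_cover W1) \<union> parcs (sub_cover W2)"
      then show "e \<in> parcs (sub_cover W)" using un by (cases e) (auto simp: sub_cover_simps)
    qed
    then have "parcs (sub_cover W) = parcs (sub_cover W1) \<union> parcs (sub_cover W2)" by blast
    then show "parcs (sub_cover W) = map_prod (\<lambda>u. u) (\<lambda>u. u) ` parcs (sub_cover W1) \<union>
        map_prod (\<lambda>u. u) (\<lambda>u. u) ` parcs (sub_cover W2)"
      by (simp add: map_prod.identity[unfolded id_def])
  qed (use un in auto)
  have rest: "\<exists>v\<in>Wi - {c}. x \<in> X v" if "x \<in> (\<Union>v\<in>Wi. X v) - X c" for x Wi using that by blast
  show ?thesis
    unfolding merging_def sub_digraph_simps(1) sub_cover_simps(1)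
  proof (rule exI[of _ c], rule exI[of _ c], rule exI[of _ "\<lambda>x. x"], rule exI[of _ "\<lambda>u. u"],
      rule exI[of _ "\<lambda>u. u"], rule exI[of _ "\<lambda>x. x"], rule exI[of _ "\<lambda>x. x"], intro conjI ballI)
    show "bij_betw (\<lambda>x. x) (X c) (X c)" by (simp add: bij_betw_def)
    show "f x = f1 x" if "x \<in> (\<Union>v\<in>W1. X v) - X c" for x using rest[OF that] f(2) by blast
    show "f x = f2 x" if "x \<in> (\<Union>v\<in>W2. X v) - X c" for x using rest[OF that] f(3) by blast
    show "f x = f1 x + f2 x" if "x \<in> X c" for x using f(1) that .
  qed (use c idD idH in auto)
qed

text \<open>Induction on the number of vertices, with blocks as the base. The fibres are assumed
  nonempty because an M-configuration needs a transversal even where all weights vanish.\<close>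

theorem constructible_sub:
  assumes "W \<subseteq> V" "conn W" "feas (weight f) W" "uncol (weight f) W" "\<And>v. v \<in> W \<Longrightarrow> X v \<noteq> {}"
  shows "constructible (sub_digraph W) X (sub_cover W) f"
  using assms
proof (induction "card W" arbitrary: W f rule: less_induct)
  case less
  note W = less.prems(1-4)
  show ?case
  proof (cases "biconn W")
    case True
    interpret critical_block V A X E W "weight f" using W True by unfold_locales auto
    show ?thesis
    proof (cases "\<exists>w\<in>W. 2 \<le> card (supp (weight f) w)")
      case True
      then obtain w where w: "w \<in> W" "2 \<le> card (supp (weight f) w)" by blast
      consider "complete_type (weight f) W" | n v where "4 \<le> n" "cycle_enum n v W"
        using block_structure[OF WV bic fea unc w] by blast
      then show ?thesis
      proof cases
        case 1
        then show ?thesis using K_config[OF refl _ w] constructible.K by blast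
      next
        case 2
        have "2 \<le> card (supp (weight f) u)" if "u \<in> W" for u
          using card_supp[OF that w(1)] w(2) by simp
        then interpret critical_cycle V A X E W "weight f" n v
          using 2(2) by unfold_locales
        show ?thesis
          using cycle_config[OF refl 2(1)] constructible.odd_C constructible.even_C constructible.A by blast
      qed
    next
      case False
      then have "card (supp (weight f) w) \<le> 1" if "w \<in> W" for w
        using that by (metis not_less_eq_eq One_nat_def Suc_1)
      then show ?thesis using M_config[OF refl less.prems(5)] constructible.M by blast
    qed
  next
    case False
    then obtain c where c: "c \<in> W" "W - {c} \<noteq> {}" "\<not> conn (W - {c})" using W(2) unfolding biconn_def by blast
    then have "W \<noteq> {c}" by blast
    obtain W1 W2 g1 g2 where *: "W1 \<union> W2 = W" "W1 \<inter> W2 = {c}" "W1 \<subset> W" "W2 \<subset> W" "conn W1" "conn W2"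
      "\<And>u v. u \<in> W1 - {c} \<Longrightarrow> v \<in> W2 - {c} \<Longrightarrow> \<not> nb u v"
      "feas g1 W1" "uncol g1 W1" "feas g2 W2" "uncol g2 W2"
      "\<And>b x. x \<in> X c \<Longrightarrow> weight f b x = g1 b x + g2 b x"
      "\<And>v b x. v \<in> W1 - {c} \<Longrightarrow> x \<in> X v \<Longrightarrow> g1 b x = weight f b x"
      "\<And>v b x. v \<in> W2 - {c} \<Longrightarrow> x \<in> X v \<Longrightarrow> g2 b x = weight f b x"
      by (rule cut_vertex_split[OF W c(1) \<open>W \<noteq> {c}\<close> c(3)]) (rule that)
    let ?f1 = "\<lambda>x. (g1 True x, g1 False x)" and ?f2 = "\<lambda>x. (g2 True x, g2 False x)"
    have card: "card W1 < card W" "card W2 < card W"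
      using *(3,4) finite_sub[OF W(1)] by (auto intro: psubset_card_mono)
    have X: "X v \<noteq> {}" if "v \<in> W1 \<or> v \<in> W2" for v using less.prems(5) that *(1) by blast
    have "constructible (sub_digraph W1) X (sub_cover W1) ?f1"
    proof (rule less.hyps[OF card(1)])
      show "W1 \<subseteq> V" using W(1) *(3) by blast
      show "conn W1" by (fact *(5))
      show "feas (weight ?f1) W1" unfolding weight_pair by (fact *(8))
      show "uncol (weight ?f1) W1" unfolding weight_pair by (fact *(9))
      show "X v \<noteq> {}" if "v \<in> W1" for v using X that by blast
    qed
    moreover have "constructible (sub_digraph W2) X (sub_cover W2) ?f2"
    proof (rule less.hyps[OF card(2)])
      show "W2 \<subseteq> V" using W(1) *(4) by blast
      show "conn W2" by (fact *(6))
      show "feas (weight ?f2) W2" unfolding weight_pair by (fact *(10))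
      show "uncol (weight ?f2) W2" unfolding weight_pair by (fact *(11))
      show "X v \<noteq> {}" if "v \<in> W2" for v using X that by blast
    qed
    moreover have "merging (sub_digraph W1) X (sub_cover W1) ?f1 (sub_digraph W2) X (sub_cover W2) ?f2
        (sub_digraph W) X (sub_cover W) f"
    proof (rule merging_sub[OF W(1) *(1,2,7)])
      show "f x = ?f1 x + ?f2 x" if "x \<in> X c" for x
        using *(12)[OF that, of True] *(12)[OF that, of False] by (simp add: weight_simps prod_eq_iff)
      show "f x = ?f1 x" if "v \<in> W1 - {c}" "x \<in> X v" for v x
        using *(13)[OF that, of True] *(13)[OF that, of False] by (simp add: weight_simps prod_eq_iff)
      show "f x = ?f2 x" if "v \<in> W2 - {c}" "x \<in> X v" for v x
        using *(14)[OF that, of True] *(14)[OF that, of False] by (simp add: weight_simps prod_eq_iff)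
    qed
    ultimately show ?thesis
      using constructible.merge sub_configuration[OF W(1)] card unfolding sub_digraph_simps(1)
      by (metis sub_digraph_simps(1))
  qed
qed

end

section \<open>Constructible configurations are uncolorable\<close>

lemma weight_zero: "f x = (0, 0) \<Longrightarrow> weight f b x = 0"
  by (simp add: weight_def)

context cover_system
begin

text \<open>The set of one vertex is among the tested sets, so every colour has positive weight in
  some direction.\<close>

lemma col_supp:
  assumes "W \<subseteq> V" "col g W \<phi>" "v \<in> W"
  shows "\<phi> v \<in> supp g v"
proof -
  obtain b where "cnt b {v} \<phi> (\<phi> v) < g b (\<phi> v)" using assms(2,3) unfolding col_def by blast
  then show ?thesis using col_range[OF assms(2,3)] by (auto simp: supp_def intro!: exI[of _ b])
qed

lemma col_in_support:
  assumes "W \<subseteq> V" "col g W \<phi>" "v \<in> W" "\<And>x b. x \<in> X v \<Longrightarrow> x \<notin> S \<Longrightarrow> g b x = 0"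
  shows "\<phi> v \<in> S"
proof (rule ccontr)
  assume "\<phi> v \<notin> S"
  then have "g b (\<phi> v) = 0" for b using assms(4) col_range[OF assms(2,3)] by blast
  then show False using col_supp[OF assms(1-3)] by (simp add: supp_def)
qed

lemma deg_le_nb:
  assumes "finite W"
  shows "deg b W v \<le> card {u \<in> W. nb v u}"
  unfolding deg_def using assms by (intro card_mono) (auto simp: nb_def)

lemma transversal_elem:
  assumes "transversal (sub_digraph W) X (sub_cover W) T" "v \<in> W"
  obtains x where "T \<inter> X v = {x}"
  using assms unfolding transversal_sub_iff by (metis card_1_singletonE)

lemma saturated_E:
  assumes W: "W \<subseteq> V" and T: "transversal (sub_digraph W) X (sub_cover W) T"
    and sat: "saturated_subcover (sub_digraph W) X (sub_cover W) T"
    and uv: "u \<in> W" "v \<in> W" "x \<in> T \<inter> X u" "y \<in> T \<inter> X v" "A b u v"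
  shows "E b x y"
proof (cases b)
  case True
  then have "A True u v" using uv by simp
  then have "E True x y" using sat[unfolded saturated_sub_iff[OF W T]] uv by blast
  then show ?thesis using True by simp
next
  case False
  then have "A True v u" using uv A_False by simp
  then have "E True y x" using sat[unfolded saturated_sub_iff[OF W T]] uv by blast
  then show ?thesis using False E_False by simp
qed

text \<open>A colouring has to use \<open>T\<close>, and then the set \<open>W\<close> itself has no
  witness: by saturation each vertex has its full degree inside the transversal.\<close>

lemma M_config_uncol_feas:
  assumes W: "W \<subseteq> V" and M: "M_configuration (sub_digraph W) X (sub_cover W) f"
  shows "uncol (weight f) W \<and> feas (weight f) W"
proof -
  let ?g = "weight f"
  obtain T where T: "transversal (sub_digraph W) X (sub_cover W) T"
    and sat: "saturated_subcover (sub_digraph W) X (sub_cover W) T"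
    and f: "\<forall>v\<in>W. \<forall>x\<in>T \<inter> X v. f x = degree_pair (with_proj (sub_digraph W)) v"
      "\<forall>x\<in>pverts (sub_cover W) - T. f x = (0, 0)"
    and blk: "biconn W"
    using M is_block_sub_iff[OF W] unfolding M_configuration_def sub_digraph_simps(1) by blast
  have g: "?g b x = deg b W v" if "v \<in> W" "x \<in> T \<inter> X v" for v x b
    using f(1) that degree_pair_sub[OF that(1)] by (cases b) (auto simp: weight_simps)
  have zero: "?g b x = 0" if "v \<in> W" "x \<in> X v" "x \<notin> T" for v x b
  proof (rule weight_zero)
    have "x \<in> pverts (sub_cover W) - T" using that by (auto simp: sub_cover_simps)
    then show "f x = (0, 0)" using f(2) by blast
  qed
  have E: "E b x y" if "u \<in> W" "v \<in> W" "x \<in> T \<inter> X u" "y \<in> T \<inter> X v" "A b u v" for b u v x y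
    using saturated_E[OF W T sat that] .
  have "\<not> col ?g W \<phi>" for \<phi>
  proof
    assume \<phi>: "col ?g W \<phi>"
    have T\<phi>: "\<phi> v \<in> T \<inter> X v" if v: "v \<in> W" for v
      using col_in_support[OF W \<phi> v zero[OF v]] col_range[OF \<phi> v] by blast
    have "W \<noteq> {}" using blk biconn_conn conn_nonempty by blast
    then obtain v b where v: "v \<in> W" "cnt b W \<phi> (\<phi> v) < ?g b (\<phi> v)" using \<phi> unfolding col_def by blast
    have "deg b W v \<le> cnt b W \<phi> (\<phi> v)"
      unfolding deg_def cnt_def using finite_sub[OF W] E[OF v(1) _ T\<phi>[OF v(1)] T\<phi>]
      by (intro card_mono) auto
    then show False using v g[OF v(1) T\<phi>[OF v(1)]] by simp
  qed
  moreover have "feas ?g W"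
    unfolding feas_def
  proof (intro ballI allI)
    fix v b assume v: "v \<in> W"
    obtain x where x: "T \<inter> X v = {x}" using transversal_elem[OF T v] .
    then have "?g b x \<le> (\<Sum>x\<in>X v. ?g b x)" using finite_X v W by (intro member_le_sum) auto
    then show "deg b W v \<le> (\<Sum>x\<in>X v. ?g b x)" using g[OF v, of x b] x by simp
  qed
  ultimately show ?thesis by (simp add: uncol_def)
qed

text \<open>The \<open>n\<close> vertices are distributed over classes whose weights add up to
  \<open>n - 1\<close>, so some \<open>T i\<close> is used more than \<open>m i\<close> times. The
  vertices that use it induce a bidirected complete graph of degree at least \<open>m i\<close>,
  which has no witness.\<close>

lemma K_config_uncol_feas:
  assumes W: "W \<subseteq> V" and K: "K_configuration (sub_digraph W) X (sub_cover W) f"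
  shows "uncol (weight f) W \<and> feas (weight f) W"
proof -
  let ?g = "weight f"
  obtain n p :: nat and m :: "nat \<Rightarrow> nat" and T where n: "n \<ge> 1"
    and iso: "digraph_iso (with_proj (sub_digraph W)) (with_proj (bidirected_complete n))"
    and sum: "(\<Sum>i = 1..p. m i) = n - 1"
    and T: "\<And>i. i \<in> {1..p} \<Longrightarrow> transversal (sub_digraph W) X (sub_cover W) (T i)"
      "\<And>i. i \<in> {1..p} \<Longrightarrow> saturated_subcover (sub_digraph W) X (sub_cover W) (T i)"
    and disj: "disjoint_family_on T {1..p}"
    and f: "\<And>i x. i \<in> {1..p} \<Longrightarrow> x \<in> T i \<Longrightarrow> f x = (m i, m i)"
      "\<And>x. x \<in> pverts (sub_cover W) - (\<Union>i\<in>{1..p}. T i) \<Longrightarrow> f x = (0, 0)"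
    using K unfolding K_configuration_def by blast
  interpret D: pair_digraph "sub_digraph W" using sub_pair_digraph[OF W] .
  have fin: "finite W" using finite_sub[OF W] .
  obtain h where h: "bij_betw h {..<n} W"
    "\<And>i j. i < n \<Longrightarrow> j < n \<Longrightarrow> (h i, h j) \<in> parcs (sub_digraph W) \<longleftrightarrow> i \<noteq> j"
    using iso digraph_iso_enum_iff[OF D.wf_digraph _ _ pair_wf_bidirected(1)[of n]]
    by (auto simp: sub_digraph_simps(1) bidirected_complete_simps)
  have cardW: "card W = n" using bij_betw_same_card[OF h(1)] by simp
  have AT: "A True u v" if uv: "u \<in> W" "v \<in> W" "u \<noteq> v" for u v
  proof -
    obtain i j where "i < n" "u = h i" "j < n" "v = h j"
      using uv h(1) by (auto simp: bij_betw_def)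
    then show ?thesis using h(2)[of i j] uv by (auto simp: sub_digraph_simps)
  qed
  then have A: "A b u v" if uv: "u \<in> W" "v \<in> W" "u \<noteq> v" for b u v using uv A_False by (cases b) auto
  have E: "E b x y" if "i \<in> {1..p}" "u \<in> W" "v \<in> W" "u \<noteq> v" "x \<in> T i \<inter> X u" "y \<in> T i \<inter> X v" for b i u v x y
    using saturated_E[OF W T(1)[OF that(1)] T(2)[OF that(1)] that(2,3,5,6) A[OF that(2-4)]] .
  have g: "?g b x = m i" if "i \<in> {1..p}" "x \<in> T i" for b i x
    using f(1)[OF that] by (cases b) (simp_all add: weight_simps)
  have zero: "?g b x = 0" if "v \<in> W" "x \<in> X v" "x \<notin> (\<Union>i\<in>{1..p}. T i)" for v x b
    by (rule weight_zero, rule f(2)) (use that in \<open>auto simp: sub_cover_simps\<close>)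
  have "\<not> col ?g W \<phi>" for \<phi>
  proof
    assume \<phi>: "col ?g W \<phi>"
    let ?U = "\<lambda>i. {v \<in> W. \<phi> v \<in> T i}"
    have cover: "\<exists>i\<in>{1..p}. \<phi> v \<in> T i" if v: "v \<in> W" for v
      using col_in_support[OF W \<phi> v zero[OF v]] by blast
    have "\<exists>i\<in>{1..p}. m i < card (?U i)"
    proof (rule ccontr)
      assume "\<not> ?thesis"
      then have "(\<Sum>i = 1..p. card (?U i)) \<le> n - 1" unfolding sum[symmetric] by (intro sum_mono) (auto simp: not_less)
      moreover have "W \<subseteq> (\<Union>i\<in>{1..p}. ?U i)" using cover by blast
      then have "card W \<le> card (\<Union>i\<in>{1..p}. ?U i)" using fin by (intro card_mono) auto
      then have "card W \<le> (\<Sum>i = 1..p. card (?U i))" using card_UN_le[of "{1..p}" ?U] by simp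
      ultimately show False using n cardW by simp
    qed
    then obtain i where i: "i \<in> {1..p}" "m i < card (?U i)" by blast
    then have "?U i \<noteq> {}" by (metis card.empty not_less_zero)
    then obtain v b where v: "v \<in> ?U i" "cnt b (?U i) \<phi> (\<phi> v) < ?g b (\<phi> v)"
      using \<phi> unfolding col_def by (metis (no_types, lifting) mem_Collect_eq subsetI)
    have "?U i - {v} \<subseteq> {u \<in> ?U i. E b (\<phi> v) (\<phi> u)}"
    proof
      fix u assume u: "u \<in> ?U i - {v}"
      have "E b (\<phi> v) (\<phi> u)"
        by (rule E[OF i(1), of v u]) (use u v col_range[OF \<phi>] in auto)
      then show "u \<in> {u \<in> ?U i. E b (\<phi> v) (\<phi> u)}" using u by blast
    qed
    then have "card (?U i - {v}) \<le> cnt b (?U i) \<phi> (\<phi> v)"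
      unfolding cnt_def using fin by (intro card_mono) auto
    then show False using v i fin g[OF i(1), of "\<phi> v" b] by simp
  qed
  moreover have "feas ?g W"
    unfolding feas_def
  proof (intro ballI allI)
    fix v b assume v: "v \<in> W"
    have "\<exists>x. T i \<inter> X v = {x}" if "i \<in> {1..p}" for i using transversal_elem[OF T(1)[OF that] v] by metis
    then obtain e where e: "\<And>i. i \<in> {1..p} \<Longrightarrow> T i \<inter> X v = {e i}" by metis
    have inj: "inj_on e {1..p}"
    proof (rule inj_onI)
      fix i j assume ij: "i \<in> {1..p}" "j \<in> {1..p}" "e i = e j"
      then have "e i \<in> T i \<inter> T j" using e by blast
      then show "i = j" using disj ij unfolding disjoint_family_on_def by blast
    qed
    have ge: "?g b (e i) = m i" if "i \<in> {1..p}" for i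
    proof -
      have "e i \<in> T i" using e[OF that] by blast
      then show ?thesis by (rule g[OF that])
    qed
    have "deg b W v \<le> card (W - {v})"
      unfolding deg_def using fin A_irrefl by (intro card_mono) auto
    also have "\<dots> = n - 1" using v cardW fin by simp
    also have "\<dots> = (\<Sum>i = 1..p. ?g b (e i))"
      unfolding sum[symmetric] using ge by (intro sum.cong) auto
    also have "\<dots> = (\<Sum>x\<in>e ` {1..p}. ?g b x)" using inj by (simp add: sum.reindex)
    also have "\<dots> \<le> (\<Sum>x\<in>X v. ?g b x)"
    proof (rule sum_mono2)
      show "finite (X v)" using finite_X v W by blast
      show "e ` {1..p} \<subseteq> X v" using e by blast
    qed simp
    finally show "deg b W v \<le> (\<Sum>x\<in>X v. ?g b x)" .
  qed
  ultimately show ?thesis by (simp add: uncol_def)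
qed

section \<open>Two-layer covers of cycles: feasibility and forced conflicts\<close>

lemma two_layer_feas:
  assumes W: "W \<subseteq> V" and cyc: "cycle_enum n h W"
    and T: "transversal (sub_digraph W) X (sub_cover W) T1" "transversal (sub_digraph W) X (sub_cover W) T2"
      "T1 \<inter> T2 = {}"
    and g: "\<And>u v x b. u \<in> W \<Longrightarrow> v \<in> W \<Longrightarrow> nb u v \<Longrightarrow> x \<in> X u \<Longrightarrow> x \<in> T1 \<union> T2 \<Longrightarrow>
      g b x = (if A b u v then 1 else 0)"
  shows "feas g W"
  unfolding feas_def
proof (intro ballI allI)
  fix v b assume v: "v \<in> W"
  have fin: "finite W" using finite_sub[OF W] .
  show "deg b W v \<le> (\<Sum>x\<in>X v. g b x)"
  proof (cases "\<exists>u\<in>W. A b v u")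
    case False
    then show ?thesis using deg_pos_iff[OF fin, of b v] by simp
  next
    case True
    then obtain u where u: "u \<in> W" "A b v u" by blast
    obtain x1 where x1: "T1 \<inter> X v = {x1}" using transversal_elem[OF T(1) v] .
    obtain x2 where x2: "T2 \<inter> X v = {x2}" using transversal_elem[OF T(2) v] .
    have ne: "x1 \<noteq> x2" using x1 x2 T(3) by blast
    have "nb v u" using u by (auto simp: nb_def)
    moreover have "x1 \<in> X v" "x2 \<in> X v" "x1 \<in> T1 \<union> T2" "x2 \<in> T1 \<union> T2" using x1 x2 by auto
    ultimately have one: "g b x1 = 1" "g b x2 = 1" using g[OF v u(1)] u(2) by auto
    have "deg b W v \<le> 2" using deg_le_nb[OF fin, of b v] cycle_enum_card_nb[OF cyc v] by linarith
    also have "2 = (\<Sum>x\<in>{x1, x2}. g b x)" using ne one by simp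
    also have "\<dots> \<le> (\<Sum>x\<in>X v. g b x)" using x1 x2 finite_X v W by (intro sum_mono2) auto
    finally show ?thesis .
  qed
qed

text \<open>The set \<open>{u, v}\<close> has no witness: a weight of 1 is met by the arc to the
  other vertex, and a weight of 0 leaves no room anyway.\<close>

lemma conflict_uncol:
  assumes \<phi>: "col g W \<phi>" and uv: "u \<in> W" "v \<in> W" "u \<noteq> v"
    and g: "\<And>b. g b (\<phi> u) \<le> (if A b u v then 1 else 0)" "\<And>b. g b (\<phi> v) \<le> (if A b v u then 1 else 0)"
    and full: "\<And>b. A b u v \<Longrightarrow> E b (\<phi> u) (\<phi> v)"
  shows False
proof -
  obtain w b where w: "w \<in> {u, v}" "cnt b {u, v} \<phi> (\<phi> w) < g b (\<phi> w)"
    using \<phi> uv unfolding col_def by (metis empty_subsetI insert_not_empty insert_subset)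
  have "E b (\<phi> v) (\<phi> u)" if "A b v u" for b
    using full[of "\<not> b"] that by (simp add: A_flip E_flip)
  then have *: "\<exists>w'\<in>{u, v}. E b (\<phi> w) (\<phi> w')" if "0 < g b (\<phi> w)"
    using w(1) that g(1)[of b] g(2)[of b] full by (auto split: if_splits)
  have "g b (\<phi> w) \<le> 1" using w(1) g(1)[of b] g(2)[of b] by (auto split: if_splits)
  moreover have "0 < g b (\<phi> w)" using w by simp
  moreover have "0 < cnt b {u, v} \<phi> (\<phi> w)"
    unfolding cnt_def using *[OF calculation(2)] by (auto simp: card_gt_0_iff)
  ultimately show False using w by simp
qed

lemma bidirected_cycle_enum:
  assumes W: "W \<subseteq> V" and n: "3 \<le> n"
    and iso: "digraph_iso (with_proj (sub_digraph W)) (with_proj (bidirected_cycle n))"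
  shows "\<exists>h. cycle_enum n h W \<and> (\<forall>u v b. u \<in> W \<longrightarrow> v \<in> W \<longrightarrow> nb u v \<longrightarrow> A b u v)"
proof -
  interpret D: pair_digraph "sub_digraph W" using sub_pair_digraph[OF W] .
  obtain h where h: "bij_betw h {..<n} W"
    "\<And>i j. i < n \<Longrightarrow> j < n \<Longrightarrow> (h i, h j) \<in> parcs (sub_digraph W) \<longleftrightarrow> (i, j) \<in> parcs (bidirected_cycle n)"
    using iso digraph_iso_enum_iff[OF D.wf_digraph _ _ pair_wf_bidirected(2)[of n]]
    by (auto simp: sub_digraph_simps(1) bidirected_cycle_simps(1))
  have mem: "h i \<in> W" if "i < n" for i using h(1) that by (auto simp: bij_betw_def)
  have ne: "j = Suc i mod n \<or> i = Suc j mod n \<Longrightarrow> i \<noteq> j" if "i < n" "j < n" for i j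
    using that n by (auto simp: mod_Suc split: if_splits)
  have A: "A True (h i) (h j) \<longleftrightarrow> j = Suc i mod n \<or> i = Suc j mod n" if "i < n" "j < n" for i j
    using h(2)[OF that] mem that ne[OF that] by (auto simp: sub_digraph_simps bidirected_cycle_simps)
  then have Ab: "A b (h i) (h j) \<longleftrightarrow> j = Suc i mod n \<or> i = Suc j mod n" if "i < n" "j < n" for b i j
    using A[OF that] A[OF that(2,1)] A_False by (cases b) auto
  then have "nb (h i) (h j) \<longleftrightarrow> j = Suc i mod n \<or> i = Suc j mod n" if "i < n" "j < n" for i j
    using that by (auto simp: nb_def)
  then have "cycle_enum n h W" using n h(1) unfolding cycle_enum_def by blast
  moreover have "A b u v" if uv: "u \<in> W" "v \<in> W" "nb u v" for u v b
  proof -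
    obtain i j where ij: "i < n" "u = h i" "j < n" "v = h j" using uv h(1) by (auto simp: bij_betw_def)
    obtain b' where "A b' u v" using uv by (auto simp: nb_def)
    then show ?thesis using Ab[OF ij(1,3)] ij by blast
  qed
  ultimately show ?thesis by blast
qed

text \<open>Saturation fully joins adjacent vertices that use the same transversal, so a colouring
  would have to alternate between \<open>T1\<close> and \<open>T2\<close> around an odd
  cycle.\<close>

lemma odd_C_config_uncol_feas:
  assumes W: "W \<subseteq> V" and C: "odd_C_configuration (sub_digraph W) X (sub_cover W) f"
  shows "uncol (weight f) W \<and> feas (weight f) W"
proof -
  let ?g = "weight f"
  obtain n T1 T2 where n: "n \<ge> 5" "odd n"
    and iso: "digraph_iso (with_proj (sub_digraph W)) (with_proj (bidirected_cycle n))"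
    and T: "transversal (sub_digraph W) X (sub_cover W) T1" "transversal (sub_digraph W) X (sub_cover W) T2"
      "T1 \<inter> T2 = {}"
    and sat: "saturated_subcover (sub_digraph W) X (sub_cover W) T1" "saturated_subcover (sub_digraph W) X (sub_cover W) T2"
    and f: "\<And>x. x \<in> T1 \<union> T2 \<Longrightarrow> f x = (1, 1)" "\<And>x. x \<in> pverts (sub_cover W) - (T1 \<union> T2) \<Longrightarrow> f x = (0, 0)"
    using C unfolding odd_C_configuration_def by blast
  obtain h where cyc: "cycle_enum n h W" and dig: "\<And>u v b. u \<in> W \<Longrightarrow> v \<in> W \<Longrightarrow> nb u v \<Longrightarrow> A b u v"
    using bidirected_cycle_enum[OF W _ iso] n(1) by auto
  have g: "?g b x = 1" if "x \<in> T1 \<union> T2" for b x using f(1)[OF that] by (cases b) (simp_all add: weight_simps)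
  have zero: "?g b x = 0" if "v \<in> W" "x \<in> X v" "x \<notin> T1 \<union> T2" for v x b
    by (rule weight_zero, rule f(2)) (use that in \<open>auto simp: sub_cover_simps\<close>)
  note tr = T(1,2)
  have "feas ?g W"
    using two_layer_feas[OF W cyc T] g dig by simp
  moreover have "\<not> col ?g W \<phi>" for \<phi>
  proof
    assume \<phi>: "col ?g W \<phi>"
    have mem: "\<phi> v \<in> T1 \<union> T2" if v: "v \<in> W" for v
      by (rule col_in_support[OF W \<phi> v zero[OF v]])
    have alt: "\<phi> u \<notin> T \<or> \<phi> v \<notin> T"
      if T: "T = T1 \<or> T = T2" and uv: "u \<in> W" "v \<in> W" "nb u v" for u v T
    proof (rule ccontr)
      assume both: "\<not> ?thesis"
      have m: "\<phi> u \<in> T \<inter> X u" "\<phi> v \<in> T \<inter> X v" using both col_range[OF \<phi>] uv by auto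
      have full: "E b (\<phi> u) (\<phi> v)" for b
        using saturated_E[OF W _ _ uv(1,2) m dig[OF uv]] tr sat T by blast
      show False
      proof (rule conflict_uncol[OF \<phi> uv(1,2)])
        show "u \<noteq> v" using uv adj_irrefl by blast
      qed (use g mem uv dig adj_sym full in auto)
    qed
    have alt1: "\<phi> (h (Suc i mod n)) \<in> T1 \<longleftrightarrow> \<phi> (h i) \<notin> T1" if i: "i < n" for i
    proof -
      have j: "Suc i mod n < n" using n by simp
      have W: "h i \<in> W" "h (Suc i mod n) \<in> W" using cycle_enum_range[OF cyc] i j by auto
      have "nb (h i) (h (Suc i mod n))" using cyc i j unfolding cycle_enum_def by blast
      then show ?thesis using alt[of T1, OF _ W] alt[of T2, OF _ W] mem W by blast
    qed
    have par: "\<phi> (h i) \<in> T1 \<longleftrightarrow> (\<phi> (h 0) \<in> T1) = even i" if "i < n" for i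
      using that
    proof (induction i)
      case (Suc i)
      then show ?case using alt1[of i] by auto
    qed simp
    show False using alt1[of "n - 1"] par[of "n - 1"] n by auto
  qed
  ultimately show ?thesis by (simp add: uncol_def)
qed

text \<open>A transversal of a twisted double cover of an even cycle contains two adjacent vertices.
  Otherwise its complement is independent as well, and switching between the two along the cycle
  yields a proper part of the double cover that is closed under adjacency.\<close>

lemma twisted_cycle_conflict:
  assumes W: "W \<subseteq> V" and cyc: "cycle_enum n h W" and ev: "even n"
    and T: "transversal (sub_digraph W) X (sub_cover W) T1" "transversal (sub_digraph W) X (sub_cover W) T2"
      "T1 \<inter> T2 = {}"
    and k: "bij_betw k {..<2 * n} (T1 \<union> T2)"
      "\<And>i j. i < 2 * n \<Longrightarrow> j < 2 * n \<Longrightarrow> (\<exists>b. E b (k i) (k j)) \<longleftrightarrow> i \<noteq> j \<and> (j = Suc i mod (2 * n) \<or> i = Suc j mod (2 * n))"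
    and full: "\<And>u v x y b b'. u \<in> W \<Longrightarrow> v \<in> W \<Longrightarrow> x \<in> (T1 \<union> T2) \<inter> X u \<Longrightarrow> y \<in> (T1 \<union> T2) \<inter> X v \<Longrightarrow>
      E b x y \<Longrightarrow> A b' u v \<Longrightarrow> E b' x y"
    and \<phi>: "\<And>v. v \<in> W \<Longrightarrow> \<phi> v \<in> (T1 \<union> T2) \<inter> X v"
  shows "\<exists>u\<in>W. \<exists>v\<in>W. \<exists>b. E b (\<phi> u) (\<phi> v)"
proof (rule ccontr)
  assume "\<not> ?thesis"
  then have indep: "\<not> E b (\<phi> u) (\<phi> v)" if "u \<in> W" "v \<in> W" for u v b using that by blast
  have fin: "finite W" using finite_sub[OF W] .
  have n: "3 \<le> n" using cyc by (simp add: cycle_enum_def)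
  define S where "S v = (T1 \<union> T2) \<inter> X v" for v
  have \<phi>S: "\<phi> v \<in> S v" if "v \<in> W" for v using \<phi>[OF that] by (simp add: S_def)
  have S_X: "x \<in> X v" if "x \<in> S v" for x v using that by (simp add: S_def)
  have V: "v \<in> V" if "v \<in> W" for v using that W by blast
  have S2: "\<exists>y. y \<noteq> \<phi> v \<and> S v = {\<phi> v, y}" if v: "v \<in> W" for v
  proof -
    obtain x1 where x1: "T1 \<inter> X v = {x1}" using transversal_elem[OF T(1) v] .
    obtain x2 where x2: "T2 \<inter> X v = {x2}" using transversal_elem[OF T(2) v] .
    have "S v = {x1, x2}" "x1 \<noteq> x2" using x1 x2 T(3) unfolding S_def by blast+
    moreover have "\<phi> v = x1 \<or> \<phi> v = x2" using \<phi>S[OF v] calculation(1) by blast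
    ultimately show ?thesis by (metis insert_commute)
  qed
  \<comment> \<open>\<open>\<psi>\<close> is the complementary choice inside the double
    cover.\<close>
  then obtain \<psi> where \<psi>: "\<And>v. v \<in> W \<Longrightarrow> \<psi> v \<noteq> \<phi> v" "\<And>v. v \<in> W \<Longrightarrow> S v = {\<phi> v, \<psi> v}" by metis
  have owner: "\<exists>v\<in>W. x \<in> S v" if "x \<in> T1 \<union> T2" for x
    using that T(1,2) unfolding transversal_sub_iff S_def by blast
  have kS: "\<exists>v\<in>W. k i \<in> S v" if "i < 2 * n" for i
    using owner bij_betwE[OF k(1)] that by blast
  have fullS: "E b' x y" if "u \<in> W" "v \<in> W" "x \<in> S u" "y \<in> S v" "E b x y" "A b' u v" for u v x y b b'
    using full[OF that(1,2) _ _ that(5,6)] that(3,4) unfolding S_def by blast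
  have E_nb: "nb u v" if "u \<in> W" "v \<in> W" "x \<in> S u" "y \<in> S v" "E b x y" for u v x y b
    using E_A[OF V[OF that(1)] V[OF that(2)] S_X[OF that(3)] S_X[OF that(4)] that(5)] by (auto simp: nb_def)
  \<comment> \<open>The two cyclic neighbours of \<open>x\<close> lie over different neighbours of
    \<open>v\<close>, by \<open>full\<close> and the matching property. Since \<open>v\<close> has
    at most two neighbours, each of them is hit.\<close>
  have nbr: "\<exists>y\<in>S u. \<exists>b. E b x y" if v: "v \<in> W" "u \<in> W" "nb v u" and x: "x \<in> S v" for u v x
  proof -
    obtain i where i: "i < 2 * n" "x = k i" using k(1) x unfolding S_def bij_betw_def by blast
    let ?j = "Suc i mod (2 * n)" and ?l = "if i = 0 then 2 * n - 1 else i - 1"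
    have jl: "?j < 2 * n" "?l < 2 * n" "i = Suc ?l mod (2 * n)" "?j \<noteq> ?l" "i \<noteq> ?j" "i \<noteq> ?l"
      using i n by (auto simp: mod_Suc)
    obtain b1 where b1: "E b1 x (k ?j)" using k(2)[OF i(1) jl(1)] i jl by blast
    obtain b2 where b2: "E b2 x (k ?l)" using k(2)[OF i(1) jl(2)] i jl by blast
    obtain u1 where u1: "u1 \<in> W" "k ?j \<in> S u1" using kS[OF jl(1)] by blast
    obtain u2 where u2: "u2 \<in> W" "k ?l \<in> S u2" using kS[OF jl(2)] by blast
    have nb1: "nb v u1" using E_nb[OF v(1) u1(1) x u1(2) b1] .
    have nb2: "nb v u2" using E_nb[OF v(1) u2(1) x u2(2) b2] .
    have "u1 \<noteq> u2"
    proof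
      assume eq: "u1 = u2"
      obtain b where b: "A b v u1" using nb1 by (auto simp: nb_def)
      have "E b x (k ?j)" using fullS[OF v(1) u1(1) x u1(2) b1 b] .
      moreover have "E b x (k ?l)" using fullS[OF v(1) u2(1) x u2(2) b2] b eq by simp
      ultimately have "k ?j = k ?l"
        using E_fun[OF V[OF v(1)] V[OF u1(1)] S_X[OF x] S_X[OF u1(2)]] S_X[OF u2(2)] eq by blast
      then show False using jl k(1) by (auto simp: bij_betw_def inj_on_eq_iff)
    qed
    then have "card {u1, u2} = 2" by simp
    moreover have "card {u' \<in> W. nb v u'} \<le> 2" using cycle_enum_card_nb[OF cyc v(1)] .
    ultimately have "{u1, u2} = {u' \<in> W. nb v u'}"
      using u1 u2 nb1 nb2 fin by (intro card_seteq) auto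
    then have "u = u1 \<or> u = u2" using v by blast
    then show ?thesis using u1 u2 b1 b2 by blast
  qed
  \<comment> \<open>A partner of \<open>\<phi> u\<close> over \<open>v\<close> cannot be
    \<open>\<phi> v\<close>, so it is \<open>\<psi> v\<close>; an arc from \<open>\<psi> u\<close>
    would give \<open>\<psi> v\<close> two partners over \<open>u\<close>.\<close>
  have indep': "\<not> E b (\<psi> u) (\<psi> v)" if uv: "u \<in> W" "v \<in> W" for u v b
  proof
    assume e: "E b (\<psi> u) (\<psi> v)"
    have m: "\<psi> u \<in> S u" "\<psi> v \<in> S v" "\<phi> u \<in> S u" using \<psi>(2) uv by auto
    have "nb u v" using E_nb[OF uv m(1,2) e] .
    then obtain y b' where y: "y \<in> S v" "E b' (\<phi> u) y" using nbr[OF uv _ m(3)] by blast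
    have "y \<noteq> \<phi> v" using indep[OF uv] y(2) by blast
    then have y': "E b' (\<phi> u) (\<psi> v)" using y \<psi>(2)[OF uv(2)] by blast
    have "A b u v" using E_A[OF V[OF uv(1)] V[OF uv(2)] S_X[OF m(1)] S_X[OF m(2)] e] .
    then have "E b (\<phi> u) (\<psi> v)" using fullS[OF uv m(3,2) y'] by blast
    then have "\<phi> u = \<psi> u"
      using E_inj[OF V[OF uv(1)] V[OF uv(2)] S_X[OF m(3)] S_X[OF m(1)] S_X[OF m(2)] _ e] by blast
    then show False using \<psi>(1)[OF uv(1)] by simp
  qed
  \<comment> \<open>The set takes \<open>\<phi>\<close> at even positions and \<open>\<psi>\<close>
    at odd ones. Arcs join only a \<open>\<phi>\<close>-vertex to a \<open>\<psi>\<close>-vertex,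
    and an even \<open>n\<close> keeps this consistent across the closing edge.\<close>
  define P where "P x \<longleftrightarrow> (\<exists>i<n. x \<in> S (h i) \<and> ((x = \<phi> (h i)) = even i))" for x
  have hW: "h i \<in> W" if "i < n" for i using cycle_enum_range[OF cyc that] .
  have P_at: "P x \<longleftrightarrow> ((x = \<phi> (h i)) = even i)" if i: "i < n" "x \<in> S (h i)" for i x
  proof -
    have "j = i" if "j < n" "x \<in> S (h j)" for j
    proof -
      have "h j = h i" using X_disjoint[OF V[OF hW[OF that(1)]] V[OF hW[OF i(1)]] S_X[OF that(2)] S_X[OF i(2)]] .
      then show ?thesis using cycle_enum_eq_iff[OF cyc that(1) i(1)] by simp
    qed
    then show ?thesis unfolding P_def using i by blast
  qed
  have closed: "P x \<longleftrightarrow> P y" if xy: "x \<in> T1 \<union> T2" "y \<in> T1 \<union> T2" "E b x y" for x y b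
  proof -
    obtain u where u: "u \<in> W" "x \<in> S u" using owner[OF xy(1)] by blast
    obtain v where v: "v \<in> W" "y \<in> S v" using owner[OF xy(2)] by blast
    obtain i where i: "i < n" "u = h i" using cycle_enum_surj[OF cyc u(1)] .
    obtain j where j: "j < n" "v = h j" using cycle_enum_surj[OF cyc v(1)] .
    have "nb u v" using E_nb[OF u(1) v(1) u(2) v(2) xy(3)] .
    then have "j = Suc i mod n \<or> i = Suc j mod n" using i j cyc by (auto simp: cycle_enum_def)
    then have par: "even i \<longleftrightarrow> odd j"
      using ev i(1) j(1) by (auto simp: mod_Suc split: if_splits)
    have "\<not> (x = \<phi> u \<and> y = \<phi> v)" using indep[OF u(1) v(1)] xy(3) by blast
    moreover have "\<not> (x = \<psi> u \<and> y = \<psi> v)" using indep'[OF u(1) v(1)] xy(3) by blast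
    moreover have "x = \<phi> u \<or> x = \<psi> u" "y = \<phi> v \<or> y = \<psi> v" using u v \<psi>(2) by auto
    ultimately have "x = \<phi> u \<longleftrightarrow> y \<noteq> \<phi> v" by blast
    then show ?thesis using P_at[of i x] P_at[of j y] u v i j par by auto
  qed
  have kT: "k i \<in> T1 \<union> T2" if "i < 2 * n" for i using bij_betwE[OF k(1)] that by blast
  \<comment> \<open>The long cycle is connected, so a set closed under adjacency contains all of it
    or nothing.\<close>
  have const: "P (k i) \<longleftrightarrow> P (k 0)" if "i < 2 * n" for i
    using that
  proof (induction i)
    case (Suc i)
    then have "\<exists>b. E b (k i) (k (Suc i))" using k(2)[of i "Suc i"] by simp
    then show ?case using closed[OF kT kT, of i "Suc i"] Suc by auto
  qed simp
  have h0: "0 < n" "h 0 \<in> W" using n hW by auto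
  have m: "\<phi> (h 0) \<in> S (h 0)" "\<psi> (h 0) \<in> S (h 0)" using \<psi>(2)[OF h0(2)] by auto
  have img: "k ` {..<2 * n} = T1 \<union> T2" using k(1) by (simp add: bij_betw_def)
  obtain i where i: "i < 2 * n" "\<phi> (h 0) = k i" using m(1) img unfolding S_def by blast
  obtain j where j: "j < 2 * n" "\<psi> (h 0) = k j" using m(2) img unfolding S_def by blast
  have "P (\<phi> (h 0)) \<longleftrightarrow> P (\<psi> (h 0))" unfolding i(2) j(2) using const[OF i(1)] const[OF j(1)] by blast
  then show False using P_at[OF h0(1) m(1)] P_at[OF h0(1) m(2)] \<psi>(1)[OF h0(2)] by simp
qed

lemma twisted_cycle_uncol_feas:
  assumes W: "W \<subseteq> V" and cyc: "cycle_enum n h W" and ev: "even n"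
    and T: "transversal (sub_digraph W) X (sub_cover W) T1" "transversal (sub_digraph W) X (sub_cover W) T2"
      "T1 \<inter> T2 = {}"
    and k: "bij_betw k {..<2 * n} (T1 \<union> T2)"
      "\<And>i j. i < 2 * n \<Longrightarrow> j < 2 * n \<Longrightarrow> (\<exists>b. E b (k i) (k j)) \<longleftrightarrow> i \<noteq> j \<and> (j = Suc i mod (2 * n) \<or> i = Suc j mod (2 * n))"
    and full: "\<And>u v x y b b'. u \<in> W \<Longrightarrow> v \<in> W \<Longrightarrow> x \<in> (T1 \<union> T2) \<inter> X u \<Longrightarrow> y \<in> (T1 \<union> T2) \<inter> X v \<Longrightarrow>
      E b x y \<Longrightarrow> A b' u v \<Longrightarrow> E b' x y"
    and g: "\<And>u v x b. u \<in> W \<Longrightarrow> v \<in> W \<Longrightarrow> nb u v \<Longrightarrow> x \<in> X u \<Longrightarrow> x \<in> T1 \<union> T2 \<Longrightarrow>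
      g b x = (if A b u v then 1 else 0)"
    and zero: "\<And>v x b. v \<in> W \<Longrightarrow> x \<in> X v \<Longrightarrow> x \<notin> T1 \<union> T2 \<Longrightarrow> g b x = 0"
  shows "uncol g W \<and> feas g W"
proof
  show "feas g W" using two_layer_feas[OF W cyc T g] .
  have "\<not> col g W \<phi>" for \<phi>
  proof
    assume \<phi>: "col g W \<phi>"
    have mem: "\<phi> v \<in> (T1 \<union> T2) \<inter> X v" if v: "v \<in> W" for v
      using col_in_support[OF W \<phi> v zero[OF v]] col_range[OF \<phi> v] by blast
    have "\<exists>u\<in>W. \<exists>v\<in>W. \<exists>b. E b (\<phi> u) (\<phi> v)"
      by (rule twisted_cycle_conflict[OF W cyc ev T k(1)]; fact)
    then obtain u v b where uv: "u \<in> W" "v \<in> W" "E b (\<phi> u) (\<phi> v)" by blast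
    have V: "u \<in> V" "v \<in> V" using uv W by auto
    have nb: "nb u v"
      using E_A[OF V col_range[OF \<phi> uv(1)] col_range[OF \<phi> uv(2)] uv(3)] by (auto simp: nb_def)
    show False
    proof (rule conflict_uncol[OF \<phi> uv(1,2)])
      show "u \<noteq> v" using nb adj_irrefl by blast
      show "g b' (\<phi> u) \<le> (if A b' u v then 1 else 0)" for b' using g[OF uv(1,2) nb] mem[OF uv(1)] by simp
      show "g b' (\<phi> v) \<le> (if A b' v u then 1 else 0)" for b' using g[OF uv(2,1) adj_sym[OF nb]] mem[OF uv(2)] by simp
      show "E b' (\<phi> u) (\<phi> v)" if "A b' u v" for b' using full[OF uv(1,2) mem[OF uv(1)] mem[OF uv(2)] uv(3) that] .
    qed
  qed
  then show "uncol g W" by (simp add: uncol_def)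
qed

lemma sub_cover_arcs:
  assumes "T \<subseteq> (\<Union>v\<in>W. X v)" "x \<in> T" "y \<in> T"
  shows "(x, y) \<in> arcs (with_proj (sub_cover W) \<restriction> T) \<longleftrightarrow> E True x y"
  using assms by (auto simp: sub_cover_simps)

lemma wf_sub_cover_induce:
  "wf_digraph (with_proj (sub_cover W) \<restriction> T)" "tail (with_proj (sub_cover W) \<restriction> T) = fst"
  "head (with_proj (sub_cover W) \<restriction> T) = snd"
  by (unfold_locales; simp) simp_all

text \<open>Both the base cycle and the double cover consist of digons, so vertices joined in one
  direction are joined in both, as \<open>twisted_cycle_uncol_feas\<close> demands.\<close>

lemma even_C_config_uncol_feas:
  assumes W: "W \<subseteq> V" and C: "even_C_configuration (sub_digraph W) X (sub_cover W) f"
  shows "uncol (weight f) W \<and> feas (weight f) W"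
proof -
  let ?g = "weight f"
  obtain n T1 T2 where n: "n \<ge> 4" "even n"
    and iso: "digraph_iso (with_proj (sub_digraph W)) (with_proj (bidirected_cycle n))"
    and T: "transversal (sub_digraph W) X (sub_cover W) T1" "transversal (sub_digraph W) X (sub_cover W) T2"
      "T1 \<inter> T2 = {}"
    and isoH: "digraph_iso (with_proj (sub_cover W) \<restriction> (T1 \<union> T2)) (with_proj (bidirected_cycle (2 * n)))"
    and f: "\<And>x. x \<in> T1 \<union> T2 \<Longrightarrow> f x = (1, 1)" "\<And>x. x \<in> pverts (sub_cover W) - (T1 \<union> T2) \<Longrightarrow> f x = (0, 0)"
    using C unfolding even_C_configuration_def by blast
  obtain h where cyc: "cycle_enum n h W" and dig: "\<And>u v b. u \<in> W \<Longrightarrow> v \<in> W \<Longrightarrow> nb u v \<Longrightarrow> A b u v"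
    using bidirected_cycle_enum[OF W _ iso] n(1) by auto
  have g: "?g b x = 1" if "x \<in> T1 \<union> T2" for b x using f(1)[OF that] by (cases b) (simp_all add: weight_simps)
  have zero: "?g b x = 0" if "v \<in> W" "x \<in> X v" "x \<notin> T1 \<union> T2" for v x b
    by (rule weight_zero, rule f(2)) (use that in \<open>auto simp: sub_cover_simps\<close>)
  have sub: "T1 \<union> T2 \<subseteq> (\<Union>v\<in>W. X v)" using T(1,2) unfolding transversal_sub_iff by blast
  obtain k where k: "bij_betw k {..<2 * n} (T1 \<union> T2)"
    "\<And>i j. i < 2 * n \<Longrightarrow> j < 2 * n \<Longrightarrow>
      (k i, k j) \<in> arcs (with_proj (sub_cover W) \<restriction> (T1 \<union> T2)) \<longleftrightarrow> (i, j) \<in> parcs (bidirected_cycle (2 * n))"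
    using isoH digraph_iso_enum_iff[OF wf_sub_cover_induce pair_wf_bidirected(2)[of "2 * n"]]
    by (auto simp: bidirected_cycle_simps(1))
  have kT: "k i \<in> T1 \<union> T2" if "i < 2 * n" for i using bij_betwE[OF k(1)] that by blast
  have ET: "E True (k i) (k j) \<longleftrightarrow> i \<noteq> j \<and> (j = Suc i mod (2 * n) \<or> i = Suc j mod (2 * n))"
    if "i < 2 * n" "j < 2 * n" for i j
    using k(2)[OF that] sub_cover_arcs[OF sub kT[OF that(1)] kT[OF that(2)]] that
    by (auto simp: bidirected_cycle_simps)
  have Eb: "E b (k i) (k j) \<longleftrightarrow> i \<noteq> j \<and> (j = Suc i mod (2 * n) \<or> i = Suc j mod (2 * n))"
    if "i < 2 * n" "j < 2 * n" for b i j
    using ET[OF that] ET[OF that(2,1)] E_False by (cases b) auto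
  have sym: "E b' x y" if xy: "x \<in> T1 \<union> T2" "y \<in> T1 \<union> T2" "E b x y" for b b' x y
  proof -
    have img: "k ` {..<2 * n} = T1 \<union> T2" using k(1) by (simp add: bij_betw_def)
    obtain i where i: "i < 2 * n" "x = k i" using xy(1) img by blast
    obtain j where j: "j < 2 * n" "y = k j" using xy(2) img by blast
    show ?thesis using Eb[OF i(1) j(1)] xy(3) i j by simp
  qed
  show ?thesis
  proof (rule twisted_cycle_uncol_feas[OF W cyc n(2) T k(1)])
    show "(\<exists>b. E b (k i) (k j)) \<longleftrightarrow> i \<noteq> j \<and> (j = Suc i mod (2 * n) \<or> i = Suc j mod (2 * n))"
      if "i < 2 * n" "j < 2 * n" for i j using Eb[OF that] by blast
    show "E b' x y" if "x \<in> (T1 \<union> T2) \<inter> X u" "y \<in> (T1 \<union> T2) \<inter> X v" "E b x y" for u v x y b b'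
      using sym[of x y b b'] that by blast
    show "?g b x = (if A b u v then 1 else 0)" if "u \<in> W" "v \<in> W" "nb u v" "x \<in> T1 \<union> T2" for u v x b
      using dig[OF that(1-3)] g[OF that(4)] by simp
  qed (use zero in blast)
qed

text \<open>Every vertex is a source or a sink, so its arcs have one direction; the compatibility of
  the two matchings of a digon then holds trivially.\<close>

lemma A_config_uncol_feas:
  assumes W: "W \<subseteq> V" and C: "A_configuration (sub_digraph W) X (sub_cover W) f"
  shows "uncol (weight f) W \<and> feas (weight f) W"
proof -
  let ?g = "weight f" and ?D = "with_proj (sub_digraph W)"
  obtain n T1 T2 where n: "n \<ge> 4" "even n" and anti: "antidirected_cycle n ?D"
    and T: "transversal (sub_digraph W) X (sub_cover W) T1" "transversal (sub_digraph W) X (sub_cover W) T2"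
      "T1 \<inter> T2 = {}"
    and antiH: "antidirected_cycle (2 * n) (with_proj (sub_cover W) \<restriction> (T1 \<union> T2))"
    and f: "\<forall>v\<in>W. \<forall>x\<in>X v. (x \<in> T1 \<union> T2 \<and> is_source ?D v \<longrightarrow> f x = (1, 0)) \<and>
      (x \<in> T1 \<union> T2 \<and> is_sink ?D v \<longrightarrow> f x = (0, 1)) \<and> (x \<notin> T1 \<union> T2 \<longrightarrow> f x = (0, 0))"
    using C unfolding A_configuration_def sub_digraph_simps(1) by blast
  interpret D: pair_digraph "sub_digraph W" using sub_pair_digraph[OF W] .
  have fin: "finite W" using finite_sub[OF W] .
  obtain h where h: "bij_betw h {..<n} W"
    "\<And>i j. i < n \<Longrightarrow> j < n \<Longrightarrow> (h i, h j) \<in> parcs (sub_digraph W) \<or> (h j, h i) \<in> parcs (sub_digraph W) \<longleftrightarrow>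
      i \<noteq> j \<and> (j = Suc i mod n \<or> i = Suc j mod n)"
    using anti digraph_iso_symmetric_enum_iff[OF D.wf_digraph, of n]
    by (auto simp: antidirected_cycle_def sub_digraph_simps(1))
  have "nb (h i) (h j) \<longleftrightarrow> j = Suc i mod n \<or> i = Suc j mod n" if "i < n" "j < n" for i j
  proof -
    have "h i \<in> W" "h j \<in> W" using h(1) that by (auto simp: bij_betw_def)
    then have "nb (h i) (h j) \<longleftrightarrow> (h i, h j) \<in> parcs (sub_digraph W) \<or> (h j, h i) \<in> parcs (sub_digraph W)"
      by (auto simp: nb_def ex_bool_eq A_False sub_digraph_simps)
    moreover have "j = Suc i mod n \<or> i = Suc j mod n \<Longrightarrow> i \<noteq> j"
      using that n by (auto simp: mod_Suc split: if_splits)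
    ultimately show ?thesis using h(2)[OF that] by blast
  qed
  then have cyc: "cycle_enum n h W" using n h(1) unfolding cycle_enum_def by auto
  have src: "is_source ?D v \<longleftrightarrow> (\<forall>u\<in>W. \<not> A False v u)" if "v \<in> W" for v
    using degree_pair_sub[OF that] deg_pos_iff[OF fin, of False v] that
    by (auto simp: is_source_def sub_digraph_simps degree_pair_def)
  have snk: "is_sink ?D v \<longleftrightarrow> (\<forall>u\<in>W. \<not> A True v u)" if "v \<in> W" for v
    using degree_pair_sub[OF that] deg_pos_iff[OF fin, of True v] that
    by (auto simp: is_sink_def sub_digraph_simps degree_pair_def)
  have ss: "is_source ?D v \<or> is_sink ?D v" if "v \<in> W" for v
    using anti that by (simp add: antidirected_cycle_def sub_digraph_simps)
  have one_dir: "b = b'" if "u \<in> W" "v \<in> W" "A b u v" "A b' u v" for u v b b'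
    using ss[OF that(1)] src[OF that(1)] snk[OF that(1)] that by (cases b; cases b') auto
  have g: "?g b x = (if A b u v then 1 else 0)"
    if uv: "u \<in> W" "v \<in> W" "nb u v" and x: "x \<in> X u" "x \<in> T1 \<union> T2" for u v x b
  proof -
    obtain d where d: "A d u v" using uv by (auto simp: nb_def)
    have "A b u v \<longleftrightarrow> b = d" using one_dir[OF uv(1,2) _ d, of b] d by blast
    moreover have "f x = (if d then (1, 0) else (0, 1))"
      using f uv(1) x ss[OF uv(1)] src[OF uv(1)] snk[OF uv(1)] d uv(2) by (cases d) auto
    ultimately show ?thesis by (cases b; cases d) (simp_all add: weight_simps)
  qed
  have zero: "?g b x = 0" if "v \<in> W" "x \<in> X v" "x \<notin> T1 \<union> T2" for v x b
    by (rule weight_zero) (use f that in blast)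
  have sub: "T1 \<union> T2 \<subseteq> (\<Union>v\<in>W. X v)" using T(1,2) unfolding transversal_sub_iff by blast
  obtain k where k: "bij_betw k {..<2 * n} (T1 \<union> T2)"
    "\<And>i j. i < 2 * n \<Longrightarrow> j < 2 * n \<Longrightarrow>
      (k i, k j) \<in> arcs (with_proj (sub_cover W) \<restriction> (T1 \<union> T2)) \<or>
      (k j, k i) \<in> arcs (with_proj (sub_cover W) \<restriction> (T1 \<union> T2)) \<longleftrightarrow>
      i \<noteq> j \<and> (j = Suc i mod (2 * n) \<or> i = Suc j mod (2 * n))"
    using antiH digraph_iso_symmetric_enum_iff[OF wf_sub_cover_induce, where m = "2 * n"]
    by (auto simp: antidirected_cycle_def)
  have kT: "k i \<in> T1 \<union> T2" if "i < 2 * n" for i using bij_betwE[OF k(1)] that by blast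
  show ?thesis
  proof (rule twisted_cycle_uncol_feas[OF W cyc n(2) T k(1)])
    show "(\<exists>b. E b (k i) (k j)) \<longleftrightarrow> i \<noteq> j \<and> (j = Suc i mod (2 * n) \<or> i = Suc j mod (2 * n))"
      if "i < 2 * n" "j < 2 * n" for i j
      using k(2)[OF that] sub_cover_arcs[OF sub kT[OF that(1)] kT[OF that(2)]]
        sub_cover_arcs[OF sub kT[OF that(2)] kT[OF that(1)]] E_False by (simp add: ex_bool_eq)
    show "E b' x y" if uv: "u \<in> W" "v \<in> W" and xy: "x \<in> (T1 \<union> T2) \<inter> X u" "y \<in> (T1 \<union> T2) \<inter> X v"
      and E: "E b x y" "A b' u v" for u v x y b b'
    proof -
      have "A b u v" using E_A[of u v x y b] uv xy E W by blast
      then have "b = b'" using one_dir[OF uv] E(2) by blast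
      then show ?thesis using E(1) by simp
    qed
    show "?g b x = (if A b u v then 1 else 0)"
      if "u \<in> W" "v \<in> W" "nb u v" "x \<in> X u" "x \<in> T1 \<union> T2" for u v x b by (rule g[OF that])
    show "?g b x = 0" if "v \<in> W" "x \<in> X v" "x \<notin> T1 \<union> T2" for v x b by (rule zero[OF that])
  qed
qed

end

section \<open>Base configurations, merging, and the equivalence for digraphs\<close>

lemma uncolorable_iff_uncol:
  assumes D: "pair_digraph D" and cov: "is_cover D X H"
  shows "uncolorable D X H f \<longleftrightarrow> cover_system.uncol X (arc_rel H) (weight f) (pverts D)"
proof -
  interpret cover_system "pverts D" "arc_rel D" X "arc_rel H" using cover_system_of_cover[OF D cov] .
  show ?thesis using uncolorable_sub_iff[OF subset_refl] unfolding sub_digraph_of_cover[OF D cov] .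
qed

lemma degree_feasible_iff_feas:
  assumes D: "pair_digraph D" and cov: "is_cover D X H"
  shows "degree_feasible D X H f \<longleftrightarrow> cover_system.feas (arc_rel D) X (weight f) (pverts D)"
proof -
  interpret cover_system "pverts D" "arc_rel D" X "arc_rel H" using cover_system_of_cover[OF D cov] .
  show ?thesis using degree_feasible_sub_iff[OF subset_refl] unfolding sub_digraph_of_cover[OF D cov] .
qed

lemma base_uncolorable_feasible:
  assumes "configuration D X H f"
    and "M_configuration D X H f \<or> K_configuration D X H f \<or> odd_C_configuration D X H f \<or>
      even_C_configuration D X H f \<or> A_configuration D X H f"
  shows "uncolorable D X H f \<and> degree_feasible D X H f"
proof -
  have D: "pair_digraph D" and cov: "is_cover D X H" using assms(1) by (auto simp: configuration_def)
  interpret cover_system "pverts D" "arc_rel D" X "arc_rel H" using cover_system_of_cover[OF D cov] .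
  note base = M_config_uncol_feas K_config_uncol_feas odd_C_config_uncol_feas even_C_config_uncol_feas
    A_config_uncol_feas
  have "uncol (weight f) (pverts D) \<and> feas (weight f) (pverts D)"
    using assms(2) base[OF subset_refl, unfolded sub_digraph_of_cover[OF D cov]] by blast
  then show ?thesis using uncolorable_iff_uncol[OF D cov] degree_feasible_iff_feas[OF D cov] by blast
qed

lemma card_image_filter_le:
  assumes "inj_on i U" "finite U" "\<And>u. u \<in> U \<Longrightarrow> P u \<Longrightarrow> Q (i u)"
  shows "card {u \<in> U. P u} \<le> card {w \<in> i ` U. Q w}"
proof -
  have "card {u \<in> U. P u} = card (i ` {u \<in> U. P u})"
    using assms(1) by (intro card_image[symmetric]) (auto intro: inj_on_subset)
  also have "\<dots> \<le> card {w \<in> i ` U. Q w}" using assms(2,3) by (intro card_mono) auto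
  finally show ?thesis .
qed

lemma arc_rel_image:
  assumes "parcs G = map_prod i i ` parcs G1 \<union> R" "arc_rel G1 b x y"
  shows "arc_rel G b (i x) (i y)"
  using assms by (cases b) (auto simp: arc_rel_def)

text \<open>A colouring of the merged cover restricts to both parts, and each part has a set,
  \<open>U1\<close> or \<open>U2\<close>, without a witness. A set that avoids the common vertex
  fails in the whole cover too. If both contain it, their union fails, since at the common vertex
  the weights add up and so do the counts. Degree-feasibility follows as degrees at the common
  vertex are at most the sums.\<close>

lemma merging_uncolorable_feasible:
  assumes conf1: "configuration D1 X1 H1 f1" and conf2: "configuration D2 X2 H2 f2"
    and conf: "configuration D X H f" and mer: "merging D1 X1 H1 f1 D2 X2 H2 f2 D X H f"
    and un: "uncolorable D1 X1 H1 f1" "uncolorable D2 X2 H2 f2"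
    and fe: "degree_feasible D1 X1 H1 f1" "degree_feasible D2 X2 H2 f2"
  shows "uncolorable D X H f \<and> degree_feasible D X H f"
proof -
  have D1: "pair_digraph D1" and c1: "is_cover D1 X1 H1" using conf1 by (auto simp: configuration_def)
  have D2: "pair_digraph D2" and c2: "is_cover D2 X2 H2" using conf2 by (auto simp: configuration_def)
  have D: "pair_digraph D" and c: "is_cover D X H" using conf by (auto simp: configuration_def)
  interpret C1: cover_system "pverts D1" "arc_rel D1" X1 "arc_rel H1" using cover_system_of_cover[OF D1 c1] .
  interpret C2: cover_system "pverts D2" "arc_rel D2" X2 "arc_rel H2" using cover_system_of_cover[OF D2 c2] .
  interpret C: cover_system "pverts D" "arc_rel D" X "arc_rel H" using cover_system_of_cover[OF D c] .
  let ?g1 = "weight f1" and ?g2 = "weight f2" and ?g = "weight f"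
  have u1: "C1.uncol ?g1 (pverts D1)" and u2: "C2.uncol ?g2 (pverts D2)"
    using un uncolorable_iff_uncol[OF D1 c1] uncolorable_iff_uncol[OF D2 c2] by auto
  have fe1: "C1.feas ?g1 (pverts D1)" and fe2: "C2.feas ?g2 (pverts D2)"
    using fe degree_feasible_iff_feas[OF D1 c1] degree_feasible_iff_feas[OF D2 c2] by auto
  obtain v1 v2 \<pi> i1 i2 j1 j2 where v: "v1 \<in> pverts D1" "v2 \<in> pverts D2"
    and idD: "identification i1 D1 i2 D2 {(v1, v2)} D"
    and \<pi>: "bij_betw \<pi> (X1 v1) (X2 v2)"
    and idH: "identification j1 H1 j2 H2 {(x, \<pi> x) | x. x \<in> X1 v1} H"
    and X: "\<And>u. u \<in> pverts D1 \<Longrightarrow> X (i1 u) = j1 ` X1 u" "\<And>u. u \<in> pverts D2 \<Longrightarrow> X (i2 u) = j2 ` X2 u"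
    and f: "\<And>x. x \<in> pverts H1 - X1 v1 \<Longrightarrow> f (j1 x) = f1 x" "\<And>y. y \<in> pverts H2 - X2 v2 \<Longrightarrow> f (j2 y) = f2 y"
      "\<And>x. x \<in> X1 v1 \<Longrightarrow> f (j1 x) = f1 x + f2 (\<pi> x)"
    using mer unfolding merging_def by auto
  have iD: "inj_on i1 (pverts D1)" "inj_on i2 (pverts D2)"
    "\<And>x y. x \<in> pverts D1 \<Longrightarrow> y \<in> pverts D2 \<Longrightarrow> i1 x = i2 y \<longleftrightarrow> x = v1 \<and> y = v2"
    "pverts D = i1 ` pverts D1 \<union> i2 ` pverts D2"
    "parcs D = map_prod i1 i1 ` parcs D1 \<union> map_prod i2 i2 ` parcs D2"
    using idD unfolding identification_def by auto
  have iH: "inj_on j1 (pverts H1)" "inj_on j2 (pverts H2)"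
    "\<And>x y. x \<in> pverts H1 \<Longrightarrow> y \<in> pverts H2 \<Longrightarrow> j1 x = j2 y \<longleftrightarrow> x \<in> X1 v1 \<and> y = \<pi> x"
    "parcs H = map_prod j1 j1 ` parcs H1 \<union> map_prod j2 j2 ` parcs H2"
    using idH unfolding identification_def by auto
  have H1: "X1 u \<subseteq> pverts H1" if "u \<in> pverts D1" for u using c1 that unfolding is_cover_def by blast
  have H2: "X2 u \<subseteq> pverts H2" if "u \<in> pverts D2" for u using c2 that unfolding is_cover_def by blast
  have E1: "arc_rel H1 b x y \<Longrightarrow> arc_rel H b (j1 x) (j1 y)" for b x y using arc_rel_image[OF iH(4)] .
  have E2: "arc_rel H2 b x y \<Longrightarrow> arc_rel H b (j2 x) (j2 y)" for b x y
    using arc_rel_image[of H j2 H2 "map_prod j1 j1 ` parcs H1"] iH(4) by (simp add: Un_commute)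
  have star: "i1 v1 = i2 v2" using iD(3)[OF v] by simp
  have g1: "?g b (j1 x) = ?g1 b x" if "u \<in> pverts D1" "u \<noteq> v1" "x \<in> X1 u" for u x b
  proof -
    have "x \<notin> X1 v1" using C1.X_disjoint[OF that(1) v(1) that(3)] that(2) by blast
    then show ?thesis using f(1)[of x] H1[OF that(1)] that(3) by (auto simp: weight_def)
  qed
  have g2: "?g b (j2 x) = ?g2 b x" if "u \<in> pverts D2" "u \<noteq> v2" "x \<in> X2 u" for u x b
  proof -
    have "x \<notin> X2 v2" using C2.X_disjoint[OF that(1) v(2) that(3)] that(2) by blast
    then show ?thesis using f(2)[of x] H2[OF that(1)] that(3) by (auto simp: weight_def)
  qed
  have gs: "?g b (j1 x) = ?g1 b x + ?g2 b (\<pi> x)" if "x \<in> X1 v1" for x b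
    using f(3)[OF that] by (simp add: weight_def)
  have finD: "finite (pverts D1)" "finite (pverts D2)" "finite (pverts D)"
    using C1.finite_V C2.finite_V C.finite_V by auto
  have "\<not> C.col ?g (pverts D) \<phi>" for \<phi>
  proof
    assume col: "C.col ?g (pverts D) \<phi>"
    have "\<exists>x\<in>X1 u. \<phi> (i1 u) = j1 x" if "u \<in> pverts D1" for u
      using C.col_range[OF col, of "i1 u"] X(1)[OF that] iD(4) that by auto
    then obtain \<phi>1 where \<phi>1: "\<And>u. u \<in> pverts D1 \<Longrightarrow> \<phi>1 u \<in> X1 u" "\<And>u. u \<in> pverts D1 \<Longrightarrow> \<phi> (i1 u) = j1 (\<phi>1 u)"
      by metis
    have "\<exists>x\<in>X2 u. \<phi> (i2 u) = j2 x" if "u \<in> pverts D2" for u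
      using C.col_range[OF col, of "i2 u"] X(2)[OF that] iD(4) that by auto
    then obtain \<phi>2 where \<phi>2: "\<And>u. u \<in> pverts D2 \<Longrightarrow> \<phi>2 u \<in> X2 u" "\<And>u. u \<in> pverts D2 \<Longrightarrow> \<phi> (i2 u) = j2 (\<phi>2 u)"
      by metis
    have \<pi>\<phi>: "\<phi>2 v2 = \<pi> (\<phi>1 v1)"
      using iH(3)[of "\<phi>1 v1" "\<phi>2 v2"] \<phi>1[OF v(1)] \<phi>2[OF v(2)] H1[OF v(1)] H2[OF v(2)] star by auto
    obtain U1 where U1: "U1 \<subseteq> pverts D1" "U1 \<noteq> {}" "\<And>u b. u \<in> U1 \<Longrightarrow> ?g1 b (\<phi>1 u) \<le> C1.cnt b U1 \<phi>1 (\<phi>1 u)"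
      using u1 \<phi>1(1) unfolding C1.uncol_def C1.col_def by (meson not_less)
    obtain U2 where U2: "U2 \<subseteq> pverts D2" "U2 \<noteq> {}" "\<And>u b. u \<in> U2 \<Longrightarrow> ?g2 b (\<phi>2 u) \<le> C2.cnt b U2 \<phi>2 (\<phi>2 u)"
      using u2 \<phi>2(1) unfolding C2.uncol_def C2.col_def by (meson not_less)
    have fin: "finite U1" "finite U2"
      using finite_subset[OF U1(1) finD(1)] finite_subset[OF U2(1) finD(2)] by auto
    have inj: "inj_on i1 U1" "inj_on i2 U2" using iD U1 U2 by (auto intro: inj_on_subset)
    \<comment> \<open>An inequality suffices: further arcs only take witnesses away.\<close>
    have cnt1: "C1.cnt b U1 \<phi>1 (\<phi>1 u) \<le> C.cnt b (i1 ` U1) \<phi> (\<phi> (i1 u))" if "u \<in> U1" for u b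
      unfolding C1.cnt_def C.cnt_def
    proof (rule card_image_filter_le[OF inj(1) fin(1)])
      fix w assume w: "w \<in> U1" "arc_rel H1 b (\<phi>1 u) (\<phi>1 w)"
      have "u \<in> pverts D1" "w \<in> pverts D1" using U1(1) that w(1) by auto
      then show "arc_rel H b (\<phi> (i1 u)) (\<phi> (i1 w))"
        unfolding \<phi>1(2)[OF \<open>u \<in> pverts D1\<close>] \<phi>1(2)[OF \<open>w \<in> pverts D1\<close>] by (intro E1 w(2))
    qed
    have cnt2: "C2.cnt b U2 \<phi>2 (\<phi>2 u) \<le> C.cnt b (i2 ` U2) \<phi> (\<phi> (i2 u))" if "u \<in> U2" for u b
      unfolding C2.cnt_def C.cnt_def
    proof (rule card_image_filter_le[OF inj(2) fin(2)])
      fix w assume w: "w \<in> U2" "arc_rel H2 b (\<phi>2 u) (\<phi>2 w)"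
      have "u \<in> pverts D2" "w \<in> pverts D2" using U2(1) that w(1) by auto
      then show "arc_rel H b (\<phi> (i2 u)) (\<phi> (i2 w))"
        unfolding \<phi>2(2)[OF \<open>u \<in> pverts D2\<close>] \<phi>2(2)[OF \<open>w \<in> pverts D2\<close>] by (intro E2 w(2))
    qed
    have sub: "i1 ` U1 \<subseteq> pverts D" "i2 ` U2 \<subseteq> pverts D" using U1 U2 iD(4) by auto
    have le1: "?g b (\<phi> (i1 u)) \<le> C.cnt b (i1 ` U1) \<phi> (\<phi> (i1 u))" if u: "u \<in> U1" "u \<noteq> v1" for u b
    proof -
      have "u \<in> pverts D1" using u U1 by blast
      then have "?g b (\<phi> (i1 u)) = ?g1 b (\<phi>1 u)" using g1[OF _ u(2)] \<phi>1 by simp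
      then show ?thesis using U1(3)[OF u(1), of b] cnt1[OF u(1), of b] by simp
    qed
    have le2: "?g b (\<phi> (i2 u)) \<le> C.cnt b (i2 ` U2) \<phi> (\<phi> (i2 u))" if u: "u \<in> U2" "u \<noteq> v2" for u b
    proof -
      have "u \<in> pverts D2" using u U2 by blast
      then have "?g b (\<phi> (i2 u)) = ?g2 b (\<phi>2 u)" using g2[OF _ u(2)] \<phi>2 by simp
      then show ?thesis using U2(3)[OF u(1), of b] cnt2[OF u(1), of b] by simp
    qed
    have bad: False if "U \<subseteq> pverts D" "U \<noteq> {}" "\<And>w b. w \<in> U \<Longrightarrow> ?g b (\<phi> w) \<le> C.cnt b U \<phi> (\<phi> w)" for U
      using col that unfolding C.col_def by (meson not_less)
    show False
    proof (cases "v1 \<in> U1 \<and> v2 \<in> U2")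
      case False
      then consider "v1 \<notin> U1" | "v2 \<notin> U2" by blast
      then show False
      proof cases
        case 1
        show False by (rule bad[OF sub(1)]) (use U1(2) le1 1 in auto)
      next
        case 2
        show False by (rule bad[OF sub(2)]) (use U2(2) le2 2 in auto)
      qed
    next
      case True
      let ?U = "i1 ` U1 \<union> i2 ` U2"
      have finU: "finite ?U" using fin by simp
      show False
      proof (rule bad)
        show "?U \<subseteq> pverts D" "?U \<noteq> {}" using sub U1(2) by auto
        fix w b assume w: "w \<in> ?U"
        show "?g b (\<phi> w) \<le> C.cnt b ?U \<phi> (\<phi> w)"
        proof (cases "w = i1 v1")
          case w1: True
          have "?g b (\<phi> w) = ?g1 b (\<phi>1 v1) + ?g2 b (\<phi>2 v2)"
            using gs[of "\<phi>1 v1" b] \<phi>1[OF v(1)] \<pi>\<phi> w1 by simp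
          also have "\<dots> \<le> C.cnt b (i1 ` U1) \<phi> (\<phi> w) + C.cnt b (i2 ` U2) \<phi> (\<phi> w)"
            using U1(3)[of v1 b] U2(3)[of v2 b] cnt1[of v1 b] cnt2[of v2 b] True w1 star by simp
          also have "\<dots> = card ({u \<in> i1 ` U1. arc_rel H b (\<phi> w) (\<phi> u)} \<union> {u \<in> i2 ` U2. arc_rel H b (\<phi> w) (\<phi> u)})"
            unfolding C.cnt_def
          proof (rule card_Un_disjoint[symmetric])
            \<comment> \<open>The two images meet at most in the common vertex, and no vertex of
              \<open>H\<close> is joined to itself, so nothing is counted twice.\<close>
            show "{u \<in> i1 ` U1. arc_rel H b (\<phi> w) (\<phi> u)} \<inter> {u \<in> i2 ` U2. arc_rel H b (\<phi> w) (\<phi> u)} = {}"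
            proof (rule ccontr)
              assume "\<not> ?thesis"
              then obtain a1 a2 where a: "a1 \<in> U1" "a2 \<in> U2" "i1 a1 = i2 a2" "arc_rel H b (\<phi> w) (\<phi> (i1 a1))" by auto
              then have "a1 = v1" using iD(3)[of a1 a2] U1(1) U2(1) by blast
              then have "arc_rel H b (\<phi> w) (\<phi> w)" using a w1 by simp
              moreover have "w \<in> pverts D" using w sub by blast
              ultimately show False using C.E_irrefl C.col_range[OF col] by blast
            qed
          qed (use fin in auto)
          also have "\<dots> = C.cnt b ?U \<phi> (\<phi> w)"
            unfolding C.cnt_def by (rule arg_cong[of _ _ card]) auto
          finally show ?thesis .
        next
          case w1: False
          have mono: "C.cnt b (i1 ` U1) \<phi> (\<phi> w) \<le> C.cnt b ?U \<phi> (\<phi> w)"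
            "C.cnt b (i2 ` U2) \<phi> (\<phi> w) \<le> C.cnt b ?U \<phi> (\<phi> w)"
            using C.cnt_mono[OF finU] by auto
          from w consider u where "u \<in> U1" "w = i1 u" | u where "u \<in> U2" "w = i2 u" by blast
          then show ?thesis
          proof cases
            case 1
            then have "u \<noteq> v1" using w1 by blast
            then show ?thesis using le1[OF 1(1), of b] 1 mono(1) by simp
          next
            case 2
            then have "u \<noteq> v2" using w1 star by auto
            then show ?thesis using le2[OF 2(1), of b] 2 mono(2) by simp
          qed
        qed
      qed
    qed
  qed
  then have "C.uncol ?g (pverts D)" by (simp add: C.uncol_def)
  moreover have "C.feas ?g (pverts D)"
    unfolding C.feas_def
  proof (intro ballI allI)
    fix w b assume w: "w \<in> pverts D"
    \<comment> \<open>Every arc at \<open>w\<close> comes from one of the parts. Only this inclusion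
      is shown, as the degree has to be bounded from above.\<close>
    have nbr: "z \<in> i1 ` {u \<in> pverts D1. \<exists>u'\<in>pverts D1. w = i1 u' \<and> arc_rel D1 b u' u} \<union>
        i2 ` {u \<in> pverts D2. \<exists>u'\<in>pverts D2. w = i2 u' \<and> arc_rel D2 b u' u}"
      if z: "arc_rel D b w z" for z
    proof -
      interpret D1: pair_digraph D1 by (rule D1)
      interpret D2: pair_digraph D2 by (rule D2)
      have "(if b then (w, z) else (z, w)) \<in> parcs D" using z by (simp add: arc_rel_def split: if_splits)
      then consider a a' where "(a, a') \<in> parcs D1" "(if b then (w, z) else (z, w)) = (i1 a, i1 a')"
        | a a' where "(a, a') \<in> parcs D2" "(if b then (w, z) else (z, w)) = (i2 a, i2 a')"
        unfolding iD(5) by auto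
      then show ?thesis
      proof cases
        case 1
        then have m: "a \<in> pverts D1" "a' \<in> pverts D1" using D1.in_arcsD1 D1.in_arcsD2 by auto
        show ?thesis
        proof (cases b)
          case True
          then have "z = i1 a'" "w = i1 a" "arc_rel D1 b a a'" using 1 by (auto simp: arc_rel_def)
          then show ?thesis using m by blast
        next
          case False
          then have "z = i1 a" "w = i1 a'" "arc_rel D1 b a' a" using 1 by (auto simp: arc_rel_def)
          then show ?thesis using m by blast
        qed
      next
        case 2
        then have m: "a \<in> pverts D2" "a' \<in> pverts D2" using D2.in_arcsD1 D2.in_arcsD2 by auto
        show ?thesis
        proof (cases b)
          case True
          then have "z = i2 a'" "w = i2 a" "arc_rel D2 b a a'" using 2 by (auto simp: arc_rel_def)
          then show ?thesis using m by blast
        next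
          case False
          then have "z = i2 a" "w = i2 a'" "arc_rel D2 b a' a" using 2 by (auto simp: arc_rel_def)
          then show ?thesis using m by blast
        qed
      qed
    qed
    have sum1: "(\<Sum>x\<in>X (i1 u). h x) = (\<Sum>x\<in>X1 u. h (j1 x))" if "u \<in> pverts D1" for u and h :: "_ \<Rightarrow> nat"
    proof -
      have "inj_on j1 (X1 u)" using iH(1) H1[OF that] by (rule inj_on_subset)
      then show ?thesis unfolding X(1)[OF that] by (simp add: sum.reindex)
    qed
    have sum2: "(\<Sum>x\<in>X (i2 u). h x) = (\<Sum>x\<in>X2 u. h (j2 x))" if "u \<in> pverts D2" for u and h :: "_ \<Rightarrow> nat"
    proof -
      have "inj_on j2 (X2 u)" using iH(2) H2[OF that] by (rule inj_on_subset)
      then show ?thesis unfolding X(2)[OF that] by (simp add: sum.reindex)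
    qed
    have deg1: "card (i1 ` {u \<in> pverts D1. arc_rel D1 b a u}) \<le> (\<Sum>x\<in>X1 a. ?g1 b x)" if a: "a \<in> pverts D1" for a
    proof -
      have "card (i1 ` {u \<in> pverts D1. arc_rel D1 b a u}) \<le> C1.deg b (pverts D1) a"
        unfolding C1.deg_def using finD by (intro card_image_le) auto
      then show ?thesis using fe1 a unfolding C1.feas_def by (meson order_trans)
    qed
    have deg2: "card (i2 ` {u \<in> pverts D2. arc_rel D2 b a u}) \<le> (\<Sum>x\<in>X2 a. ?g2 b x)" if a: "a \<in> pverts D2" for a
    proof -
      have "card (i2 ` {u \<in> pverts D2. arc_rel D2 b a u}) \<le> C2.deg b (pverts D2) a"
        unfolding C2.deg_def using finD by (intro card_image_le) auto
      then show ?thesis using fe2 a unfolding C2.feas_def by (meson order_trans)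
    qed
    have "(\<exists>a\<in>pverts D1. w = i1 a) \<or> (\<exists>a\<in>pverts D2. w = i2 a)" using w iD(4) by auto
    then consider "w = i1 v1" | a where "a \<in> pverts D1" "a \<noteq> v1" "w = i1 a" | a where "a \<in> pverts D2" "a \<noteq> v2" "w = i2 a"
      using star by metis
    then show "C.deg b (pverts D) w \<le> (\<Sum>x\<in>X w. ?g b x)"
    proof cases
      case 1
      let ?N1 = "i1 ` {u \<in> pverts D1. arc_rel D1 b v1 u}" and ?N2 = "i2 ` {u \<in> pverts D2. arc_rel D2 b v2 u}"
      have e1: "u' = v1" if "u' \<in> pverts D1" "w = i1 u'" for u' using inj_onD[OF iD(1)] that v(1) 1 by metis
      have e2: "u' = v2" if "u' \<in> pverts D2" "w = i2 u'" for u' using inj_onD[OF iD(2)] that v(2) 1 star by metis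
      have "{z \<in> pverts D. arc_rel D b w z} \<subseteq> ?N1 \<union> ?N2"
        using nbr e1 e2 by fast
      then have "C.deg b (pverts D) w \<le> card (?N1 \<union> ?N2)"
        unfolding C.deg_def using finD by (intro card_mono) auto
      also have "\<dots> \<le> card ?N1 + card ?N2" by (rule card_Un_le)
      also have "\<dots> \<le> (\<Sum>x\<in>X1 v1. ?g1 b x) + (\<Sum>x\<in>X2 v2. ?g2 b x)" using deg1[OF v(1)] deg2[OF v(2)] by simp
      also have "(\<Sum>x\<in>X2 v2. ?g2 b x) = (\<Sum>x\<in>X1 v1. ?g2 b (\<pi> x))" using sum.reindex_bij_betw[OF \<pi>] by metis
      also have "(\<Sum>x\<in>X1 v1. ?g1 b x) + \<dots> = (\<Sum>x\<in>X1 v1. ?g b (j1 x))"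
        unfolding sum.distrib[symmetric] using gs by (intro sum.cong) auto
      also have "\<dots> = (\<Sum>x\<in>X w. ?g b x)" using sum1[OF v(1)] 1 by simp
      finally show ?thesis .
    next
      case 2
      have e1: "u' = a" if "u' \<in> pverts D1" "w = i1 u'" for u' using inj_onD[OF iD(1)] that 2 by metis
      have e2: "w \<noteq> i2 u'" if "u' \<in> pverts D2" for u' using iD(3)[OF 2(1) that] 2 by simp
      have "{z \<in> pverts D. arc_rel D b w z} \<subseteq> i1 ` {u \<in> pverts D1. arc_rel D1 b a u}"
        using nbr e1 e2 by fast
      then have "C.deg b (pverts D) w \<le> card (i1 ` {u \<in> pverts D1. arc_rel D1 b a u})"
        unfolding C.deg_def using finD by (intro card_mono) auto
      also have "\<dots> \<le> (\<Sum>x\<in>X1 a. ?g1 b x)" using deg1[OF 2(1)] .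
      also have "\<dots> = (\<Sum>x\<in>X1 a. ?g b (j1 x))" using g1[OF 2(1,2)] by (intro sum.cong) auto
      also have "\<dots> = (\<Sum>x\<in>X w. ?g b x)" using sum1[OF 2(1)] 2 by simp
      finally show ?thesis .
    next
      case 3
      have e2: "u' = a" if "u' \<in> pverts D2" "w = i2 u'" for u' using inj_onD[OF iD(2)] that 3 by metis
      have e1: "w \<noteq> i1 u'" if "u' \<in> pverts D1" for u' using iD(3)[OF that 3(1)] 3 by auto
      have "{z \<in> pverts D. arc_rel D b w z} \<subseteq> i2 ` {u \<in> pverts D2. arc_rel D2 b a u}"
        using nbr e1 e2 by fast
      then have "C.deg b (pverts D) w \<le> card (i2 ` {u \<in> pverts D2. arc_rel D2 b a u})"
        unfolding C.deg_def using finD by (intro card_mono) auto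
      also have "\<dots> \<le> (\<Sum>x\<in>X2 a. ?g2 b x)" using deg2[OF 3(1)] .
      also have "\<dots> = (\<Sum>x\<in>X2 a. ?g b (j2 x))" using g2[OF 3(1,2)] by (intro sum.cong) auto
      also have "\<dots> = (\<Sum>x\<in>X w. ?g b x)" using sum2[OF 3(1)] 3 by simp
      finally show ?thesis .
    qed
  qed
  ultimately show ?thesis using uncolorable_iff_uncol[OF D c] degree_feasible_iff_feas[OF D c] by blast
qed

lemma constructible_uncolorable_feasible:
  "constructible D X H f \<Longrightarrow> configuration D X H f \<and> uncolorable D X H f \<and> degree_feasible D X H f"
proof (induction rule: constructible.induct)
  case (merge D1 X1 H1 f1 D2 X2 H2 f2 D X H f)
  then show ?case using merging_uncolorable_feasible by blast
next
  case (M D X H f)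
  then have "configuration D X H f" by (simp add: M_configuration_def)
  then show ?case using base_uncolorable_feasible M by blast
next
  case (K D X H f)
  then have "configuration D X H f" by (simp add: K_configuration_def)
  then show ?case using base_uncolorable_feasible K by blast
next
  case (odd_C D X H f)
  then have "configuration D X H f" by (simp add: odd_C_configuration_def)
  then show ?case using base_uncolorable_feasible odd_C by blast
next
  case (even_C D X H f)
  then have "configuration D X H f" by (simp add: even_C_configuration_def)
  then show ?case using base_uncolorable_feasible even_C by blast
next
  case (A D X H f)
  then have "configuration D X H f" by (simp add: A_configuration_def)
  then show ?case using base_uncolorable_feasible A by blast
qed

text \<open>Nonemptiness of \<open>H\<close> excludes one degenerate case: a single vertex with an
  empty fibre is uncolorable and degree-feasible, but offers no transversal for a base
  configuration.\<close>

theorem theorem14: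
  fixes D :: "'a pair_pre_digraph"
    and X :: "'a \<Rightarrow> 'b set"
    and H :: "'b pair_pre_digraph"
    and f :: "'b \<Rightarrow> nat \<times> nat"
  assumes "pair_digraph D"
    and "Digraph_Component.connected (with_proj D)"
    and "is_cover D X H"
    and "pverts H \<noteq> {}"
  shows "uncolorable D X H f \<and> degree_feasible D X H f \<longleftrightarrow> constructible D X H f"
proof
  assume uf: "uncolorable D X H f \<and> degree_feasible D X H f"
  interpret cover_system "pverts D" "arc_rel D" X "arc_rel H" using cover_system_of_cover[OF assms(1,3)] .
  note sub = sub_digraph_of_cover[OF assms(1,3)]
  have un: "uncol (weight f) (pverts D)" and fe: "feas (weight f) (pverts D)"
    using uf uncolorable_iff_uncol[OF assms(1,3)] degree_feasible_iff_feas[OF assms(1,3)] by auto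
  have con: "conn (pverts D)" using connected_sub_iff[OF subset_refl] assms(2) unfolding sub by blast
  \<comment> \<open>An empty fibre has total weight 0, so its vertex is isolated; by connectivity it
    is the only vertex, and \<open>H\<close> would be empty.\<close>
  have "X v \<noteq> {}" if v: "v \<in> pverts D" for v
  proof
    assume empty: "X v = {}"
    have "\<not> nb v u" if "u \<in> pverts D" for u
    proof
      assume "nb v u"
      then obtain b where "arc_rel D b v u" by (auto simp: nb_def)
      then have "0 < deg b (pverts D) v" using deg_pos_iff[OF finite_V] that by blast
      moreover have "deg b (pverts D) v \<le> (\<Sum>x\<in>X v. weight f b x)" using fe v by (simp add: feas_def)
      ultimately show False using empty by simp
    qed
    then have "pverts D = {v}" using conn_neighbour[OF con v] by blast
    moreover have "(\<Union>v\<in>pverts D. X v) = pverts H" using assms(3) by (simp add: is_cover_def)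
    ultimately show False using empty assms(4) by simp
  qed
  then show "constructible D X H f"
    using constructible_sub[OF subset_refl con fe un] unfolding sub by blast
next
  assume "constructible D X H f"
  then show "uncolorable D X H f \<and> degree_feasible D X H f" using constructible_uncolorable_feasible by blast
qed

end
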